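(* Let $p\ge 3$ be a prime and $n\ge 1$ an integer. Let $\mathbf G$ be one of $\mathbf{SL}_2$, $\mathbf{SL}_k$ with $k\ge 3$, or $\mathbf{Sp}_{2k}$ with $k\ge 2$, and let $h(\mathbf G,p)$ and $h_f(\mathbf G,p,n)$ be defined by \[ \begin{array}{c|c|c} \mathbf G & h(\mathbf G,p) & h_f(\mathbf G,p,n)\\ \hline \mathbf{SL}_2 & \frac12(p-1) & \frac12(p^n-p^{n-1})\\ \mathbf{SL}_k\ (k\ge 3) & p^{k-1}-p^{k-2} & (p^n-p^{n-1})p^{(k-2)n}\\ \mathbf{Sp}_{2k}\ (k\ge 2) & \frac12(p-1)p^{k-1} & \frac12(p^n-p^{n-1})p^{(k-1)n} \end{array} \] Then every non-trivial representation of $\mathbf G(\mathbb Z/p^n\mathbb Z)$ has degree at least $h(\mathbf G,p)$ and every faithful representation of $\mathbf G(\mathbb Z/p^n\mathbb Z)$ has degree at least $h_f(\mathbf G,p,n)$; that is, \[ m(\mathbf G(\mathbb Z/p^n\mathbb Z))\ge h(\mathbf G,p),\qquad m_f(\mathbf G(\mathbb Z/p^n\mathbb Z))\ge h_f(\mathbf G,p,n). \] In particular, there is an absolute constant $c>0$ such that $m(\mathbf G(\mathbb Z/p^n\mathbb Z))\ge c\,p^r$ for all such $\mathbf G,p,n$, where $r$ is the rank of $\mathbf G$ (that is, $r=1$ for $\mathbf{SL}_2$, $r=k-1$ for $\mathbf{SL}_k$, $r=k$ for $\mathbf{Sp}_{2k}$).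
   Context: Representations are finite-dimensional and complex. For a group $G$, $m(G)$ is the smallest degree (dimension) of a non-trivial complex representation of $G$, and $m_f(G)$ is the smallest degree of a faithful complex representation of $G$ (a representation with trivial kernel). A representation is non-trivial if it is not the constant homomorphism to the identity. For a commutative ring $R$, $\mathbf{SL}_k(R)$ is the group of $k\times k$ matrices over $R$ of determinant $1$, and $\mathbf{Sp}_{2k}(R)=\{A\in \mathrm{GL}_{2k}(R): AJA^T=J\}$, where $J=\begin{pmatrix}0&I_k\\-I_k&0\end{pmatrix}$. *)

theory Defs
  imports "Jordan_Normal_Form.Determinant" "HOL-Number_Theory.Residues"
begin

section \<open>Matrices over a ring given by its carrier\<close>

text \<open>
  The library's matrix product and determinant need the coefficient ring to be a type.
  Here the ring has to be \<open>residue_ring (p ^ n)\<close> with \<open>p\<close> and \<open>n\<close> quantified inside a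
  formula, so product and determinant are defined relative to a ring record.
\<close>

definition mat_over :: "('a, 'r) ring_scheme \<Rightarrow> nat \<Rightarrow> 'a mat monoid" where
  "mat_over R k =
    \<lparr>carrier = {A \<in> carrier_mat k k. \<forall>i<k. \<forall>j<k. A $$ (i, j) \<in> carrier R},
     monoid.mult = (\<lambda>A B. mat k k (\<lambda>(i, j). \<Oplus>\<^bsub>R\<^esub>l\<in>{0..<k}. A $$ (i, l) \<otimes>\<^bsub>R\<^esub> B $$ (l, j))),
     one = mat k k (\<lambda>(i, j). if i = j then \<one>\<^bsub>R\<^esub> else \<zero>\<^bsub>R\<^esub>)\<rparr>"

definition det_over :: "('a, 'r) ring_scheme \<Rightarrow> nat \<Rightarrow> 'a mat \<Rightarrow> 'a" where
  "det_over R k A =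
    (\<Oplus>\<^bsub>R\<^esub>\<pi>\<in>{\<pi>. \<pi> permutes {0..<k}}.
      (if evenperm \<pi> then \<one>\<^bsub>R\<^esub> else \<ominus>\<^bsub>R\<^esub> \<one>\<^bsub>R\<^esub>) \<otimes>\<^bsub>R\<^esub> (\<Otimes>\<^bsub>R\<^esub>i\<in>{0..<k}. A $$ (i, \<pi> i)))"

definition GL_over :: "('a, 'r) ring_scheme \<Rightarrow> nat \<Rightarrow> 'a mat monoid" where
  "GL_over R k = units_of (mat_over R k)"

definition SL_over :: "('a, 'r) ring_scheme \<Rightarrow> nat \<Rightarrow> 'a mat monoid" where
  "SL_over R k =
    (mat_over R k)\<lparr>carrier := {A \<in> carrier (mat_over R k). det_over R k A = \<one>\<^bsub>R\<^esub>}\<rparr>"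

definition J_over :: "('a, 'r) ring_scheme \<Rightarrow> nat \<Rightarrow> 'a mat" where
  "J_over R k = mat (2 * k) (2 * k)
    (\<lambda>(i, j). if j = i + k then \<one>\<^bsub>R\<^esub> else if i = j + k then \<ominus>\<^bsub>R\<^esub> \<one>\<^bsub>R\<^esub> else \<zero>\<^bsub>R\<^esub>)"

text \<open>The second argument is half the matrix size: \<open>Sp_over R k\<close> is $\mathbf{Sp}_{2k}(R)$.\<close>

definition Sp_over :: "('a, 'r) ring_scheme \<Rightarrow> nat \<Rightarrow> 'a mat monoid" where
  "Sp_over R k =
    (GL_over R (2 * k))\<lparr>carrier := {A \<in> carrier (GL_over R (2 * k)).
      A \<otimes>\<^bsub>mat_over R (2 * k)\<^esub> J_over R k \<otimes>\<^bsub>mat_over R (2 * k)\<^esub> transpose_mat A = J_over R k}\<rparr>"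


section \<open>Finite-dimensional complex representations\<close>

definition GL_complex :: "nat \<Rightarrow> complex mat monoid" where
  "GL_complex d = units_of (ring_mat TYPE(complex) d ())"

definition representation :: "('g, 'm) monoid_scheme \<Rightarrow> nat \<Rightarrow> ('g \<Rightarrow> complex mat) \<Rightarrow> bool" where
  "representation G d \<rho> \<longleftrightarrow> \<rho> \<in> hom G (GL_complex d)"

definition nontrivial_rep :: "('g, 'm) monoid_scheme \<Rightarrow> nat \<Rightarrow> ('g \<Rightarrow> complex mat) \<Rightarrow> bool" where
  "nontrivial_rep G d \<rho> \<longleftrightarrow>
    representation G d \<rho> \<and> \<not> (\<forall>g\<in>carrier G. \<rho> g = \<one>\<^bsub>GL_complex d\<^esub>)"

definition faithful_rep :: "('g, 'm) monoid_scheme \<Rightarrow> nat \<Rightarrow> ('g \<Rightarrow> complex mat) \<Rightarrow> bool" where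
  "faithful_rep G d \<rho> \<longleftrightarrow>
    representation G d \<rho> \<and> kernel G (GL_complex d) \<rho> = {\<one>\<^bsub>G\<^esub>}"

definition min_degree :: "('g, 'm) monoid_scheme \<Rightarrow> nat" where
  "min_degree G = (LEAST d. \<exists>\<rho>. nontrivial_rep G d \<rho>)"

definition min_faithful_degree :: "('g, 'm) monoid_scheme \<Rightarrow> nat" where
  "min_faithful_degree G = (LEAST d. \<exists>\<rho>. faithful_rep G d \<rho>)"


section \<open>The groups and the bounds\<close>

text \<open>\<open>SL k\<close> stands for $\mathbf{SL}_k$ and \<open>Sp k\<close> for $\mathbf{Sp}_{2k}$.\<close>

datatype group_type = SL nat | Sp nat

fun admissible :: "group_type \<Rightarrow> bool" where
  "admissible (SL k) \<longleftrightarrow> k \<ge> 2"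
| "admissible (Sp k) \<longleftrightarrow> k \<ge> 2"

fun points :: "group_type \<Rightarrow> ('a, 'r) ring_scheme \<Rightarrow> 'a mat monoid" where
  "points (SL k) R = SL_over R k"
| "points (Sp k) R = Sp_over R k"

fun group_rank :: "group_type \<Rightarrow> nat" where
  "group_rank (SL k) = k - 1"
| "group_rank (Sp k) = k"

fun h_bound :: "group_type \<Rightarrow> nat \<Rightarrow> real" where
  "h_bound (SL k) p =
    (if k = 2 then 1 / 2 * (real p - 1) else real p ^ (k - 1) - real p ^ (k - 2))"
| "h_bound (Sp k) p = 1 / 2 * (real p - 1) * real p ^ (k - 1)"

fun hf_bound :: "group_type \<Rightarrow> nat \<Rightarrow> nat \<Rightarrow> real" where
  "hf_bound (SL k) p n =
    (if k = 2 then 1 / 2 * (real p ^ n - real p ^ (n - 1))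
     else (real p ^ n - real p ^ (n - 1)) * real p ^ ((k - 2) * n))"
| "hf_bound (Sp k) p n = 1 / 2 * (real p ^ n - real p ^ (n - 1)) * real p ^ ((k - 1) * n)"

end

theory Submission
  imports Defs
begin

text \<open>
  Let $U_0,\dots,U_{m-1}$ be commuting elements of a group $G$ whose $p^n$-th powers are trivial. In a
  representation of $G$ they have a joint eigenvector, and its eigenvalues, which are roots of unity, define a
  character of the subgroup that they generate. An element of $G$ that normalises this subgroup takes the
  eigenvector to a joint eigenvector for a conjugate character. Joint eigenvectors for distinct characters
  are linearly independent, so the degree is at least the number of characters in an orbit
  (\<open>degree_ge_character_orbit\<close>).

  In $\mathbf{SL}_k$ with $k\ge 3$ the elements are the $m=k-1$ elementary matrices $I+E_{l,k-1}$ with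
  $l<k-1$. In $\mathbf{Sp}_{2k}$ they are the $m=k$ matrices $\begin{pmatrix}I&S_l\cr 0&I\end{pmatrix}$ with
  $S_0=E_{00}$ and $S_l=E_{0l}+E_{l0}$ for $l>0$. Both families are normalised by block diagonal matrices.
  A diagonal one takes $U_0$ to $U_0^a$ in $\mathbf{SL}_k$ and to $U_0^{a^2}$ in $\mathbf{Sp}_{2k}$, for any
  unit $a$. A unipotent one fixes $U_0$ and takes $U_l$ to $U_lU_0^{rt_l}$, with $r=1$ or $r=2$
  respectively and arbitrary $t_l$. If the eigenvalue of $U_0$ has order $p^j$, then the orbit
  has at least $(p^j-p^{j-1})p^{j(m-1)}$ elements for $\mathbf{SL}_k$ and at least half of this number for
  $\mathbf{Sp}_{2k}$ (\<open>SL_degree_ge\<close>, \<open>Sp_degree_ge\<close>).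

  If the representation is faithful, then $U_0^{p^{n-1}}$ acts non-trivially, and some eigenvalue of $U_0$
  has order $p^n$. This gives the bound with $j=n$. If the representation is only non-trivial, the bound
  needs $j\ge 1$, that is, $U_0$ must act non-trivially. It does, because both groups are the normal closure
  of $U_0$ (\<open>SL_normal_closure_elementary\<close>, \<open>Sp_normal_closure_transvection\<close>). The ring
  $\mathbf Z/p^n\mathbf Z$ is local, so Gaussian elimination writes a matrix in $\mathbf{SL}_k$ as a product of
  elementary matrices, and its symplectic analogue, which moves hyperbolic pairs by transvections, does the
  same in $\mathbf{Sp}_{2k}$. Conjugates of $U_0$ and commutators with $U_0$ provide all the factors.

  Finally $\mathbf{SL}_2=\mathbf{Sp}_2$, and the first row of the table of bounds is the third one with
  $k=1$. The minimal degrees are attained because the regular representation is faithful.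
\<close>

section \<open>Joint eigenvectors\<close>

lemma mult_mat_unit_vec:
  fixes A :: "'a :: semiring_1 mat"
  assumes "A \<in> carrier_mat n m" "j < m"
  shows "A *\<^sub>v unit_vec m j = col A j"
  using assms by (intro eq_vecI) (auto simp: scalar_prod_right_unit)

text \<open>
  By induction on the number of vectors: applying one of the matrices to a linear relation and subtracting a
  multiple of the relation makes one of its terms vanish.
\<close>
lemma joint_eigenvectors_independent:
  fixes U :: "'l \<Rightarrow> complex mat" and x :: "'i \<Rightarrow> complex vec"
  assumes "finite J"
    and U: "\<And>l. l \<in> L \<Longrightarrow> U l \<in> carrier_mat d d"
    and x: "\<And>i. i \<in> J \<Longrightarrow> x i \<in> carrier_vec d" "\<And>i. i \<in> J \<Longrightarrow> x i \<noteq> 0\<^sub>v d"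
    and eig: "\<And>i l. i \<in> J \<Longrightarrow> l \<in> L \<Longrightarrow> U l *\<^sub>v x i = \<tau> i l \<cdot>\<^sub>v x i"
    and dist: "\<And>i i'. i \<in> J \<Longrightarrow> i' \<in> J \<Longrightarrow> i \<noteq> i' \<Longrightarrow> \<exists>l\<in>L. \<tau> i l \<noteq> \<tau> i' l"
    and rel: "\<And>r. r < d \<Longrightarrow> (\<Sum>i\<in>J. c i * x i $ r) = 0"
    and "i \<in> J"
  shows "c i = 0"
  using assms
proof (induction J arbitrary: c i rule: finite_induct)
  case empty
  then show ?case by simp
next
  case (insert j J)
  have J0: "c i = 0" if i: "i \<in> J" for i
  proof -
    obtain l where l: "l \<in> L" "\<tau> i l \<noteq> \<tau> j l"
      using insert.prems(5)[of i j] i insert.hyps by auto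
    have "(\<Sum>i\<in>J. (c i * (\<tau> i l - \<tau> j l)) * x i $ r) = 0" if r: "r < d" for r
    proof -
      \<comment> \<open>Apply \<open>U l\<close> to the relation and subtract \<open>\<tau> j l\<close> times the relation; the term of \<open>j\<close> drops out.\<close>
      have comp: "(\<Sum>s\<in>{0..<d}. U l $$ (r, s) * x i $ s) = \<tau> i l * x i $ r" if "i \<in> insert j J" for i
      proof -
        have "(U l *\<^sub>v x i) $ r = (\<tau> i l \<cdot>\<^sub>v x i) $ r"
          using insert.prems(4)[OF that l(1)] by simp
        moreover have "x i \<in> carrier_vec d" using insert.prems(2) that by blast
        ultimately show ?thesis
          using insert.prems(1)[OF l(1)] r by (simp add: scalar_prod_def)
      qed
      have "0 = (\<Sum>s\<in>{0..<d}. U l $$ (r, s) * (\<Sum>i\<in>insert j J. c i * x i $ s))"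
        using insert.prems(6) by simp
      also have "\<dots> = (\<Sum>i\<in>insert j J. c i * (\<Sum>s\<in>{0..<d}. U l $$ (r, s) * x i $ s))"
        by (simp only: sum_distrib_left, subst sum.swap) (simp add: mult_ac)
      also have "\<dots> = (\<Sum>i\<in>insert j J. c i * (\<tau> i l * x i $ r))"
        using comp by (intro sum.cong) auto
      finally have "(\<Sum>i\<in>insert j J. c i * (\<tau> i l * x i $ r)) - \<tau> j l * (\<Sum>i\<in>insert j J. c i * x i $ r) = 0"
        using insert.prems(6)[OF r] by simp
      then have "(\<Sum>i\<in>insert j J. (c i * (\<tau> i l - \<tau> j l)) * x i $ r) = 0"
        by (simp only: sum_distrib_left sum_subtractf[symmetric]) (simp add: algebra_simps)
      then show ?thesis using insert.hyps by simp
    qed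
    then have "c i * (\<tau> i l - \<tau> j l) = 0"
      using insert.IH[of "\<lambda>i. c i * (\<tau> i l - \<tau> j l)" i] insert.prems(1-5) i by auto
    then show ?thesis using l(2) by simp
  qed
  have "c j = 0"
  proof (rule ccontr)
    assume "c j \<noteq> 0"
    then have "x j $ r = 0" if "r < d" for r
      using insert.prems(6)[OF that] insert.hyps J0 by simp
    then have "x j = 0\<^sub>v d" using insert.prems(2)[of j] by (intro eq_vecI) auto
    then show False using insert.prems(3)[of j] by simp
  qed
  then show ?case using J0 insert.prems(7) by auto
qed

text \<open>
  If there were more than \<open>d\<close> vectors, the matrix with these columns, padded to a square by zero
  rows, would be singular, and a vector in its kernel would be a linear relation.
\<close>
lemma card_joint_eigenvectors_le:
  fixes U :: "'l \<Rightarrow> complex mat" and x :: "'i \<Rightarrow> complex vec"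
  assumes fin: "finite J"
    and U: "\<And>l. l \<in> L \<Longrightarrow> U l \<in> carrier_mat d d"
    and x: "\<And>i. i \<in> J \<Longrightarrow> x i \<in> carrier_vec d" "\<And>i. i \<in> J \<Longrightarrow> x i \<noteq> 0\<^sub>v d"
    and eig: "\<And>i l. i \<in> J \<Longrightarrow> l \<in> L \<Longrightarrow> U l *\<^sub>v x i = \<tau> i l \<cdot>\<^sub>v x i"
    and dist: "\<And>i i'. i \<in> J \<Longrightarrow> i' \<in> J \<Longrightarrow> i \<noteq> i' \<Longrightarrow> \<exists>l\<in>L. \<tau> i l \<noteq> \<tau> i' l"
  shows "card J \<le> d"
proof (rule ccontr)
  let ?m = "card J"
  assume "\<not> ?m \<le> d"
  then have dm: "d < ?m" by simp
  obtain f where f: "bij_betw f {0..<?m} J"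
    using ex_bij_betw_nat_finite[OF fin] by blast
  define X where "X = mat ?m ?m (\<lambda>(r, s). if r < d then x (f s) $ r else 0)"
  have X: "X \<in> carrier_mat ?m ?m" by (simp add: X_def)
  have "transpose_mat X *\<^sub>v unit_vec ?m d = row X d"
    using X dm by (simp add: mult_mat_unit_vec[of _ ?m ?m])
  also have "\<dots> = 0\<^sub>v ?m" using dm by (intro eq_vecI) (auto simp: X_def)
  finally have kern: "transpose_mat X *\<^sub>v unit_vec ?m d = 0\<^sub>v ?m" .
  have "unit_vec ?m d \<noteq> (0\<^sub>v ?m :: complex vec)"
    using dm by (metis index_unit_vec(1) index_zero_vec(1) zero_neq_one)
  then have "det (transpose_mat X) = 0"
    unfolding det_0_iff_vec_prod_zero[OF transpose_carrier_mat[THEN iffD2, OF X]]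
    using kern unit_vec_carrier by blast
  then have "det X = 0" by (simp add: det_transpose[OF X])
  then obtain v where v: "v \<in> carrier_vec ?m" "v \<noteq> 0\<^sub>v ?m" "X *\<^sub>v v = 0\<^sub>v ?m"
    using det_0_iff_vec_prod_zero[OF X] by blast
  define c where "c i = v $ (inv_into {0..<?m} f i)" for i
  have cf: "c (f s) = v $ s" if "s < ?m" for s
    using that f by (simp add: c_def bij_betw_inv_into_left)
  have rel: "(\<Sum>i\<in>J. c i * x i $ r) = 0" if r: "r < d" for r
  proof -
    have "(\<Sum>i\<in>J. c i * x i $ r) = (\<Sum>s\<in>{0..<?m}. c (f s) * x (f s) $ r)"
      by (rule sum.reindex_bij_betw[OF f, symmetric])
    also have "\<dots> = (\<Sum>s\<in>{0..<?m}. X $$ (r, s) * v $ s)"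
      using cf r dm by (intro sum.cong) (auto simp: X_def)
    also have "\<dots> = (X *\<^sub>v v) $ r"
      using r dm X v(1) by (simp add: scalar_prod_def)
    finally show ?thesis using v(3) r dm by simp
  qed
  have "c i = 0" if "i \<in> J" for i
    by (rule joint_eigenvectors_independent[where J = J and L = L and U = U and x = x and \<tau> = \<tau>])
      (use fin U x eig dist rel that in auto)
  then have "v $ s = 0" if "s < ?m" for s
    using cf[OF that] f that by (metis atLeastLessThan_iff bij_betwE zero_le)
  then have "v = 0\<^sub>v ?m" using v(1) by (intro eq_vecI) auto
  then show False using v(2) by simp
qed

text \<open>
  For \<open>X ^\<^sub>m N = 1\<^sub>m d\<close> and \<open>\<omega> ^ N = 1\<close> this is \<open>N\<close> times the projection of \<open>x\<close> to the eigenspace of \<open>X\<close> for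
  \<open>\<omega>\<close>.
\<close>
definition spectral_component :: "nat \<Rightarrow> complex \<Rightarrow> complex mat \<Rightarrow> complex vec \<Rightarrow> complex vec" where
  "spectral_component N \<omega> X x =
     vec (dim_vec x) (\<lambda>r. \<Sum>t<N. inverse \<omega> ^ t * ((X ^\<^sub>m t) *\<^sub>v x) $ r)"

lemma mult_mat_vec_spectral_component:
  assumes X: "X \<in> carrier_mat d d" and Y: "Y \<in> carrier_mat d d" and x: "x \<in> carrier_vec d"
    and r: "r < d"
  shows "(Y *\<^sub>v spectral_component N \<omega> X x) $ r =
    (\<Sum>t<N. inverse \<omega> ^ t * (Y *\<^sub>v ((X ^\<^sub>m t) *\<^sub>v x)) $ r)"
proof -
  have *: "(X ^\<^sub>m t) *\<^sub>v x \<in> carrier_vec d" for t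
    using X x by (meson mult_mat_vec_carrier pow_carrier_mat)
  have "(Y *\<^sub>v spectral_component N \<omega> X x) $ r =
    (\<Sum>s\<in>{0..<d}. Y $$ (r, s) * (\<Sum>t<N. inverse \<omega> ^ t * ((X ^\<^sub>m t) *\<^sub>v x) $ s))"
    using Y x r by (simp add: spectral_component_def scalar_prod_def)
  also have "\<dots> = (\<Sum>t<N. inverse \<omega> ^ t * (\<Sum>s\<in>{0..<d}. Y $$ (r, s) * ((X ^\<^sub>m t) *\<^sub>v x) $ s))"
    by (simp only: sum_distrib_left, subst sum.swap) (simp add: mult_ac)
  also have "\<dots> = (\<Sum>t<N. inverse \<omega> ^ t * (Y *\<^sub>v ((X ^\<^sub>m t) *\<^sub>v x)) $ r)"
  proof (rule sum.cong[OF refl])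
    fix t
    have "(Y *\<^sub>v z) $ r = (\<Sum>s\<in>{0..<d}. Y $$ (r, s) * z $ s)" if "z \<in> carrier_vec d" for z
      using Y that r by (simp add: scalar_prod_def)
    then show "inverse \<omega> ^ t * (\<Sum>s\<in>{0..<d}. Y $$ (r, s) * ((X ^\<^sub>m t) *\<^sub>v x) $ s) =
      inverse \<omega> ^ t * (Y *\<^sub>v ((X ^\<^sub>m t) *\<^sub>v x)) $ r"
      by (simp only: *[of t])
  qed
  finally show ?thesis .
qed

lemma pow_mat_Suc_left:
  assumes "X \<in> carrier_mat d d"
  shows "X * X ^\<^sub>m t = X ^\<^sub>m Suc t"
proof (induction t)
  case 0
  then show ?case using assms by simp
next
  case (Suc t)
  have "X * X ^\<^sub>m Suc t = (X * X ^\<^sub>m t) * X"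
    using assms by (simp add: assoc_mult_mat[of _ d d _ d _ d])
  then show ?case by (simp only: Suc) simp
qed

lemma pow_mat_commute:
  assumes X: "X \<in> carrier_mat d d" and Y: "Y \<in> carrier_mat d d" and XY: "X * Y = Y * X"
  shows "X ^\<^sub>m t * Y = Y * X ^\<^sub>m t"
proof (induction t)
  case 0
  then show ?case using X Y by simp
next
  case (Suc t)
  have "X ^\<^sub>m Suc t * Y = X ^\<^sub>m t * (Y * X)"
    using X Y XY by (simp add: assoc_mult_mat[of _ d d _ d _ d])
  also have "\<dots> = (X ^\<^sub>m t * Y) * X"
    using X Y by (simp add: assoc_mult_mat[of _ d d _ d _ d])
  also have "\<dots> = Y * X ^\<^sub>m Suc t"
    using X Y by (simp add: Suc assoc_mult_mat[of _ d d _ d _ d])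
  finally show ?case .
qed

lemma spectral_component_carrier [simp]:
  "x \<in> carrier_vec d \<Longrightarrow> spectral_component N \<omega> X x \<in> carrier_vec d"
  by (simp only: spectral_component_def carrier_vecD vec_carrier)

text \<open>Multiplication by \<open>X\<close> shifts the sum cyclically.\<close>
lemma spectral_component_eigen:
  assumes X: "X \<in> carrier_mat d d" and x: "x \<in> carrier_vec d"
    and XN: "X ^\<^sub>m N = 1\<^sub>m d" and \<omega>: "\<omega> ^ N = 1" and "N > 0"
  shows "X *\<^sub>v spectral_component N \<omega> X x = \<omega> \<cdot>\<^sub>v spectral_component N \<omega> X x"
proof (intro eq_vecI)
  fix r assume "r < dim_vec (\<omega> \<cdot>\<^sub>v spectral_component N \<omega> X x)"
  then have r: "r < d" using x by (simp add: spectral_component_def)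
  have \<omega>0: "\<omega> \<noteq> 0" using \<omega> \<open>N > 0\<close> by (metis power_0_left less_irrefl zero_neq_one)
  define g where "g t = inverse \<omega> ^ t * ((X ^\<^sub>m t) *\<^sub>v x) $ r" for t
  have gN: "g N = g 0" using \<omega> X unfolding g_def power_inverse XN by simp
  have shift: "X *\<^sub>v ((X ^\<^sub>m t) *\<^sub>v x) = (X ^\<^sub>m Suc t) *\<^sub>v x" for t
    using assoc_mult_mat_vec[OF X pow_carrier_mat[OF X] x, of t] pow_mat_Suc_left[OF X, of t] by metis
  have step: "inverse \<omega> ^ t * (X *\<^sub>v ((X ^\<^sub>m t) *\<^sub>v x)) $ r = \<omega> * g (Suc t)" for t
  proof -
    have "\<omega> * g (Suc t) = (\<omega> * inverse \<omega> ^ Suc t) * ((X ^\<^sub>m Suc t) *\<^sub>v x) $ r"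
      by (simp only: g_def mult.assoc)
    also have "\<omega> * inverse \<omega> ^ Suc t = inverse \<omega> ^ t" using \<omega>0 by simp
    finally show ?thesis by (simp only: shift)
  qed
  have "(X *\<^sub>v spectral_component N \<omega> X x) $ r = (\<Sum>t<N. \<omega> * g (Suc t))"
    unfolding mult_mat_vec_spectral_component[OF X X x r] step ..
  also have "\<dots> = \<omega> * (\<Sum>t<N. g t)"
    using sum.lessThan_Suc[of g N] sum.lessThan_Suc_shift[of g N] gN
    by (simp add: sum_distrib_left[symmetric])
  finally show "(X *\<^sub>v spectral_component N \<omega> X x) $ r = (\<omega> \<cdot>\<^sub>v spectral_component N \<omega> X x) $ r"
    using r x by (simp add: g_def spectral_component_def)
qed (use X x in \<open>auto simp: spectral_component_def\<close>)

lemma spectral_component_commuting_eigen: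
  assumes X: "X \<in> carrier_mat d d" and Y: "Y \<in> carrier_mat d d" and x: "x \<in> carrier_vec d"
    and XY: "X * Y = Y * X" and eig: "Y *\<^sub>v x = c \<cdot>\<^sub>v x"
  shows "Y *\<^sub>v spectral_component N \<omega> X x = c \<cdot>\<^sub>v spectral_component N \<omega> X x"
proof (intro eq_vecI)
  fix r assume "r < dim_vec (c \<cdot>\<^sub>v spectral_component N \<omega> X x)"
  then have r: "r < d" using x by (simp add: spectral_component_def)
  have "Y *\<^sub>v ((X ^\<^sub>m t) *\<^sub>v x) = c \<cdot>\<^sub>v ((X ^\<^sub>m t) *\<^sub>v x)" for t
  proof -
    have "Y *\<^sub>v ((X ^\<^sub>m t) *\<^sub>v x) = (X ^\<^sub>m t * Y) *\<^sub>v x"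
      using assoc_mult_mat_vec[of Y d d "X ^\<^sub>m t" d x] X Y x pow_mat_commute[OF X Y XY, of t] by simp
    also have "\<dots> = (X ^\<^sub>m t) *\<^sub>v (c \<cdot>\<^sub>v x)"
      using assoc_mult_mat_vec[of "X ^\<^sub>m t" d d Y d x] X Y x eig by simp
    also have "\<dots> = c \<cdot>\<^sub>v ((X ^\<^sub>m t) *\<^sub>v x)"
      using X x by (meson mult_mat_vec pow_carrier_mat)
    finally show ?thesis .
  qed
  moreover have "dim_vec ((X ^\<^sub>m t) *\<^sub>v x) = d" for t using X by simp
  ultimately show "(Y *\<^sub>v spectral_component N \<omega> X x) $ r = (c \<cdot>\<^sub>v spectral_component N \<omega> X x) $ r"
    unfolding mult_mat_vec_spectral_component[OF X Y x r]
    using r x by (simp add: spectral_component_def sum_distrib_left mult_ac)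
qed (use Y x in \<open>auto simp: spectral_component_def\<close>)

lemma sum_powers_root_of_unity:
  fixes z :: complex
  assumes "z ^ N = 1" "z \<noteq> 1"
  shows "(\<Sum>s<N. z ^ s) = 0"
  using assms geometric_sum[of z N] by simp

text \<open>Fourier inversion: the components sum to \<open>N\<close> times the vector, so they do not all vanish.\<close>
lemma ex_nonzero_spectral_component:
  assumes X: "X \<in> carrier_mat d d" and x: "x \<in> carrier_vec d" "x \<noteq> 0\<^sub>v d" and N: "N > 0"
  shows "\<exists>\<omega>. \<omega> ^ N = 1 \<and> spectral_component N \<omega> X x \<noteq> 0\<^sub>v d"
proof (rule ccontr)
  assume contra: "\<not> ?thesis"
  define w where "w = cis (2 * pi / real N)"
  have wk: "w ^ k = cis (2 * pi * real k / real N)" for k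
    by (simp add: w_def DeMoivre mult.commute)
  have inj: "inj_on (\<lambda>k. w ^ k) {..<N}"
    using bij_betw_roots_unity[OF N] by (simp add: bij_betw_def wk)
  have wN: "w ^ N = 1" using N by (simp add: wk)
  have w0: "w \<noteq> 0" by (simp add: w_def)
  have sums: "(\<Sum>k<N. inverse (w ^ k) ^ t) = (if t = 0 then of_nat N else 0)" if t: "t < N" for t
  proof (cases "t = 0")
    case False
    have "w ^ t \<noteq> w ^ 0" using inj t N False by (metis inj_onD lessThan_iff)
    moreover have "(w ^ t) ^ N = 1"
      using wN by (simp add: power_mult[symmetric] mult.commute[of t]) (simp add: power_mult)
    ultimately have "(\<Sum>k<N. (inverse (w ^ t)) ^ k) = 0"
      by (intro sum_powers_root_of_unity) (simp_all add: power_inverse)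
    then show ?thesis using False by (simp add: power_inverse power_mult[symmetric] mult.commute)
  qed simp
  have "x $ r = 0" if r: "r < d" for r
  proof -
    have "(w ^ k) ^ N = 1" for k
      using wN by (simp add: power_mult[symmetric] mult.commute[of k]) (simp add: power_mult)
    then have "spectral_component N (w ^ k) X x = 0\<^sub>v d" for k
      using contra by blast
    then have "spectral_component N (w ^ k) X x $ r = 0" for k
      using r by simp
    then have "(\<Sum>t<N. inverse (w ^ k) ^ t * ((X ^\<^sub>m t) *\<^sub>v x) $ r) = 0" for k
      using r carrier_vecD[OF x(1)] unfolding spectral_component_def by (simp only: index_vec)
    then have "0 = (\<Sum>k<N. \<Sum>t<N. inverse (w ^ k) ^ t * ((X ^\<^sub>m t) *\<^sub>v x) $ r)"
      by simp
    also have "\<dots> = (\<Sum>t<N. (\<Sum>k<N. inverse (w ^ k) ^ t) * ((X ^\<^sub>m t) *\<^sub>v x) $ r)"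
      by (subst sum.swap) (simp add: sum_distrib_right)
    also have "\<dots> = (\<Sum>t<N. if t = 0 then of_nat N * x $ r else 0)"
      using sums X x by (intro sum.cong) auto
    also have "\<dots> = of_nat N * x $ r" using N by simp
    finally show ?thesis using N by simp
  qed
  then have "x = 0\<^sub>v d" using x by (intro eq_vecI) auto
  then show False using x by simp
qed

text \<open>
  Some \<open>y = (X ^\<^sub>m M) *\<^sub>v v - v\<close> is not zero. It has no spectral component for an eigenvalue \<open>\<omega>\<close> with
  \<open>\<omega> ^ M = 1\<close>, so one of its other components is the desired eigenvector.
\<close>
lemma ex_eigenvector_order:
  fixes X :: "complex mat"
  assumes X: "X \<in> carrier_mat d d" and XN: "X ^\<^sub>m N = 1\<^sub>m d" and N: "N > 0" and M: "X ^\<^sub>m M \<noteq> 1\<^sub>m d"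
  shows "\<exists>x \<omega>. x \<in> carrier_vec d \<and> x \<noteq> 0\<^sub>v d \<and> X *\<^sub>v x = \<omega> \<cdot>\<^sub>v x \<and> \<omega> ^ N = 1 \<and> \<omega> ^ M \<noteq> 1"
proof -
  let ?Z = "X ^\<^sub>m M - 1\<^sub>m d"
  have Z: "?Z \<in> carrier_mat d d" by (rule minus_carrier_mat) simp
  have "\<exists>v. v \<in> carrier_vec d \<and> ?Z *\<^sub>v v \<noteq> 0\<^sub>v d"
  proof (rule ccontr)
    assume contra: "\<not> ?thesis"
    have "(X ^\<^sub>m M) $$ (i, j) = 1\<^sub>m d $$ (i, j)" if "i < d" "j < d" for i j
    proof -
      have "col ?Z j = 0\<^sub>v d"
      proof -
        have "?Z *\<^sub>v unit_vec d j = 0\<^sub>v d" using contra by simp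
        then show ?thesis by (simp only: mult_mat_unit_vec[OF Z that(2)])
      qed
      then have "col ?Z j $ i = 0" using that by simp
      then have "?Z $$ (i, j) = 0" using Z that by (simp only: carrier_matD index_col)
      then show ?thesis using X that by simp
    qed
    then have "X ^\<^sub>m M = 1\<^sub>m d" using X by (intro eq_matI) auto
    then show False using M by simp
  qed
  then obtain v where v: "v \<in> carrier_vec d" "?Z *\<^sub>v v \<noteq> 0\<^sub>v d" by auto
  define y where "y = ?Z *\<^sub>v v"
  have y: "y \<in> carrier_vec d" "y \<noteq> 0\<^sub>v d" using v Z by (auto simp: y_def)
  obtain \<omega> where \<omega>: "\<omega> ^ N = 1" "spectral_component N \<omega> X y \<noteq> 0\<^sub>v d"
    using ex_nonzero_spectral_component[OF X y N] by blast
  have "\<omega> ^ M \<noteq> 1"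
  proof
    assume \<omega>M: "\<omega> ^ M = 1"
    let ?u = "spectral_component N \<omega> X v"
    have u: "?u \<in> carrier_vec d" using v by simp
    have eu: "X *\<^sub>v ?u = \<omega> \<cdot>\<^sub>v ?u" using spectral_component_eigen[OF X v(1) XN \<omega>(1) N] .
    have "(X ^\<^sub>m t) *\<^sub>v ?u = \<omega> ^ t \<cdot>\<^sub>v ?u" for t
    proof (induction t)
      case (Suc t)
      have "(X ^\<^sub>m Suc t) *\<^sub>v ?u = (X ^\<^sub>m t) *\<^sub>v (X *\<^sub>v ?u)"
        by (simp only: pow_mat.simps assoc_mult_mat_vec[OF pow_carrier_mat[OF X] X u])
      also have "\<dots> = \<omega> \<cdot>\<^sub>v ((X ^\<^sub>m t) *\<^sub>v ?u)"
        unfolding eu by (rule mult_mat_vec[OF pow_carrier_mat[OF X] u])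
      finally show ?case unfolding Suc by (simp add: smult_smult_assoc)
    qed (use X u in simp)
    from this[of M] have eM: "(X ^\<^sub>m M) *\<^sub>v ?u = ?u" unfolding \<omega>M by simp
    have "spectral_component N \<omega> X y = ?Z *\<^sub>v ?u"
    proof (intro eq_vecI)
      fix r assume "r < dim_vec (?Z *\<^sub>v ?u)"
      then have r: "r < d" using Z by simp
      have "(X ^\<^sub>m t) * ?Z = ?Z * (X ^\<^sub>m t)" for t
      proof -
        have "?Z * X = X ^\<^sub>m Suc M - X"
          using minus_mult_distrib_mat[OF pow_carrier_mat[OF X] one_carrier_mat X] X by simp
        moreover have "X * ?Z = X ^\<^sub>m Suc M - X"
          using mult_minus_distrib_mat[OF X pow_carrier_mat[OF X] one_carrier_mat] X
          by (simp only: pow_mat_Suc_left[OF X] right_mult_one_mat[OF X])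
        ultimately show ?thesis by (intro pow_mat_commute[OF X Z]) simp
      qed
      then have "(X ^\<^sub>m t) *\<^sub>v y = ?Z *\<^sub>v ((X ^\<^sub>m t) *\<^sub>v v)" for t
        unfolding y_def assoc_mult_mat_vec[OF pow_carrier_mat[OF X] Z v(1), symmetric]
          assoc_mult_mat_vec[OF Z pow_carrier_mat[OF X] v(1), symmetric] by simp
      then show "spectral_component N \<omega> X y $ r = (?Z *\<^sub>v ?u) $ r"
        unfolding mult_mat_vec_spectral_component[OF X Z v(1) r]
        using r y by (simp only: spectral_component_def index_vec carrier_vecD)
    qed (use y Z in \<open>simp add: spectral_component_def\<close>)
    also have "\<dots> = (X ^\<^sub>m M) *\<^sub>v ?u - ?u"
      using minus_mult_distrib_mat_vec[OF pow_carrier_mat[OF X] one_carrier_mat u] u by simp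
    also have "\<dots> = 0\<^sub>v d" using eM u by simp
    finally show False using \<omega>(2) by simp
  qed
  moreover have "X *\<^sub>v spectral_component N \<omega> X y = \<omega> \<cdot>\<^sub>v spectral_component N \<omega> X y"
    by (rule spectral_component_eigen[OF X y(1) XN \<omega>(1) N])
  ultimately show ?thesis
    by (intro exI[of _ "spectral_component N \<omega> X y"] exI[of _ \<omega>] conjI
        spectral_component_carrier[OF y(1)] \<omega>)
qed

text \<open>
  The matrices are treated one after the other. A spectral component with respect to the next matrix is
  still an eigenvector of the previous ones, with the same eigenvalues, because the matrices commute.
\<close>
lemma ex_joint_eigenvector:
  fixes U :: "nat \<Rightarrow> complex mat"
  assumes U: "\<And>l. l < m \<Longrightarrow> U l \<in> carrier_mat d d"
    and UN: "\<And>l. l < m \<Longrightarrow> U l ^\<^sub>m N = 1\<^sub>m d" and N: "N > 0"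
    and comm: "\<And>l l'. l < m \<Longrightarrow> l' < m \<Longrightarrow> U l * U l' = U l' * U l"
    and M: "U 0 ^\<^sub>m M \<noteq> 1\<^sub>m d" and m: "0 < m"
  shows "\<exists>x \<tau>. x \<in> carrier_vec d \<and> x \<noteq> 0\<^sub>v d \<and> \<tau> 0 ^ N = 1 \<and> \<tau> 0 ^ M \<noteq> 1 \<and> (\<forall>l<m. \<tau> l \<noteq> 0) \<and>
    (\<forall>l<m. U l *\<^sub>v x = \<tau> l \<cdot>\<^sub>v x)"
  using m U UN comm M
proof (induction m)
  case 0
  then show ?case by simp
next
  case (Suc m)
  show ?case
  proof (cases "m = 0")
    case True
    obtain x \<omega> where x: "x \<in> carrier_vec d" "x \<noteq> 0\<^sub>v d" "U 0 *\<^sub>v x = \<omega> \<cdot>\<^sub>v x" "\<omega> ^ N = 1" "\<omega> ^ M \<noteq> 1"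
      using ex_eigenvector_order[OF Suc.prems(2)[of 0] Suc.prems(3)[of 0] N Suc.prems(5)] by auto
    have "\<omega> \<noteq> 0" using x(4) N by (metis power_0_left less_irrefl zero_neq_one)
    then show ?thesis using True x by (intro exI[of _ x] exI[of _ "\<lambda>_. \<omega>"]) auto
  next
    case False
    then have "0 < m" by simp
    from Suc.IH[OF this Suc.prems(2-4) Suc.prems(5)]
    obtain x \<tau> where x: "x \<in> carrier_vec d" "x \<noteq> 0\<^sub>v d" "\<tau> 0 ^ N = 1" "\<tau> 0 ^ M \<noteq> 1"
      "\<forall>l<m. \<tau> l \<noteq> 0" "\<forall>l<m. U l *\<^sub>v x = \<tau> l \<cdot>\<^sub>v x"
      by auto
    obtain \<omega> where \<omega>: "\<omega> ^ N = 1" "spectral_component N \<omega> (U m) x \<noteq> 0\<^sub>v d"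
      using ex_nonzero_spectral_component[OF Suc.prems(2)[of m] x(1,2) N] by auto
    have "\<omega> \<noteq> 0" using \<omega>(1) N by (metis power_0_left less_irrefl zero_neq_one)
    moreover have "U m *\<^sub>v spectral_component N \<omega> (U m) x = \<omega> \<cdot>\<^sub>v spectral_component N \<omega> (U m) x"
      using spectral_component_eigen[OF Suc.prems(2)[of m] x(1) Suc.prems(3)[of m] \<omega>(1) N] by simp
    moreover have "U l *\<^sub>v spectral_component N \<omega> (U m) x = \<tau> l \<cdot>\<^sub>v spectral_component N \<omega> (U m) x"
      if "l < m" for l
      by (rule spectral_component_commuting_eigen[OF Suc.prems(2)[of m] Suc.prems(2)[of l] x(1)
            Suc.prems(4)[of m l]]) (use that x(6) in auto)
    ultimately show ?thesis using x False \<omega>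
      by (intro exI[of _ "spectral_component N \<omega> (U m) x"] exI[of _ "\<tau>(m := \<omega>)"]) (auto simp: less_Suc_eq)
  qed
qed

section \<open>Orbits of characters\<close>

lemma representation_group_hom:
  assumes "group G" "representation G d \<rho>"
  shows "group_hom G (GL_complex d) \<rho>"
proof -
  interpret R: semiring "ring_mat TYPE(complex) d ()" by (rule semiring_mat)
  have "group (GL_complex d)" unfolding GL_complex_def by (rule R.units_group)
  then show ?thesis
    using assms by (simp add: representation_def group_hom_def group_hom_axioms_def)
qed

lemma GL_complex_simps:
  "\<one>\<^bsub>GL_complex d\<^esub> = 1\<^sub>m d" "mult (GL_complex d) = (*)"
  by (simp_all add: GL_complex_def units_of_def ring_mat_def)

lemma carrier_GL_complex: "carrier (GL_complex d) = {A \<in> carrier_mat d d. \<exists>B\<in>carrier_mat d d. B * A = 1\<^sub>m d \<and> A * B = 1\<^sub>m d}"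
  by (simp add: GL_complex_def units_of_def Units_def ring_mat_def)

lemma representation_carrier_mat:
  "representation G d \<rho> \<Longrightarrow> g \<in> carrier G \<Longrightarrow> \<rho> g \<in> carrier_mat d d"
  by (auto simp: representation_def hom_def carrier_GL_complex Pi_iff)

lemma representation_mult:
  "representation G d \<rho> \<Longrightarrow> g \<in> carrier G \<Longrightarrow> h \<in> carrier G \<Longrightarrow> \<rho> (g \<otimes>\<^bsub>G\<^esub> h) = \<rho> g * \<rho> h"
  by (simp add: representation_def hom_def GL_complex_simps)

lemma representation_one:
  "group G \<Longrightarrow> representation G d \<rho> \<Longrightarrow> \<rho> \<one>\<^bsub>G\<^esub> = 1\<^sub>m d"
  using group_hom.hom_one[OF representation_group_hom] by (simp add: GL_complex_simps)

lemma representation_pow: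
  assumes "group G" "representation G d \<rho>" "g \<in> carrier G"
  shows "\<rho> (g [^]\<^bsub>G\<^esub> (t :: nat)) = \<rho> g ^\<^sub>m t"
proof -
  interpret group G by fact
  have "\<rho> g \<in> carrier_mat d d" using assms by (rule_tac representation_carrier_mat)
  then show ?thesis
    using assms by (induction t) (simp_all add: representation_one representation_mult)
qed

lemma representation_mult_vec_nonzero:
  assumes G: "group G" and \<rho>: "representation G d \<rho>" and g: "g \<in> carrier G"
    and x: "x \<in> carrier_vec d" "x \<noteq> 0\<^sub>v d"
  shows "\<rho> g *\<^sub>v x \<noteq> 0\<^sub>v d"
proof
  assume 0: "\<rho> g *\<^sub>v x = 0\<^sub>v d"
  interpret group G by fact
  note c = representation_carrier_mat[OF \<rho> inv_closed[OF g]] representation_carrier_mat[OF \<rho> g]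
  have "\<rho> (inv\<^bsub>G\<^esub> g) * \<rho> g = 1\<^sub>m d"
    using representation_mult[OF \<rho> inv_closed[OF g] g] g by (simp add: representation_one[OF G \<rho>])
  then have "x = \<rho> (inv\<^bsub>G\<^esub> g) *\<^sub>v (\<rho> g *\<^sub>v x)"
    using assoc_mult_mat_vec[OF c x(1)] x(1) by simp
  also have "\<dots> = 0\<^sub>v d" unfolding 0 using c(1) by (intro eq_vecI) auto
  finally show False using x(2) by simp
qed

lemma eigenvector_transport:
  fixes X :: "'a :: field mat"
  assumes "X \<in> carrier_mat d d" "Y \<in> carrier_mat d d" "g \<in> carrier_mat d d" "x \<in> carrier_vec d"
    and "X * g = g * Y" "Y *\<^sub>v x = c \<cdot>\<^sub>v x"
  shows "X *\<^sub>v (g *\<^sub>v x) = c \<cdot>\<^sub>v (g *\<^sub>v x)"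
proof -
  have "X *\<^sub>v (g *\<^sub>v x) = g *\<^sub>v (Y *\<^sub>v x)"
    using assoc_mult_mat_vec[OF assms(1,3,4)] assoc_mult_mat_vec[OF assms(3,2,4)] assms(5) by simp
  then show ?thesis unfolding assms(6) mult_mat_vec[OF assms(3,4)] .
qed

lemma eigenvector_mult:
  fixes X :: "'a :: field mat"
  assumes "X \<in> carrier_mat d d" "Y \<in> carrier_mat d d" "x \<in> carrier_vec d"
    and "X *\<^sub>v x = a \<cdot>\<^sub>v x" "Y *\<^sub>v x = b \<cdot>\<^sub>v x"
  shows "(X * Y) *\<^sub>v x = (a * b) \<cdot>\<^sub>v x"
proof -
  have "(X * Y) *\<^sub>v x = X *\<^sub>v (b \<cdot>\<^sub>v x)"
    by (simp only: assoc_mult_mat_vec[OF assms(1-3)] assms(5))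
  also have "\<dots> = b \<cdot>\<^sub>v (a \<cdot>\<^sub>v x)" by (simp only: mult_mat_vec[OF assms(1,3)] assms(4))
  finally show ?thesis by (simp add: smult_smult_assoc mult.commute)
qed

lemma eigenvector_pow:
  fixes X :: "'a :: field mat"
  assumes X: "X \<in> carrier_mat d d" and x: "x \<in> carrier_vec d" and e: "X *\<^sub>v x = a \<cdot>\<^sub>v x"
  shows "(X ^\<^sub>m t) *\<^sub>v x = (a ^ t) \<cdot>\<^sub>v x"
proof (induction t)
  case 0
  then show ?case using X x by simp
next
  case (Suc t)
  show ?case
    using eigenvector_mult[OF pow_carrier_mat[OF X] X x Suc e] by (simp add: mult.commute)
qed

text \<open>
  The order of \<open>\<zeta>\<close> divides \<open>p ^ n\<close>, so it is a power \<open>p ^ j\<close>, and it does not divide \<open>p ^ i\<close>.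
\<close>
lemma root_of_unity_prime_power_order:
  fixes \<zeta> :: complex and p :: nat
  assumes p: "prime p" and n: "\<zeta> ^ (p ^ n) = 1" and i: "\<zeta> ^ (p ^ i) \<noteq> 1"
  shows "\<exists>j. i < j \<and> j \<le> n \<and> (\<forall>s t. \<zeta> ^ s = \<zeta> ^ t \<longleftrightarrow> [s = t] (mod p ^ j))"
proof -
  define j where "j = (LEAST j. \<zeta> ^ (p ^ j) = 1)"
  have j: "\<zeta> ^ (p ^ j) = 1" unfolding j_def using n by (rule LeastI)
  have least: "j \<le> k" if "\<zeta> ^ (p ^ k) = 1" for k unfolding j_def using that by (rule Least_le)
  have p0: "p ^ n \<noteq> 0" using p by auto
  have \<zeta>0: "\<zeta> \<noteq> 0" using n p0 by (metis power_0_left zero_neq_one)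
  have ord: "\<zeta> ^ t = 1 \<longleftrightarrow> p ^ j dvd t" for t
  proof
    assume t: "\<zeta> ^ t = 1"
    obtain x y where xy: "p ^ n * x = t * y + gcd (p ^ n) t" using bezout_nat[OF p0] by blast
    have "1 = \<zeta> ^ (p ^ n * x)" using n by (simp add: power_mult)
    also have "\<dots> = \<zeta> ^ gcd (p ^ n) t" unfolding xy using t by (simp add: power_add power_mult)
    finally have g: "\<zeta> ^ gcd (p ^ n) t = 1" by simp
    obtain k where k: "gcd (p ^ n) t = p ^ k"
      using divides_primepow_nat[OF p, of "gcd (p ^ n) t" n] by auto
    then have "j \<le> k" using least g by simp
    then have "p ^ j dvd gcd (p ^ n) t" unfolding k by (rule le_imp_power_dvd)
    then show "p ^ j dvd t" by simp
  next
    assume "p ^ j dvd t"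
    then obtain q where q: "t = p ^ j * q" by (elim dvdE)
    show "\<zeta> ^ t = 1" unfolding q power_mult j by simp
  qed
  have le: "\<zeta> ^ s = \<zeta> ^ t \<longleftrightarrow> [s = t] (mod p ^ j)" if "s \<le> t" for s t
  proof -
    have "\<zeta> ^ t = \<zeta> ^ s * \<zeta> ^ (t - s)" using that by (simp add: power_add[symmetric])
    then have "\<zeta> ^ s = \<zeta> ^ t \<longleftrightarrow> \<zeta> ^ (t - s) = 1" using \<zeta>0 by auto
    also have "\<dots> \<longleftrightarrow> [s = t] (mod p ^ j)"
      unfolding ord using cong_altdef_nat[OF that, of "p ^ j"] by (simp add: cong_sym_eq)
    finally show ?thesis .
  qed
  have "\<zeta> ^ s = \<zeta> ^ t \<longleftrightarrow> [s = t] (mod p ^ j)" for s t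
    using le[of s t] le[of t s] by (cases "s \<le> t") (auto simp: cong_sym_eq)
  moreover have "i < j"
  proof (rule ccontr)
    assume "\<not> i < j"
    then have "p ^ j dvd p ^ i" by (intro le_imp_power_dvd) simp
    then show False using ord i by blast
  qed
  ultimately show ?thesis using least[OF n] by blast
qed

text \<open>
  Let \<open>x\<close> be a joint eigenvector with eigenvalues \<open>\<tau> l\<close>, where \<open>\<tau> 0\<close> has order \<open>p ^ j\<close> and \<open>i < j\<close>. The
  image of \<open>x\<close> under \<open>H t \<otimes> D a\<close> has the eigenvalue \<open>\<tau> 0 ^ (a ^ r)\<close> for \<open>U 0\<close> and the eigenvalue
  \<open>\<tau> l ^ c a l * \<tau> 0 ^ (a ^ r * (r * t l))\<close> for \<open>U l\<close>. The first determines \<open>a\<close> in a set on which \<open>a ^ r\<close> is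
  injective modulo \<open>p ^ j\<close>. Given \<open>a\<close>, the others determine all \<open>t l\<close> modulo \<open>p ^ j\<close>, because \<open>a\<close> and \<open>r\<close>
  are prime to \<open>p\<close>.
\<close>
lemma degree_ge_character_orbit:
  fixes G (structure) and U :: "nat \<Rightarrow> 'g" and D :: "nat \<Rightarrow> 'g" and H :: "(nat \<Rightarrow> nat) \<Rightarrow> 'g"
  assumes G: "group G" and \<rho>: "representation G d \<rho>" and p: "prime p" and m: "0 < m"
    and U: "\<And>l. l < m \<Longrightarrow> U l \<in> carrier G"
    and comm: "\<And>l l'. l < m \<Longrightarrow> l' < m \<Longrightarrow> U l \<otimes> U l' = U l' \<otimes> U l"
    and exponent: "\<And>l. l < m \<Longrightarrow> U l [^] (p ^ n) = \<one>"
    and nontriv: "\<rho> (U 0 [^] (p ^ i)) \<noteq> 1\<^sub>m d"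
    and D: "\<And>a. coprime a p \<Longrightarrow> D a \<in> carrier G"
    and UD0: "\<And>a. coprime a p \<Longrightarrow> U 0 \<otimes> D a = D a \<otimes> U 0 [^] (a ^ r)"
    and UD: "\<And>a l. coprime a p \<Longrightarrow> 0 < l \<Longrightarrow> l < m \<Longrightarrow> U l \<otimes> D a = D a \<otimes> U l [^] (c a l :: nat)"
    and H: "\<And>t. H t \<in> carrier G"
    and UH0: "\<And>t. U 0 \<otimes> H t = H t \<otimes> U 0"
    and UH: "\<And>t l. 0 < l \<Longrightarrow> l < m \<Longrightarrow> U l \<otimes> H t = H t \<otimes> (U l \<otimes> U 0 [^] (r * t l))"
    and r: "coprime r p"
  shows "\<exists>j. i < j \<and> j \<le> n \<and>
    (\<forall>A. finite A \<longrightarrow> (\<forall>a\<in>A. coprime a p) \<longrightarrow> (\<forall>a\<in>A. \<forall>b\<in>A. [a ^ r = b ^ r] (mod p ^ j) \<longrightarrow> a = b) \<longrightarrow>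
      card A * (p ^ j) ^ (m - 1) \<le> d)"
proof -
  interpret group G by fact
  have \<rho>c: "\<rho> g \<in> carrier_mat d d" if "g \<in> carrier G" for g
    by (rule representation_carrier_mat[OF \<rho> that])
  note \<rho>m = representation_mult[OF \<rho>]
  have N: "p ^ n > 0" using p by (simp add: prime_gt_0_nat)
  have "\<exists>x \<tau>. x \<in> carrier_vec d \<and> x \<noteq> 0\<^sub>v d \<and> \<tau> 0 ^ (p ^ n) = 1 \<and> \<tau> 0 ^ (p ^ i) \<noteq> 1 \<and>
    (\<forall>l<m. \<tau> l \<noteq> 0) \<and> (\<forall>l<m. \<rho> (U l) *\<^sub>v x = \<tau> l \<cdot>\<^sub>v x)"
  proof (rule ex_joint_eigenvector[OF _ _ N _ _ m])
    show "\<rho> (U l) ^\<^sub>m p ^ n = 1\<^sub>m d" if "l < m" for l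
      using representation_pow[OF G \<rho> U[OF that], of "p ^ n"] exponent[OF that]
      by (simp add: representation_one[OF G \<rho>])
    show "\<rho> (U l) * \<rho> (U l') = \<rho> (U l') * \<rho> (U l)" if "l < m" "l' < m" for l l'
      using comm[OF that] U that by (metis \<rho>m)
    show "\<rho> (U 0) ^\<^sub>m p ^ i \<noteq> 1\<^sub>m d"
      using representation_pow[OF G \<rho> U[OF m], of "p ^ i"] nontriv by simp
  qed (use \<rho>c U in auto)
  then obtain x \<tau> where x: "x \<in> carrier_vec d" "x \<noteq> 0\<^sub>v d" and \<tau>: "\<tau> 0 ^ (p ^ n) = 1" "\<tau> 0 ^ (p ^ i) \<noteq> 1"
    "\<And>l. l < m \<Longrightarrow> \<tau> l \<noteq> 0" and eig: "\<And>l. l < m \<Longrightarrow> \<rho> (U l) *\<^sub>v x = \<tau> l \<cdot>\<^sub>v x"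
    by blast
  obtain j where j: "i < j" "j \<le> n" "\<And>s t. \<tau> 0 ^ s = \<tau> 0 ^ t \<longleftrightarrow> [s = t] (mod p ^ j)"
    using root_of_unity_prime_power_order[OF p \<tau>(1,2)] by blast
  have eig_pow: "\<rho> (U l [^] (t :: nat)) *\<^sub>v x = (\<tau> l ^ t) \<cdot>\<^sub>v x" if "l < m" for l t
    unfolding representation_pow[OF G \<rho> U[OF that]]
    by (rule eigenvector_pow[OF \<rho>c[OF U[OF that]] x(1) eig[OF that]])
  have card: "card A * (p ^ j) ^ (m - 1) \<le> d"
    if A: "finite A" "\<And>a. a \<in> A \<Longrightarrow> coprime a p"
      "\<And>a b. a \<in> A \<Longrightarrow> b \<in> A \<Longrightarrow> [a ^ r = b ^ r] (mod p ^ j) \<Longrightarrow> a = b" for A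
  proof -
    define T where "T = ({1..<m} \<rightarrow>\<^sub>E {..<p ^ j})"
    define g where "g = (\<lambda>(a, t). H t \<otimes> D a)"
    define \<sigma> where "\<sigma> = (\<lambda>(a, t) l. if l = 0 then \<tau> 0 ^ (a ^ r) else \<tau> l ^ c a l * \<tau> 0 ^ (a ^ r * (r * t l)))"
    have g: "g y \<in> carrier G" if "y \<in> A \<times> T" for y
      using that A(2) D H by (auto simp: g_def)
    have "card (A \<times> T) \<le> d"
    proof (rule card_joint_eigenvectors_le[where L = "{..<m}" and U = "\<lambda>l. \<rho> (U l)"
          and x = "\<lambda>y. \<rho> (g y) *\<^sub>v x" and \<tau> = \<sigma>])
      show "finite (A \<times> T)" using A(1) by (auto simp: T_def intro: finite_PiE)
      show "\<rho> (U l) \<in> carrier_mat d d" if "l \<in> {..<m}" for l using that U \<rho>c by simp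
      show "\<rho> (g y) *\<^sub>v x \<in> carrier_vec d" if "y \<in> A \<times> T" for y
        using \<rho>c[OF g[OF that]] x(1) by simp
      show "\<rho> (g y) *\<^sub>v x \<noteq> 0\<^sub>v d" if "y \<in> A \<times> T" for y
        by (rule representation_mult_vec_nonzero[OF G \<rho> g[OF that] x])
      show "\<rho> (U l) *\<^sub>v (\<rho> (g y) *\<^sub>v x) = \<sigma> y l \<cdot>\<^sub>v (\<rho> (g y) *\<^sub>v x)"
        if y: "y \<in> A \<times> T" and l': "l \<in> {..<m}" for y l
      proof -
        obtain a t where at: "y = (a, t)" "a \<in> A" using y by auto
        have l: "l < m" using l' by simp
        note a = A(2)[OF at(2)]
        note clo = U[OF l] U[OF m] H[of t] D[OF a]
        define V where "V = (if l = 0 then U 0 [^] (a ^ r) else U l [^] c a l \<otimes> U 0 [^] (a ^ r * (r * t l)))"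
        have V: "V \<in> carrier G" using clo by (simp add: V_def)
        have UDpow: "U 0 [^] s \<otimes> D a = D a \<otimes> U 0 [^] (a ^ r * s)" for s :: nat
        proof (induction s)
          case (Suc s)
          have "U 0 [^] Suc s \<otimes> D a = U 0 [^] s \<otimes> (D a \<otimes> U 0 [^] (a ^ r))"
            using clo by (simp add: m_assoc UD0[OF a])
          also have "\<dots> = D a \<otimes> (U 0 [^] (a ^ r * s) \<otimes> U 0 [^] (a ^ r))"
            using clo by (simp add: m_assoc[symmetric] Suc)
          finally show ?case using clo by (simp add: nat_pow_mult add.commute)
        qed (use clo in simp)
        have rel: "U l \<otimes> g y = g y \<otimes> V"
        proof (cases "l = 0")
          case True
          have "U 0 \<otimes> (H t \<otimes> D a) = H t \<otimes> (U 0 \<otimes> D a)"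
            using clo by (simp add: m_assoc[symmetric] UH0)
          then show ?thesis using clo True by (simp add: at g_def V_def UD0[OF a] m_assoc)
        next
          case False
          then have l0: "0 < l" by simp
          have "U l \<otimes> (H t \<otimes> D a) = H t \<otimes> (U l \<otimes> (U 0 [^] (r * t l) \<otimes> D a))"
            using clo by (simp add: m_assoc[symmetric] UH[OF l0 l])
          also have "\<dots> = H t \<otimes> ((U l \<otimes> D a) \<otimes> U 0 [^] (a ^ r * (r * t l)))"
            using clo by (simp add: m_assoc UDpow)
          also have "\<dots> = (H t \<otimes> D a) \<otimes> V"
            using clo False by (simp add: m_assoc UD[OF a l0 l] V_def)
          finally show ?thesis by (simp add: at g_def)
        qed
        have "\<rho> V *\<^sub>v x = \<sigma> y l \<cdot>\<^sub>v x"
        proof (cases "l = 0")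
          case True
          then show ?thesis using eig_pow[OF m] by (simp add: V_def \<sigma>_def at)
        next
          case False
          have "\<rho> V = \<rho> (U l [^] c a l) * \<rho> (U 0 [^] (a ^ r * (r * t l)))"
            using clo False by (simp add: V_def \<rho>m)
          then show ?thesis
            using eigenvector_mult[OF \<rho>c \<rho>c x(1) eig_pow[OF l] eig_pow[OF m]] clo False
            by (simp add: \<sigma>_def at)
        qed
        moreover have "\<rho> (U l) * \<rho> (g y) = \<rho> (g y) * \<rho> V"
          using rel \<rho>m g[OF y] clo V by metis
        ultimately show ?thesis
          using eigenvector_transport[OF \<rho>c[OF clo(1)] \<rho>c[OF V] \<rho>c[OF g[OF y]] x(1)] by blast
      qed
      show "\<exists>l\<in>{..<m}. \<sigma> y l \<noteq> \<sigma> y' l" if y: "y \<in> A \<times> T" "y' \<in> A \<times> T" "y \<noteq> y'" for y y'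
      proof (rule ccontr)
        assume "\<not> ?thesis"
        then have eq: "\<sigma> y l = \<sigma> y' l" if "l < m" for l using that by auto
        obtain a t a' t' where at: "y = (a, t)" "y' = (a', t')" "a \<in> A" "a' \<in> A" "t \<in> T" "t' \<in> T"
          using y by auto
        have "[a ^ r = a' ^ r] (mod p ^ j)" using eq[OF m] j(3) by (simp add: \<sigma>_def at)
        then have a: "a = a'" using A(3) at by simp
        have "t l = t' l" for l
        proof (cases "l \<in> {1..<m}")
          case True
          then have l: "l < m" "l \<noteq> 0" by auto
          have "\<tau> 0 ^ (a ^ r * (r * t l)) = \<tau> 0 ^ (a ^ r * (r * t' l))"
            using eq[OF l(1)] l \<tau>(3)[OF l(1)] by (simp add: \<sigma>_def at a)
          then have "[(a ^ r * r) * t l = (a ^ r * r) * t' l] (mod p ^ j)"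
            using j(3) by (simp add: mult.assoc)
          moreover have "coprime (a ^ r * r) (p ^ j)" using A(2)[OF at(3)] r by simp
          ultimately have "[t l = t' l] (mod p ^ j)" by (simp add: cong_mult_lcancel_nat)
          moreover have "t l < p ^ j" "t' l < p ^ j" using at True by (auto simp: T_def PiE_iff)
          ultimately show ?thesis by (simp add: cong_less_modulus_unique_nat)
        next
          case False
          then show ?thesis
            using PiE_arb[OF at(5)[unfolded T_def]] PiE_arb[OF at(6)[unfolded T_def]] by metis
        qed
        then show False using y(3) a at by auto
      qed
    qed
    then show ?thesis by (simp add: card_cartesian_product T_def card_PiE)
  qed
  show ?thesis by (rule exI[of _ j]) (use j(1,2) card in blast)
qed

section \<open>Matrices modulo an integer\<close>

text \<open>
  The carrier of \<open>residue_ring N\<close> consists of the integers from \<open>0\<close> to \<open>N - 1\<close>, so the matrices over it are the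
  entrywise residues of integer matrices. Computations can then be done with integer matrices, where
  products and determinants of matrices over a type are available.
\<close>
definition reduce :: "int \<Rightarrow> int mat \<Rightarrow> int mat" where
  "reduce N A = map_mat (\<lambda>x. x mod N) A"

text \<open>
  The residues of a set of integer matrices. Both families of groups have this form, for sets defined by a
  congruence.
\<close>
definition mod_group :: "int \<Rightarrow> nat \<Rightarrow> int mat set \<Rightarrow> int mat monoid" where
  "mod_group N k S = \<lparr>carrier = reduce N ` S, monoid.mult = mult (mat_over (residue_ring N) k),
     one = one (mat_over (residue_ring N) k)\<rparr>"

lemma reduce_dim [simp]: "dim_row (reduce N A) = dim_row A" "dim_col (reduce N A) = dim_col A"
  by (simp_all add: reduce_def)

lemma reduce_carrier [simp]: "reduce N A \<in> carrier_mat n k \<longleftrightarrow> A \<in> carrier_mat n k"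
  by (simp add: reduce_def)

lemma reduce_index [simp]:
  "i < dim_row A \<Longrightarrow> j < dim_col A \<Longrightarrow> reduce N A $$ (i, j) = A $$ (i, j) mod N"
  by (simp add: reduce_def)

lemma reduce_reduce [simp]: "reduce N (reduce N A) = reduce N A"
  by (intro eq_matI) auto

lemma reduce_eq_iff:
  assumes "A \<in> carrier_mat n k" "B \<in> carrier_mat n k"
  shows "reduce N A = reduce N B \<longleftrightarrow> (\<forall>i<n. \<forall>j<k. [A $$ (i, j) = B $$ (i, j)] (mod N))"
proof
  assume eq: "reduce N A = reduce N B"
  show "\<forall>i<n. \<forall>j<k. [A $$ (i, j) = B $$ (i, j)] (mod N)"
  proof (intro allI impI)
    fix i j assume "i < n" "j < k"
    then show "[A $$ (i, j) = B $$ (i, j)] (mod N)"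
      using arg_cong[OF eq, of "\<lambda>A. A $$ (i, j)"] assms by (simp add: cong_def)
  qed
next
  assume "\<forall>i<n. \<forall>j<k. [A $$ (i, j) = B $$ (i, j)] (mod N)"
  then show "reduce N A = reduce N B"
    using assms by (intro eq_matI) (auto simp: cong_def)
qed

lemma reduce_mult_cong:
  assumes "A \<in> carrier_mat n k" "A' \<in> carrier_mat n k" "B \<in> carrier_mat k l" "B' \<in> carrier_mat k l"
    and "reduce N A = reduce N A'" "reduce N B = reduce N B'"
  shows "reduce N (A * B) = reduce N (A' * B')"
proof -
  have A: "[A $$ (i, s) = A' $$ (i, s)] (mod N)" if "i < n" "s < k" for i s
    using assms(5) that unfolding reduce_eq_iff[OF assms(1,2)] by blast
  have B: "[B $$ (s, j) = B' $$ (s, j)] (mod N)" if "s < k" "j < l" for s j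
    using assms(6) that unfolding reduce_eq_iff[OF assms(3,4)] by blast
  have "[(A * B) $$ (i, j) = (A' * B') $$ (i, j)] (mod N)" if "i < n" "j < l" for i j
  proof -
    have "[(\<Sum>s\<in>{0..<k}. A $$ (i, s) * B $$ (s, j)) = (\<Sum>s\<in>{0..<k}. A' $$ (i, s) * B' $$ (s, j))] (mod N)"
      using that by (intro cong_sum cong_mult A B) auto
    then show ?thesis using assms(1-4) that by (simp add: scalar_prod_def)
  qed
  then show ?thesis
    using reduce_eq_iff[OF mult_carrier_mat[OF assms(1,3)] mult_carrier_mat[OF assms(2,4)]] by simp
qed

lemma mult_carrier_mat_square [simp]:
  "A \<in> carrier_mat n n \<Longrightarrow> B \<in> carrier_mat n n \<Longrightarrow> A * B \<in> carrier_mat n n"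
  by (rule mult_carrier_mat)

lemma reduce_transpose: "reduce N (transpose_mat A) = transpose_mat (reduce N A)"
  by (intro eq_matI) auto

lemma reduce_smult_cong:
  assumes "A \<in> carrier_mat n k" "[a = b] (mod N)"
  shows "reduce N (a \<cdot>\<^sub>m A) = reduce N (b \<cdot>\<^sub>m A)"
  using assms by (intro eq_matI) (auto intro!: cong_scalar_right simp flip: cong_def)

definition symp_form :: "nat \<Rightarrow> int mat" where
  "symp_form k = mat (2 * k) (2 * k)
    (\<lambda>(i, j). if j = i + k then 1 else if i = j + k then - 1 else 0)"

lemma symp_form_carrier [simp]: "symp_form k \<in> carrier_mat (2 * k) (2 * k)"
  by (simp add: symp_form_def)

lemma symp_form_dim [simp]: "dim_row (symp_form k) = 2 * k" "dim_col (symp_form k) = 2 * k"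
  by (simp_all add: symp_form_def)

lemma symp_form_square: "symp_form k * symp_form k = - 1\<^sub>m (2 * k)"
proof (intro eq_matI)
  fix i j assume "i < dim_row (- 1\<^sub>m (2 * k) :: int mat)" "j < dim_col (- 1\<^sub>m (2 * k) :: int mat)"
  then have ij: "i < 2 * k" "j < 2 * k" by auto
  let ?f = "\<lambda>s. (if s = i + k then 1 else if i = s + k then - 1 else 0) *
      (if j = s + k then 1 else if s = j + k then - 1 else 0 :: int)"
  have "(symp_form k * symp_form k) $$ (i, j) = (\<Sum>s\<in>{0..<2 * k}. ?f s)"
    using ij by (simp add: symp_form_def scalar_prod_def)
  also have "\<dots> = (\<Sum>s\<in>{0..<2 * k}. if s = (if i < k then i + k else i - k) then (if i = j then - 1 else 0) else 0)"
    using ij by (intro sum.cong) auto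
  also have "\<dots> = (if i = j then - 1 else 0)" using ij by auto
  finally show "(symp_form k * symp_form k) $$ (i, j) = (- 1\<^sub>m (2 * k)) $$ (i, j)"
    using ij by simp
qed (auto simp: symp_form_def)

definition SL_lift :: "int \<Rightarrow> nat \<Rightarrow> int mat set" where
  "SL_lift N k = {A \<in> carrier_mat k k. [det A = 1] (mod N)}"

definition Sp_lift :: "int \<Rightarrow> nat \<Rightarrow> int mat set" where
  "Sp_lift N k = {A \<in> carrier_mat (2 * k) (2 * k).
     reduce N (A * symp_form k * transpose_mat A) = reduce N (symp_form k)}"

context residues
begin

lemma carrier_mat_over: "carrier (mat_over R k) = reduce m ` carrier_mat k k"
proof
  show "carrier (mat_over R k) \<subseteq> reduce m ` carrier_mat k k"
  proof
    fix A assume A: "A \<in> carrier (mat_over R k)"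
    then have c: "A \<in> carrier_mat k k" "\<And>i j. i < k \<Longrightarrow> j < k \<Longrightarrow> A $$ (i, j) \<in> {0..m - 1}"
      by (simp_all add: mat_over_def res_carrier_eq)
    have "A = reduce m A"
      using c by (intro eq_matI) auto
    then show "A \<in> reduce m ` carrier_mat k k" using c by blast
  qed
  show "reduce m ` carrier_mat k k \<subseteq> carrier (mat_over R k)"
    by (auto simp: mat_over_def)
qed

lemma mult_mat_over:
  assumes "A \<in> carrier_mat k k" "B \<in> carrier_mat k k"
  shows "reduce m A \<otimes>\<^bsub>mat_over R k\<^esub> reduce m B = reduce m (A * B)"
proof (intro eq_matI)
  fix i j assume "i < dim_row (reduce m (A * B))" "j < dim_col (reduce m (A * B))"
  then have ij: "i < k" "j < k" using assms by auto
  have "(reduce m A \<otimes>\<^bsub>mat_over R k\<^esub> reduce m B) $$ (i, j) =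
    (\<Oplus>\<^bsub>R\<^esub>l\<in>{0..<k}. reduce m A $$ (i, l) \<otimes>\<^bsub>R\<^esub> reduce m B $$ (l, j))"
    using ij by (simp add: mat_over_def)
  also have "\<dots> = (\<Oplus>\<^bsub>R\<^esub>l\<in>{0..<k}. (A $$ (i, l) * B $$ (l, j)) mod m)"
    using assms ij by (intro finsum_cong') (auto simp: mult_cong)
  also have "\<dots> = (\<Sum>l\<in>{0..<k}. A $$ (i, l) * B $$ (l, j)) mod m"
    by (rule sum_cong) simp
  also have "\<dots> = reduce m (A * B) $$ (i, j)"
    using assms ij by (simp add: scalar_prod_def)
  finally show "(reduce m A \<otimes>\<^bsub>mat_over R k\<^esub> reduce m B) $$ (i, j) = reduce m (A * B) $$ (i, j)" .
qed (use assms in \<open>simp_all add: mat_over_def\<close>)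

lemma one_mat_over: "\<one>\<^bsub>mat_over R k\<^esub> = reduce m (1\<^sub>m k)"
  by (intro eq_matI) (use m_gt_one in \<open>auto simp: mat_over_def res_one_eq res_zero_eq\<close>)

lemma det_over_reduce:
  assumes A: "A \<in> carrier_mat k k"
  shows "det_over R k (reduce m A) = det A mod m"
proof -
  have sgn: "(if evenperm \<pi> then \<one>\<^bsub>R\<^esub> else \<ominus>\<^bsub>R\<^esub> \<one>\<^bsub>R\<^esub>) = signof \<pi> mod m" for \<pi> :: "nat \<Rightarrow> nat"
    by (simp add: one_cong neg_cong sign_def)
  have prd: "(\<Otimes>\<^bsub>R\<^esub>i\<in>{0..<k}. reduce m A $$ (i, \<pi> i)) = (\<Prod>i = 0..<k. A $$ (i, \<pi> i)) mod m"
    if "\<pi> permutes {0..<k}" for \<pi>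
  proof -
    have "\<pi> i < k" if "i < k" for i using permutes_in_image[OF \<open>\<pi> permutes _\<close>, of i] that by simp
    then have "(\<Otimes>\<^bsub>R\<^esub>i\<in>{0..<k}. reduce m A $$ (i, \<pi> i)) = (\<Otimes>\<^bsub>R\<^esub>i\<in>{0..<k}. A $$ (i, \<pi> i) mod m)"
      using A by (intro finprod_cong') auto
    then show ?thesis by (simp add: prod_cong)
  qed
  have "det_over R k (reduce m A) = (\<Oplus>\<^bsub>R\<^esub>\<pi>\<in>{\<pi>. \<pi> permutes {0..<k}}.
      (signof \<pi> * (\<Prod>i = 0..<k. A $$ (i, \<pi> i))) mod m)"
    unfolding det_over_def by (intro finsum_cong') (auto simp: prd sgn mult_cong)
  also have "\<dots> = det A mod m"
    by (subst sum_cong) (simp_all add: finite_permutations det_def'[OF A])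
  finally show ?thesis .
qed

lemma J_over_reduce: "J_over R k = reduce m (symp_form k)"
  by (intro eq_matI) (use m_gt_one in \<open>auto simp: J_over_def symp_form_def res_one_eq res_zero_eq res_neg_eq\<close>)

lemma SL_over_eq: "SL_over R k = mod_group m k (SL_lift m k)"
proof -
  have "{A \<in> carrier (mat_over R k). det_over R k A = \<one>\<^bsub>R\<^esub>} = reduce m ` SL_lift m k"
    using m_gt_one by (auto simp: carrier_mat_over det_over_reduce SL_lift_def res_one_eq cong_def)
  then show ?thesis
    by (simp add: SL_over_def mod_group_def R_m_def mat_over_def)
qed

lemma det_cong:
  assumes "A \<in> carrier_mat k k" "B \<in> carrier_mat k k" "reduce m A = reduce m B"
  shows "[det A = det B] (mod m)"
  using assms by (metis cong_def det_over_reduce)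

text \<open>A multiple of the adjugate matrix is an inverse.\<close>
lemma ex_inverse_mod:
  assumes A: "A \<in> carrier_mat k k" and "coprime (det A) m"
  shows "\<exists>B\<in>carrier_mat k k. reduce m (A * B) = reduce m (1\<^sub>m k) \<and> reduce m (B * A) = reduce m (1\<^sub>m k)"
proof -
  obtain u where u: "[det A * u = 1] (mod m)" using assms(2) by (metis cong_solve_coprime_int)
  let ?B = "u \<cdot>\<^sub>m adj_mat A"
  note adj = adj_mat[OF A]
  have "A * ?B = (det A * u) \<cdot>\<^sub>m 1\<^sub>m k" "?B * A = (det A * u) \<cdot>\<^sub>m 1\<^sub>m k"
    using A adj by (auto simp: mult_smult_distrib[of _ k k _ k] mult_smult_assoc_mat[of _ k k _ k] mult.commute intro!: eq_matI)
  moreover have "reduce m ((det A * u) \<cdot>\<^sub>m 1\<^sub>m k) = reduce m (1 \<cdot>\<^sub>m 1\<^sub>m k)"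
    by (rule reduce_smult_cong[OF one_carrier_mat u])
  moreover have "1 \<cdot>\<^sub>m 1\<^sub>m k = (1\<^sub>m k :: int mat)" by (intro eq_matI) auto
  ultimately show ?thesis using adj(1) by (intro bexI[of _ ?B]) auto
qed

text \<open>
  The determinant of \<open>A\<close> is a unit, so \<open>A\<close> has a two-sided inverse, and this is congruent to \<open>B\<close>.
\<close>
lemma right_inverse_imp_left_inverse:
  assumes A: "A \<in> carrier_mat k k" and B: "B \<in> carrier_mat k k"
    and AB: "reduce m (A * B) = reduce m (1\<^sub>m k)"
  shows "reduce m (B * A) = reduce m (1\<^sub>m k)"
proof -
  have "[det A * det B = 1] (mod m)"
    using det_cong[of "A * B" k "1\<^sub>m k"] A B AB by (simp add: det_mult)
  then have "coprime (det A) m" by (metis cong_imp_coprime cong_sym coprime_1_left coprime_mult_left_iff)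
  then obtain C where C: "C \<in> carrier_mat k k" "reduce m (C * A) = reduce m (1\<^sub>m k)"
    using ex_inverse_mod[OF A] by blast
  have "reduce m B = reduce m ((1\<^sub>m k) * B)" using B by simp
  also have "\<dots> = reduce m ((C * A) * B)"
    by (rule reduce_mult_cong[of _ k k _ _ k]) (use A B C in auto)
  also have "\<dots> = reduce m (C * (A * B))" using A B C by (simp add: assoc_mult_mat[of _ k k _ k _ k])
  also have "\<dots> = reduce m (C * 1\<^sub>m k)"
    by (rule reduce_mult_cong[of _ k k _ _ k]) (use A B C AB in auto)
  finally have "reduce m B = reduce m C" using C by simp
  then have "reduce m (B * A) = reduce m (C * A)"
    by (intro reduce_mult_cong[of _ k k _ _ k]) (use A B C in auto)
  then show ?thesis using C by simp
qed

text \<open>The inverse of \<open>symp_form k\<close> is \<open>- symp_form k\<close>.\<close>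
lemma symplectic_right_inverse:
  assumes A: "A \<in> carrier_mat (2 * k) (2 * k)"
    and symp: "reduce m (A * symp_form k * transpose_mat A) = reduce m (symp_form k)"
  shows "reduce m (A * (symp_form k * transpose_mat A * - symp_form k)) = reduce m (1\<^sub>m (2 * k))"
proof -
  let ?n = "2 * k" and ?J = "symp_form k"
  have "A * (?J * transpose_mat A * - ?J) = (A * ?J * transpose_mat A) * - ?J"
    using A by (simp add: assoc_mult_mat[of _ ?n ?n _ ?n _ ?n])
  then have "reduce m (A * (?J * transpose_mat A * - ?J)) = reduce m (?J * - ?J)"
    using A symp by (simp only:) (rule reduce_mult_cong[of _ ?n ?n _ _ ?n]; simp)
  also have "?J * - ?J = 1\<^sub>m ?n"
    using symp_form_square[of k] by simp
  finally show ?thesis .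
qed

lemma Units_mat_overI:
  assumes A: "A \<in> carrier_mat k k" and B: "B \<in> carrier_mat k k"
    and AB: "reduce m (A * B) = reduce m (1\<^sub>m k)"
  shows "reduce m A \<in> Units (mat_over R k)"
proof -
  have "reduce m B \<otimes>\<^bsub>mat_over R k\<^esub> reduce m A = \<one>\<^bsub>mat_over R k\<^esub>"
    "reduce m A \<otimes>\<^bsub>mat_over R k\<^esub> reduce m B = \<one>\<^bsub>mat_over R k\<^esub>"
    using A B AB right_inverse_imp_left_inverse[OF A B AB] by (simp_all add: mult_mat_over one_mat_over)
  then show ?thesis
    using A B by (auto simp: Units_def carrier_mat_over intro!: bexI[of _ "reduce m B"])
qed

lemma Sp_over_eq: "Sp_over R k = mod_group m (2 * k) (Sp_lift m k)"
proof -
  let ?n = "2 * k" and ?J = "symp_form k"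
  let ?P = "\<lambda>A. A \<otimes>\<^bsub>mat_over R ?n\<^esub> J_over R k \<otimes>\<^bsub>mat_over R ?n\<^esub> transpose_mat A = J_over R k"
  have P: "?P (reduce m A) \<longleftrightarrow> reduce m (A * ?J * transpose_mat A) = reduce m ?J"
    if "A \<in> carrier_mat ?n ?n" for A
    using that by (simp add: J_over_reduce mult_mat_over reduce_transpose[symmetric])
  have "{A \<in> Units (mat_over R ?n). ?P A} = reduce m ` Sp_lift m k"
  proof (intro equalityI subsetI)
    fix A assume A: "A \<in> {A \<in> Units (mat_over R ?n). ?P A}"
    then have "A \<in> carrier (mat_over R ?n)" by (auto simp: Units_def)
    then show "A \<in> reduce m ` Sp_lift m k"
      using A P by (auto simp: carrier_mat_over Sp_lift_def)
  next
    fix A assume "A \<in> reduce m ` Sp_lift m k"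
    then obtain X where X: "X \<in> carrier_mat ?n ?n" "A = reduce m X"
      "reduce m (X * ?J * transpose_mat X) = reduce m ?J" by (auto simp: Sp_lift_def)
    have c: "?J * transpose_mat X * - ?J \<in> carrier_mat ?n ?n" using X by simp
    show "A \<in> {A \<in> Units (mat_over R ?n). ?P A}"
      using Units_mat_overI[OF X(1) c symplectic_right_inverse[OF X(1,3)]] P[OF X(1)] X by simp
  qed
  then show ?thesis
    by (simp add: Sp_over_def GL_over_def units_of_def mod_group_def R_m_def mat_over_def)
qed

lemma group_mod_group:
  assumes S: "S \<subseteq> carrier_mat k k" "1\<^sub>m k \<in> S" "\<And>A B. A \<in> S \<Longrightarrow> B \<in> S \<Longrightarrow> A * B \<in> S"
    and inv: "\<And>A. A \<in> S \<Longrightarrow> \<exists>B\<in>S. reduce m (B * A) = reduce m (1\<^sub>m k)"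
  shows "group (mod_group m k S)"
proof -
  let ?G = "mod_group m k S"
  have mult: "reduce m A \<otimes>\<^bsub>?G\<^esub> reduce m B = reduce m (A * B)" if "A \<in> S" "B \<in> S" for A B
    using that S(1) mult_mat_over[of A k B] by (auto simp: mod_group_def R_m_def)
  have one: "\<one>\<^bsub>?G\<^esub> = reduce m (1\<^sub>m k)" using one_mat_over by (simp add: mod_group_def R_m_def)
  have car: "carrier ?G = reduce m ` S" by (simp add: mod_group_def)
  show ?thesis
  proof (rule groupI)
    show "x \<otimes>\<^bsub>?G\<^esub> y \<in> carrier ?G" if "x \<in> carrier ?G" "y \<in> carrier ?G" for x y
      using that S(3) by (auto simp: car mult)
    show "\<one>\<^bsub>?G\<^esub> \<in> carrier ?G" using S(2) by (simp add: car one)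
    show "x \<otimes>\<^bsub>?G\<^esub> y \<otimes>\<^bsub>?G\<^esub> z = x \<otimes>\<^bsub>?G\<^esub> (y \<otimes>\<^bsub>?G\<^esub> z)"
      if xyz: "x \<in> carrier ?G" "y \<in> carrier ?G" "z \<in> carrier ?G" for x y z
    proof -
      obtain A B C where "A \<in> S" "B \<in> S" "C \<in> S" "x = reduce m A" "y = reduce m B" "z = reduce m C"
        using xyz unfolding car by blast
      then show ?thesis
        using S(1,3) assoc_mult_mat[of A k k B k C k] by (simp add: mult subset_iff)
    qed
    show "\<one>\<^bsub>?G\<^esub> \<otimes>\<^bsub>?G\<^esub> x = x" if x: "x \<in> carrier ?G" for x
    proof -
      obtain A where "A \<in> S" "x = reduce m A" using x unfolding car by auto
      then show ?thesis using S(1,2) mult[of "1\<^sub>m k" A] by (auto simp: one)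
    qed
    show "\<exists>y\<in>carrier ?G. y \<otimes>\<^bsub>?G\<^esub> x = \<one>\<^bsub>?G\<^esub>" if x: "x \<in> carrier ?G" for x
    proof -
      obtain A where A: "A \<in> S" "x = reduce m A" using x unfolding car by auto
      obtain B where "B \<in> S" "reduce m (B * A) = reduce m (1\<^sub>m k)" using inv[OF A(1)] by blast
      then show ?thesis using A mult[of B A] by (auto simp: one car)
    qed
  qed
qed

lemma mod_group_simps:
  assumes "S \<subseteq> carrier_mat k k"
  shows "A \<in> S \<Longrightarrow> B \<in> S \<Longrightarrow> reduce m A \<otimes>\<^bsub>mod_group m k S\<^esub> reduce m B = reduce m (A * B)"
    and "\<one>\<^bsub>mod_group m k S\<^esub> = reduce m (1\<^sub>m k)"
    and "carrier (mod_group m k S) = reduce m ` S"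
  using assms mult_mat_over[of A k B] one_mat_over by (auto simp: mod_group_def R_m_def)

lemma SL_lift_mult: "A \<in> SL_lift m k \<Longrightarrow> B \<in> SL_lift m k \<Longrightarrow> A * B \<in> SL_lift m k"
  using cong_mult[of "det A" 1 m "det B" 1] by (auto simp: SL_lift_def det_mult)

lemma group_SL_lift: "group (mod_group m k (SL_lift m k))"
proof (rule group_mod_group)
  fix A assume A: "A \<in> SL_lift m k"
  then have c: "A \<in> carrier_mat k k" and d: "[det A = 1] (mod m)" by (auto simp: SL_lift_def)
  then have "coprime (det A) m" by (metis cong_imp_coprime cong_sym coprime_1_left)
  then obtain B where B: "B \<in> carrier_mat k k" "reduce m (B * A) = reduce m (1\<^sub>m k)"
    using ex_inverse_mod[OF c] by blast
  have "[det B * det A = 1] (mod m)" using det_cong[of "B * A" k "1\<^sub>m k"] B c by (simp add: det_mult)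
  moreover have "[det B * det A = det B * 1] (mod m)" using d by (rule cong_scalar_left)
  ultimately have "[det B = 1] (mod m)" by (metis cong_sym cong_trans mult.right_neutral)
  then show "\<exists>B\<in>SL_lift m k. reduce m (B * A) = reduce m (1\<^sub>m k)" using B by (auto simp: SL_lift_def)
qed (auto simp: SL_lift_mult, auto simp: SL_lift_def)

lemma Sp_lift_mult:
  assumes "A \<in> Sp_lift m k" "B \<in> Sp_lift m k"
  shows "A * B \<in> Sp_lift m k"
proof -
  let ?n = "2 * k" and ?J = "symp_form k"
  have c: "A \<in> carrier_mat ?n ?n" "B \<in> carrier_mat ?n ?n" using assms by (auto simp: Sp_lift_def)
  have "(A * B) * ?J * transpose_mat (A * B) = A * (B * ?J * transpose_mat B) * transpose_mat A"
    using c by (simp add: transpose_mult[of _ ?n ?n] assoc_mult_mat[of _ ?n ?n _ ?n _ ?n])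
  moreover have "reduce m \<dots> = reduce m (A * ?J * transpose_mat A)"
    by (rule reduce_mult_cong[of _ ?n ?n _ _ ?n], insert c assms)
      (auto simp: Sp_lift_def intro!: reduce_mult_cong[of _ ?n ?n _ _ ?n])
  ultimately show ?thesis using assms c by (simp add: Sp_lift_def)
qed

lemma group_Sp_lift: "group (mod_group m (2 * k) (Sp_lift m k))"
proof (rule group_mod_group)
  let ?n = "2 * k" and ?J = "symp_form k"
  fix A assume A: "A \<in> Sp_lift m k"
  then have c: "A \<in> carrier_mat ?n ?n" and s: "reduce m (A * ?J * transpose_mat A) = reduce m ?J"
    by (auto simp: Sp_lift_def)
  define B where "B = ?J * transpose_mat A * - ?J"
  have B: "B \<in> carrier_mat ?n ?n" using c by (simp add: B_def)
  have BA: "reduce m (B * A) = reduce m (1\<^sub>m ?n)"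
    using right_inverse_imp_left_inverse[OF c B] symplectic_right_inverse[OF c s] by (simp add: B_def)
  have BA': "reduce m (transpose_mat (B * A)) = reduce m (1\<^sub>m ?n)"
    using BA by (simp add: reduce_transpose) (simp add: reduce_transpose[symmetric])
  have "reduce m (B * ?J * transpose_mat B) = reduce m (B * (A * ?J * transpose_mat A) * transpose_mat B)"
    by (rule reduce_mult_cong[of _ ?n ?n _ _ ?n], insert c B s)
      (auto intro!: reduce_mult_cong[of _ ?n ?n _ _ ?n])
  also have "B * (A * ?J * transpose_mat A) * transpose_mat B = (B * A) * ?J * transpose_mat (B * A)"
    using c B by (simp add: transpose_mult[of _ ?n ?n] assoc_mult_mat[of _ ?n ?n _ ?n _ ?n])
  also have "reduce m \<dots> = reduce m (1\<^sub>m ?n * ?J * 1\<^sub>m ?n)"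
  proof (rule reduce_mult_cong[of _ ?n ?n _ _ ?n])
    show "reduce m (B * A * ?J) = reduce m (1\<^sub>m ?n * ?J)"
      by (rule reduce_mult_cong[of _ ?n ?n _ _ ?n]) (use c B BA in simp_all)
  qed (use c B BA' in simp_all)
  also have "1\<^sub>m ?n * ?J * 1\<^sub>m ?n = ?J"
    by (simp only: left_mult_one_mat[OF symp_form_carrier] right_mult_one_mat[OF symp_form_carrier])
  finally have "B \<in> Sp_lift m k" using B by (simp add: Sp_lift_def)
  then show "\<exists>B\<in>Sp_lift m k. reduce m (B * A) = reduce m (1\<^sub>m ?n)" using BA by blast
qed (auto simp: Sp_lift_mult, auto simp: Sp_lift_def)

lemma finite_mod_group:
  assumes "S \<subseteq> carrier_mat k k"
  shows "finite (carrier (mod_group m k S))"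
proof -
  have "reduce m ` S \<subseteq> (\<lambda>f. mat k k f) ` (({0..<k} \<times> {0..<k}) \<rightarrow>\<^sub>E {0..<m})"
  proof
    fix B assume "B \<in> reduce m ` S"
    then obtain A where A: "A \<in> carrier_mat k k" "B = reduce m A" using assms by auto
    then have "B = mat k k (restrict (\<lambda>(i, j). A $$ (i, j) mod m) ({0..<k} \<times> {0..<k}))"
      by (intro eq_matI) auto
    moreover have "restrict (\<lambda>(i, j). A $$ (i, j) mod m) ({0..<k} \<times> {0..<k})
        \<in> ({0..<k} \<times> {0..<k}) \<rightarrow>\<^sub>E {0..<m}"
      using m_gt_one by (intro restrict_PiE_iff[THEN iffD2]) auto
    ultimately show "B \<in> (\<lambda>f. mat k k f) ` (({0..<k} \<times> {0..<k}) \<rightarrow>\<^sub>E {0..<m})"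
      by (rule image_eqI)
  qed
  moreover have "finite (({0..<k} \<times> {0..<k}) \<rightarrow>\<^sub>E {0..<m})" by (intro finite_PiE) auto
  ultimately show ?thesis by (simp add: mod_group_def finite_subset)
qed

text \<open>For a matrix of size two, \<open>A * J * transpose_mat A = det A \<cdot>\<^sub>m J\<close>.\<close>
lemma SL_2_eq_Sp_2: "SL_over R 2 = Sp_over R 1"
proof -
  have "SL_lift m 2 = Sp_lift m 1"
  proof -
    have "reduce m (A * symp_form 1 * transpose_mat A) = reduce m (symp_form 1) \<longleftrightarrow> [det A = 1] (mod m)"
      if A: "A \<in> carrier_mat 2 2" for A
    proof -
      have d: "det A = A $$ (0,0) * A $$ (1,1) - A $$ (0,1) * A $$ (1,0)"
        using A by (subst laplace_expansion_row[of _ 2 0])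
          (auto simp: cofactor_def mat_delete_def det_single[of _] numeral_2_eq_2)
      have "A * symp_form 1 * transpose_mat A = mat 2 2 (\<lambda>(i, j). if i = j then 0 else if i = 0 then det A else - det A)"
        (is "?L = ?M")
      proof (intro eq_matI)
        fix i j assume "i < dim_row ?M" "j < dim_col ?M"
        then have "i \<in> {0, 1}" "j \<in> {0, 1}" by auto
        then show "?L $$ (i, j) = ?M $$ (i, j)"
          using A unfolding d by (auto simp: symp_form_def scalar_prod_def row_def col_def numeral_2_eq_2 algebra_simps)
      qed (use A in auto)
      moreover have "reduce m ?M = reduce m (symp_form 1) \<longleftrightarrow> [det A = 1] (mod m)"
      proof -
        have "[- det A = - 1] (mod m) \<longleftrightarrow> [det A = 1] (mod m)"
          by (rule cong_minus_minus_iff)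
        moreover have all2: "(\<forall>i<2. P i) \<longleftrightarrow> P 0 \<and> P (1::nat)" for P
          by (auto simp: less_2_cases_iff)
        ultimately show ?thesis
          by (subst reduce_eq_iff[of _ 2 2]) (auto simp: all2 symp_form_def)
      qed
      ultimately show ?thesis by simp
    qed
    then show ?thesis by (auto simp: SL_lift_def Sp_lift_def)
  qed
  then show ?thesis by (simp add: SL_over_eq Sp_over_eq)
qed

end

section \<open>The symplectic group as the normal closure of a transvection\<close>

definition sform :: "nat \<Rightarrow> int vec \<Rightarrow> int vec \<Rightarrow> int" where
  "sform k x y = (\<Sum>i<k. x $ i * y $ (i + k) - x $ (i + k) * y $ i)"

text \<open>
  The matrix of the map that takes \<open>x\<close> to \<open>x + (s * sform k x v) \<cdot>\<^sub>v v\<close>. The conditional expression gives the coefficients of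
  the linear form \<open>\<lambda>x. sform k x v\<close>.
\<close>
definition transvection :: "nat \<Rightarrow> int vec \<Rightarrow> int \<Rightarrow> int mat" where
  "transvection k v s = mat (2 * k) (2 * k)
     (\<lambda>(i, j). (if i = j then 1 else 0) + s * v $ i * (if j < k then v $ (j + k) else - v $ (j - k)))"

definition vcong :: "int \<Rightarrow> nat \<Rightarrow> int vec \<Rightarrow> int vec \<Rightarrow> bool" where
  "vcong N d x y \<longleftrightarrow> (\<forall>i<d. [x $ i = y $ i] (mod N))"

lemma vcong_refl [simp]: "vcong N d x x"
  by (simp add: vcong_def)

lemma vcong_sym: "vcong N d x y \<Longrightarrow> vcong N d y x"
  by (simp add: vcong_def cong_sym_eq)

lemma vcong_trans: "vcong N d x y \<Longrightarrow> vcong N d y z \<Longrightarrow> vcong N d x z"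
  unfolding vcong_def using cong_trans by blast

lemma vcong_mult_mat_vec:
  assumes "A \<in> carrier_mat d d" "x \<in> carrier_vec d" "y \<in> carrier_vec d" "vcong N d x y"
  shows "vcong N d (A *\<^sub>v x) (A *\<^sub>v y)"
  unfolding vcong_def
proof (intro allI impI)
  fix i assume i: "i < d"
  have "[(\<Sum>s\<in>{0..<d}. A $$ (i, s) * x $ s) = (\<Sum>s\<in>{0..<d}. A $$ (i, s) * y $ s)] (mod N)"
    using assms(4) by (intro cong_sum cong_scalar_left) (auto simp: vcong_def)
  then show "[(A *\<^sub>v x) $ i = (A *\<^sub>v y) $ i] (mod N)"
    using assms(1-3) i by (simp add: scalar_prod_def)
qed

lemma sform_cong:
  assumes "vcong N (2 * k) x x'" "vcong N (2 * k) y y'"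
  shows "[sform k x y = sform k x' y'] (mod N)"
  using assms unfolding sform_def vcong_def
  by (intro cong_sum cong_diff cong_mult) auto

lemma sform_add_smult:
  assumes "x \<in> carrier_vec (2 * k)" "v \<in> carrier_vec (2 * k)"
  shows "sform k (x + a \<cdot>\<^sub>v v) y = sform k x y + a * sform k v y"
    and "sform k y (x + a \<cdot>\<^sub>v v) = sform k y x + a * sform k y v"
proof -
  have idx: "(x + a \<cdot>\<^sub>v v) $ i = x $ i + a * v $ i" if "i < 2 * k" for i
    using assms that by simp
  show "sform k (x + a \<cdot>\<^sub>v v) y = sform k x y + a * sform k v y"
    unfolding sform_def sum_distrib_left sum.distrib[symmetric]
    by (intro sum.cong refl) (simp add: idx algebra_simps del: index_add_vec)
  show "sform k y (x + a \<cdot>\<^sub>v v) = sform k y x + a * sform k y v"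
    unfolding sform_def sum_distrib_left sum.distrib[symmetric]
    by (intro sum.cong refl) (simp add: idx algebra_simps del: index_add_vec)
qed

lemma sform_add:
  assumes "x \<in> carrier_vec (2 * k)" "v \<in> carrier_vec (2 * k)"
  shows "sform k (x + v) y = sform k x y + sform k v y"
    and "sform k y (x + v) = sform k y x + sform k y v"
  using sform_add_smult[OF assms, where a = 1] by simp_all

lemma sform_minus:
  assumes "x \<in> carrier_vec (2 * k)" "v \<in> carrier_vec (2 * k)"
  shows "sform k (x - v) y = sform k x y - sform k v y"
    and "sform k y (x - v) = sform k y x - sform k y v"
proof -
  have "x - v = x + (- 1) \<cdot>\<^sub>v v" using assms by (intro eq_vecI) auto
  then show "sform k (x - v) y = sform k x y - sform k v y" "sform k y (x - v) = sform k y x - sform k y v"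
    using sform_add_smult[OF assms, where a = "- 1"] by simp_all
qed

lemma sform_swap: "sform k y x = - sform k x y"
  by (simp add: sform_def sum_negf[symmetric] algebra_simps)

lemma sform_self [simp]: "sform k x x = 0"
  by (simp add: sform_def algebra_simps)

lemma sform_unit_vec:
  assumes "i < k"
  shows "sform k x (unit_vec (2 * k) (i + k)) = x $ i"
    and "sform k x (unit_vec (2 * k) i) = - x $ (i + k)"
proof -
  have "sform k x (unit_vec (2 * k) (i + k)) = (\<Sum>s<k. if s = i then x $ i else 0)"
    unfolding sform_def using assms by (intro sum.cong) auto
  then show "sform k x (unit_vec (2 * k) (i + k)) = x $ i" using assms by simp
  have "sform k x (unit_vec (2 * k) i) = (\<Sum>s<k. if s = i then - x $ (i + k) else 0)"
    unfolding sform_def using assms by (intro sum.cong) auto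
  then show "sform k x (unit_vec (2 * k) i) = - x $ (i + k)" using assms by simp
qed

lemma sum_double_interval:
  fixes k :: nat
  shows "(\<Sum>j\<in>{0..<2 * k}. f j) = (\<Sum>j<k. f j + f (j + k) :: 'a :: comm_monoid_add)"
proof -
  have "(\<Sum>j\<in>{0..<2 * k}. f j) = (\<Sum>j\<in>{0..<k}. f j) + (\<Sum>j\<in>{k..<2 * k}. f j)"
    by (rule sum.atLeastLessThan_concat[symmetric]) auto
  also have "(\<Sum>j\<in>{k..<2 * k}. f j) = (\<Sum>j\<in>{0..<k}. f (j + k))"
    using sum.shift_bounds_nat_ivl[of f 0 k k] by (simp add: mult_2)
  finally show ?thesis by (simp add: sum.distrib atLeast0LessThan)
qed

lemma sform_eq_scalar_prod:
  assumes "x \<in> carrier_vec (2 * k)" "y \<in> carrier_vec (2 * k)"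
  shows "sform k x y = x \<bullet> (symp_form k *\<^sub>v y)"
proof -
  have J: "(symp_form k *\<^sub>v y) $ i = (if i < k then y $ (i + k) else - y $ (i - k))" if "i < 2 * k" for i
  proof -
    have "(symp_form k *\<^sub>v y) $ i = (\<Sum>s\<in>{0..<2 * k}. (if s = i + k then 1 else if i = s + k then - 1 else 0) * y $ s)"
      using assms that by (simp add: symp_form_def scalar_prod_def)
    also have "\<dots> = (\<Sum>s\<in>{0..<2 * k}. if s = (if i < k then i + k else i - k) then (if i < k then 1 else - 1) * y $ s else 0)"
      using that by (intro sum.cong) auto
    also have "\<dots> = (if i < k then y $ (i + k) else - y $ (i - k))" using that by auto
    finally show ?thesis .
  qed
  have "x \<bullet> (symp_form k *\<^sub>v y) = (\<Sum>i\<in>{0..<2 * k}. x $ i * (if i < k then y $ (i + k) else - y $ (i - k)))"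
    unfolding scalar_prod_def using J by (intro sum.cong) auto
  also have "\<dots> = sform k x y"
    unfolding sum_double_interval sform_def by (intro sum.cong) auto
  finally show ?thesis ..
qed

lemma transvection_carrier [simp]: "transvection k v s \<in> carrier_mat (2 * k) (2 * k)"
  by (simp add: transvection_def)

lemma transvection_mult_vec:
  assumes x: "x \<in> carrier_vec (2 * k)" and v: "v \<in> carrier_vec (2 * k)"
  shows "transvection k v s *\<^sub>v x = x + (s * sform k x v) \<cdot>\<^sub>v v"
proof (intro eq_vecI)
  fix i assume "i < dim_vec (x + (s * sform k x v) \<cdot>\<^sub>v v)"
  then have i: "i < 2 * k" using v by simp
  let ?w = "\<lambda>j. if j < k then v $ (j + k) else - v $ (j - k)"
  have w: "(\<Sum>j\<in>{0..<2 * k}. ?w j * x $ j) = sform k x v"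
    unfolding sum_double_interval sform_def by (intro sum.cong) (auto simp: algebra_simps)
  have "(transvection k v s *\<^sub>v x) $ i = (\<Sum>j\<in>{0..<2 * k}. ((if i = j then 1 else 0) + s * v $ i * ?w j) * x $ j)"
    using x i by (simp add: transvection_def scalar_prod_def)
  also have "\<dots> = (\<Sum>j\<in>{0..<2 * k}. (if i = j then x $ j else 0) + (s * v $ i) * (?w j * x $ j))"
    by (intro sum.cong) (auto simp: algebra_simps)
  also have "\<dots> = x $ i + (s * v $ i) * sform k x v"
    using i unfolding sum.distrib sum_distrib_left[symmetric] w by simp
  finally show "(transvection k v s *\<^sub>v x) $ i = (x + (s * sform k x v) \<cdot>\<^sub>v v) $ i"
    using i x v by simp
qed (use x v in \<open>simp_all add: transvection_def\<close>)

lemma sform_transvection: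
  assumes "x \<in> carrier_vec (2 * k)" "y \<in> carrier_vec (2 * k)" "v \<in> carrier_vec (2 * k)"
  shows "sform k (transvection k v s *\<^sub>v x) (transvection k v s *\<^sub>v y) = sform k x y"
  using assms sform_swap[of k v y]
  by (simp add: transvection_mult_vec sform_add_smult algebra_simps)

definition form_preserving :: "int \<Rightarrow> nat \<Rightarrow> int mat \<Rightarrow> bool" where
  "form_preserving N k C \<longleftrightarrow> C \<in> carrier_mat (2 * k) (2 * k) \<and>
    (\<forall>x\<in>carrier_vec (2 * k). \<forall>y\<in>carrier_vec (2 * k). [sform k (C *\<^sub>v x) (C *\<^sub>v y) = sform k x y] (mod N))"

lemma unit_vec_mult_mat:
  fixes M :: "int mat"
  assumes "M \<in> carrier_mat n n" "i < n" "j < n"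
  shows "unit_vec n i \<bullet> (M *\<^sub>v unit_vec n j) = M $$ (i, j)"
  using assms by (simp add: scalar_prod_left_unit[of _ n] scalar_prod_right_unit[of _ n])

context residues
begin

lemma form_preserving_iff:
  assumes C: "C \<in> carrier_mat (2 * k) (2 * k)"
  shows "form_preserving m k C \<longleftrightarrow>
    reduce m (transpose_mat C * symp_form k * C) = reduce m (symp_form k)"
proof -
  let ?n = "2 * k" and ?J = "symp_form k"
  let ?M = "transpose_mat C * ?J * C"
  have M: "?M \<in> carrier_mat ?n ?n" using C by simp
  have eq: "sform k (C *\<^sub>v x) (C *\<^sub>v y) = x \<bullet> (?M *\<^sub>v y)"
    if "x \<in> carrier_vec ?n" "y \<in> carrier_vec ?n" for x y
  proof -
    have JCy: "?J *\<^sub>v (C *\<^sub>v y) \<in> carrier_vec ?n"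
      by (rule mult_mat_vec_carrier[OF symp_form_carrier mult_mat_vec_carrier[OF C that(2)]])
    have "?M *\<^sub>v y = transpose_mat C *\<^sub>v (?J *\<^sub>v (C *\<^sub>v y))"
      using C that by (simp add: assoc_mult_mat_vec[of _ ?n ?n _ ?n])
    then have "x \<bullet> (?M *\<^sub>v y) = (C *\<^sub>v x) \<bullet> (?J *\<^sub>v (C *\<^sub>v y))"
      using transpose_vec_mult_scalar[OF C that(1) JCy] that JCy C
      by (metis comm_scalar_prod mult_mat_vec_carrier transpose_carrier_mat)
    then show ?thesis using sform_eq_scalar_prod C that by (metis mult_mat_vec_carrier)
  qed
  show ?thesis
  proof
    assume fp: "form_preserving m k C"
    have "[?M $$ (i, j) = ?J $$ (i, j)] (mod m)" if "i < ?n" "j < ?n" for i j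
    proof -
      have "[sform k (C *\<^sub>v unit_vec ?n i) (C *\<^sub>v unit_vec ?n j) = sform k (unit_vec ?n i) (unit_vec ?n j)] (mod m)"
        using fp by (simp add: form_preserving_def)
      then show ?thesis
        unfolding eq[OF unit_vec_carrier unit_vec_carrier]
          sform_eq_scalar_prod[OF unit_vec_carrier unit_vec_carrier]
          unit_vec_mult_mat[OF M that] unit_vec_mult_mat[OF symp_form_carrier that] .
    qed
    then show "reduce m ?M = reduce m ?J" using reduce_eq_iff[OF M symp_form_carrier] by blast
  next
    assume "reduce m ?M = reduce m ?J"
    then have ent: "[?M $$ (i, j) = ?J $$ (i, j)] (mod m)" if "i < ?n" "j < ?n" for i j
      using reduce_eq_iff[OF M symp_form_carrier] that by blast
    have "[x \<bullet> (?M *\<^sub>v y) = x \<bullet> (?J *\<^sub>v y)] (mod m)" if "x \<in> carrier_vec ?n" "y \<in> carrier_vec ?n" for x y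
    proof -
      have exp: "x \<bullet> (A *\<^sub>v y) = (\<Sum>i\<in>{0..<?n}. x $ i * (\<Sum>j\<in>{0..<?n}. A $$ (i, j) * y $ j))"
        if "A \<in> carrier_mat ?n ?n" for A
        using that \<open>y \<in> _\<close> by (simp add: scalar_prod_def)
      show ?thesis
        unfolding exp[OF M] exp[OF symp_form_carrier]
        by (intro cong_sum cong_scalar_left cong_scalar_right ent) auto
    qed
    then show "form_preserving m k C"
      using C eq sform_eq_scalar_prod by (simp add: form_preserving_def)
  qed
qed

text \<open>
  The right inverse \<open>symp_form k * transpose_mat A * - symp_form k\<close> of \<open>A\<close> is also a left inverse, and this is
  the transposed condition.
\<close>
lemma Sp_lift_transpose:
  assumes "A \<in> Sp_lift m k"
  shows "transpose_mat A \<in> Sp_lift m k"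
proof -
  let ?n = "2 * k" and ?J = "symp_form k"
  have A: "A \<in> carrier_mat ?n ?n" and s: "reduce m (A * ?J * transpose_mat A) = reduce m ?J"
    using assms by (auto simp: Sp_lift_def)
  let ?B = "?J * transpose_mat A * - ?J"
  have B: "?B \<in> carrier_mat ?n ?n" using A by (intro mult_carrier_mat_square) auto
  have "reduce m (?B * A) = reduce m (1\<^sub>m ?n)"
    by (rule right_inverse_imp_left_inverse[OF A B symplectic_right_inverse[OF A s]])
  then have "reduce m (?J * (?B * A)) = reduce m (?J * 1\<^sub>m ?n)"
    by (intro reduce_mult_cong[of _ ?n ?n _ _ ?n]) (use A B in simp_all)
  moreover have "?J * (?B * A) = transpose_mat A * ?J * A"
  proof -
    have "?J * (?B * A) = - ((?J * ?J) * (transpose_mat A * (?J * A)))"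
      using A by (simp add: assoc_mult_mat[of _ ?n ?n _ ?n _ ?n])
    also have "\<dots> = transpose_mat A * (?J * A)"
      unfolding symp_form_square using A left_mult_one_mat[of "transpose_mat A * (?J * A)" ?n ?n] by simp
    finally show ?thesis using A by (simp add: assoc_mult_mat[of _ ?n ?n _ ?n _ ?n])
  qed
  ultimately show ?thesis using A right_mult_one_mat[OF symp_form_carrier] by (simp add: Sp_lift_def)
qed

text \<open>
  \<open>A\<close> preserves the form if \<open>transpose_mat A * symp_form k * A\<close> is congruent to \<open>symp_form k\<close>, while the set
  \<open>Sp_lift\<close> is defined with the transpose on the right.
\<close>
lemma Sp_lift_iff_form_preserving: "C \<in> Sp_lift m k \<longleftrightarrow> form_preserving m k C"
proof (cases "C \<in> carrier_mat (2 * k) (2 * k)")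
  case True
  have "C \<in> Sp_lift m k \<longleftrightarrow> transpose_mat C \<in> Sp_lift m k"
    using Sp_lift_transpose[of C] Sp_lift_transpose[of "transpose_mat C"] by auto
  then show ?thesis using True by (simp add: form_preserving_iff Sp_lift_def)
qed (auto simp: Sp_lift_def form_preserving_def)

lemma transvection_in_Sp_lift:
  "v \<in> carrier_vec (2 * k) \<Longrightarrow> transvection k v s \<in> Sp_lift m k"
  by (simp add: Sp_lift_iff_form_preserving form_preserving_def sform_transvection)

end

lemma mult_unit_vec_index:
  fixes M :: "'a :: semiring_1 mat"
  assumes "M \<in> carrier_mat n n" "i < n" "j < n"
  shows "(M *\<^sub>v unit_vec n j) $ i = M $$ (i, j)"
  using assms by (simp add: scalar_prod_right_unit)

locale prime_power_modulus =
  fixes p n :: nat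
  assumes prime: "prime p" and n_pos: "n \<ge> 1"
begin

abbreviation "N \<equiv> int p ^ n"

abbreviation "SL_mod k \<equiv> mod_group N k (SL_lift N k)"

abbreviation "Sp_mod k \<equiv> mod_group N (2 * k) (Sp_lift N k)"

lemma modulus_gt_1: "N > 1"
proof -
  have "1 < int p" using prime_gt_1_nat[OF prime] by simp
  then show ?thesis using n_pos by (simp add: one_less_power)
qed

sublocale residues N "residue_ring N"
  by unfold_locales (rule modulus_gt_1)

lemma p_dvd_modulus: "int p dvd N"
  using n_pos by (simp add: dvd_power)

lemma prime_int_p: "prime (int p)"
  using prime by simp

lemma cong_mod_p: "[a = b] (mod N) \<Longrightarrow> int p dvd a \<longleftrightarrow> int p dvd b"
  using p_dvd_modulus by (meson cong_dvd_iff cong_dvd_modulus)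

lemma ex_inverse_of_unit:
  assumes "\<not> int p dvd a"
  shows "\<exists>b. [a * b = 1] (mod N)"
proof -
  have "coprime (int p) a" using prime_int_p assms by (rule prime_imp_coprime)
  then have "coprime a N" by (simp add: coprime_commute)
  then show ?thesis by (rule cong_solve_coprime_int)
qed

lemma not_dvd_of_cong_1: "[a = 1] (mod N) \<Longrightarrow> \<not> int p dvd a"
  using cong_mod_p[of a 1] prime_gt_1_nat[OF prime] by simp

definition unimodular :: "nat \<Rightarrow> int vec \<Rightarrow> bool" where
  "unimodular k v \<longleftrightarrow> v \<in> carrier_vec (2 * k) \<and> (\<exists>i<2 * k. \<not> int p dvd v $ i)"

text \<open>
  The orthogonal complement, modulo \<open>N\<close>, of the first \<open>m\<close> hyperbolic pairs of unit vectors.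
\<close>
definition fixed_complement :: "nat \<Rightarrow> nat \<Rightarrow> int vec set" where
  "fixed_complement k m = {x \<in> carrier_vec (2 * k). \<forall>i<m. [x $ i = 0] (mod N) \<and> [x $ (i + k) = 0] (mod N)}"

lemma unimodularI:
  assumes "v \<in> carrier_vec (2 * k)" "\<not> int p dvd sform k x v"
  shows "unimodular k v"
proof -
  have "int p dvd sform k x v" if "\<And>i. i < 2 * k \<Longrightarrow> int p dvd v $ i"
    unfolding sform_def using that by (intro dvd_sum dvd_diff dvd_mult) auto
  then show ?thesis using assms by (auto simp: unimodular_def)
qed

text \<open>
  Up to sign, a coordinate of \<open>x\<close> is the value of the form at \<open>x\<close> and a unit vector.
\<close>
lemma ex_dual_vector:
  assumes x: "x \<in> fixed_complement k m" and u: "unimodular k x" and m: "m \<le> k"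
  shows "\<exists>z\<in>fixed_complement k m. \<not> int p dvd sform k x z"
proof -
  obtain i where i: "i < 2 * k" "\<not> int p dvd x $ i" using u by (auto simp: unimodular_def)
  have nz: "\<not> [x $ i = 0] (mod N)" using i(2) cong_mod_p[of "x $ i" 0] by auto
  show ?thesis
  proof (cases "i < k")
    case True
    have "\<not> i < m" using nz x by (auto simp: fixed_complement_def)
    then have "unit_vec (2 * k) (i + k) \<in> fixed_complement k m"
      using True m by (auto simp: fixed_complement_def)
    then show ?thesis using sform_unit_vec(1)[OF True, of x] i by (intro bexI[of _ "unit_vec (2 * k) (i + k)"]) auto
  next
    case False
    define l where "l = i - k"
    have l: "l < k" "i = l + k" using i False by (auto simp: l_def)
    have "\<not> l < m" using nz x l by (auto simp: fixed_complement_def)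
    then have "unit_vec (2 * k) l \<in> fixed_complement k m"
      using l m by (auto simp: fixed_complement_def)
    then show ?thesis using sform_unit_vec(2)[OF l(1), of x] i l by (intro bexI[of _ "unit_vec (2 * k) l"]) auto
  qed
qed

end

text \<open>
  Two such monoids are used. For the whole symplectic group, the locale shows that it acts transitively
  on unimodular vectors. For the elements whose residues lie in a given normal subgroup, it shows that
  this subgroup is the whole group.
\<close>
locale transvection_monoid = prime_power_modulus +
  fixes k :: nat and H :: "int mat set"
  assumes H_form: "\<And>C. C \<in> H \<Longrightarrow> form_preserving N k C"
    and H_mult: "\<And>C D. C \<in> H \<Longrightarrow> D \<in> H \<Longrightarrow> C * D \<in> H"
    and H_one: "1\<^sub>m (2 * k) \<in> H"
    and H_transvection: "\<And>v s. unimodular k v \<Longrightarrow> transvection k v s \<in> H"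
begin

definition pointwise_stabilizer :: "nat \<Rightarrow> int mat set" where
  "pointwise_stabilizer m = {C \<in> H. \<forall>i<m.
     vcong N (2 * k) (C *\<^sub>v unit_vec (2 * k) i) (unit_vec (2 * k) i) \<and>
     vcong N (2 * k) (C *\<^sub>v unit_vec (2 * k) (i + k)) (unit_vec (2 * k) (i + k))}"

lemma H_carrier [simp]: "C \<in> H \<Longrightarrow> C \<in> carrier_mat (2 * k) (2 * k)"
  using H_form by (auto simp: form_preserving_def)

lemma vcong_mult_compose:
  assumes "C \<in> carrier_mat (2 * k) (2 * k)" "D \<in> carrier_mat (2 * k) (2 * k)" "x \<in> carrier_vec (2 * k)"
    "y \<in> carrier_vec (2 * k)" "vcong N (2 * k) (D *\<^sub>v x) y" "vcong N (2 * k) (C *\<^sub>v y) z"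
  shows "vcong N (2 * k) ((C * D) *\<^sub>v x) z"
proof -
  have "vcong N (2 * k) (C *\<^sub>v (D *\<^sub>v x)) (C *\<^sub>v y)"
    by (rule vcong_mult_mat_vec[OF assms(1) mult_mat_vec_carrier[OF assms(2,3)] assms(4,5)])
  then show ?thesis
    unfolding assoc_mult_mat_vec[OF assms(1-3)] using assms(6) by (rule vcong_trans)
qed

lemma stabilizer_mult:
  assumes "C \<in> pointwise_stabilizer m" "D \<in> pointwise_stabilizer m"
  shows "C * D \<in> pointwise_stabilizer m"
  using assms H_mult vcong_mult_compose[OF H_carrier H_carrier unit_vec_carrier unit_vec_carrier]
  by (auto simp: pointwise_stabilizer_def)

lemma transvection_fixes_orthogonal:
  assumes x: "x \<in> carrier_vec (2 * k)" and v: "v \<in> carrier_vec (2 * k)" and xv: "[sform k x v = 0] (mod N)"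
  shows "vcong N (2 * k) (transvection k v s *\<^sub>v x) x"
  unfolding vcong_def
proof (intro allI impI)
  fix i assume i: "i < 2 * k"
  have "[x $ i + (s * sform k x v) * v $ i = x $ i + (s * 0) * v $ i] (mod N)"
    by (intro cong_add cong_refl cong_scalar_right cong_scalar_left xv)
  then show "[(transvection k v s *\<^sub>v x) $ i = x $ i] (mod N)"
    using x v i by (simp add: transvection_mult_vec)
qed

lemma stabilizer_transvection:
  assumes v: "v \<in> fixed_complement k m" "unimodular k v" and m: "m \<le> k"
  shows "transvection k v s \<in> pointwise_stabilizer m"
proof -
  have vc: "v \<in> carrier_vec (2 * k)" using v by (simp add: fixed_complement_def)
  have "[sform k (unit_vec (2 * k) i) v = 0] (mod N)" "[sform k (unit_vec (2 * k) (i + k)) v = 0] (mod N)" if "i < m" for i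
  proof -
    have "i < k" using that m by simp
    moreover have "[- v $ i = 0] (mod N)" "[v $ (i + k) = 0] (mod N)"
      using v that by (auto simp: fixed_complement_def cong_0_iff)
    ultimately show "[sform k (unit_vec (2 * k) i) v = 0] (mod N)" "[sform k (unit_vec (2 * k) (i + k)) v = 0] (mod N)"
      by (simp_all add: sform_swap[of k _ v] sform_unit_vec)
  qed
  then show ?thesis
    using H_transvection[OF v(2)] transvection_fixes_orthogonal[OF _ vc] by (simp add: pointwise_stabilizer_def)
qed

text \<open>The transvection along \<open>y - x\<close> with a suitable factor takes \<open>x\<close> to \<open>y\<close>.\<close>
lemma stabilizer_moves_nonorthogonal:
  assumes x: "x \<in> fixed_complement k m" and y: "y \<in> fixed_complement k m"
    and unit: "\<not> int p dvd sform k x y" and m: "m \<le> k"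
  shows "\<exists>C\<in>pointwise_stabilizer m. vcong N (2 * k) (C *\<^sub>v x) y \<and>
    (\<forall>z\<in>carrier_vec (2 * k). [sform k z (y - x) = 0] (mod N) \<longrightarrow> vcong N (2 * k) (C *\<^sub>v z) z)"
proof -
  have c: "x \<in> carrier_vec (2 * k)" "y \<in> carrier_vec (2 * k)" using x y by (auto simp: fixed_complement_def)
  obtain b where b: "[sform k x y * b = 1] (mod N)" using ex_inverse_of_unit[OF unit] by blast
  define v where "v = y - x"
  have vc: "v \<in> carrier_vec (2 * k)" using c by (simp add: v_def)
  have xv: "sform k x v = sform k x y" using c by (simp add: v_def sform_minus)
  have v: "v \<in> fixed_complement k m"
    using x y m by (auto simp: v_def fixed_complement_def cong_0_iff)
  have "unimodular k v" using unimodularI[OF vc, of x] unit xv by simp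
  then have C: "transvection k v b \<in> pointwise_stabilizer m" using v m by (intro stabilizer_transvection)
  have "vcong N (2 * k) (transvection k v b *\<^sub>v x) y"
    unfolding vcong_def
  proof (intro allI impI)
    fix i assume i: "i < 2 * k"
    have "[x $ i + (sform k x y * b) * (y $ i - x $ i) = x $ i + 1 * (y $ i - x $ i)] (mod N)"
      by (intro cong_add cong_refl cong_scalar_right b)
    then show "[(transvection k v b *\<^sub>v x) $ i = y $ i] (mod N)"
      using c vc i xv by (simp add: transvection_mult_vec) (simp add: v_def mult.commute)
  qed
  then show ?thesis using C transvection_fixes_orthogonal[OF _ vc] unfolding v_def by blast
qed

lemma fixed_complement_add:
  "x \<in> fixed_complement k m \<Longrightarrow> y \<in> fixed_complement k m \<Longrightarrow> m \<le> k \<Longrightarrow> x + y \<in> fixed_complement k m"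
  by (auto simp: fixed_complement_def cong_0_iff)

lemma stabilizer_transitive_unimodular:
  assumes x: "x \<in> fixed_complement k m" "unimodular k x" and y: "y \<in> fixed_complement k m" "unimodular k y"
    and m: "m \<le> k"
  shows "\<exists>C\<in>pointwise_stabilizer m. vcong N (2 * k) (C *\<^sub>v x) y"
proof -
  \<comment> \<open>Over a local ring, one vector pairs with both \<open>x\<close> and \<open>y\<close> to a unit.\<close>
  have "\<exists>z\<in>fixed_complement k m. \<not> int p dvd sform k x z \<and> \<not> int p dvd sform k z y"
  proof -
    obtain z where z: "z \<in> fixed_complement k m" "\<not> int p dvd sform k x z"
      using ex_dual_vector[OF x m] by blast
    obtain w where w: "w \<in> fixed_complement k m" "\<not> int p dvd sform k y w"
      using ex_dual_vector[OF y m] by blast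
    have w': "\<not> int p dvd sform k w y" using w(2) sform_swap[of k w y] by simp
    consider "\<not> int p dvd sform k z y" | "\<not> int p dvd sform k x w"
      | "int p dvd sform k z y" "int p dvd sform k x w" by blast
    then show ?thesis
    proof cases
      case 3
      have "sform k x (z + w) = sform k x z + sform k x w" "sform k (z + w) y = sform k z y + sform k w y"
        using z w by (auto simp: fixed_complement_def sform_add)
      then have "\<not> int p dvd sform k x (z + w)" "\<not> int p dvd sform k (z + w) y"
        using 3 z(2) w' by (simp_all add: dvd_add_left_iff dvd_add_right_iff)
      then show ?thesis using fixed_complement_add[OF z(1) w(1) m] by blast
    qed (use z w w' in blast)+
  qed
  then obtain z where z: "z \<in> fixed_complement k m" "\<not> int p dvd sform k x z" "\<not> int p dvd sform k z y"
    by blast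
  obtain C where C: "C \<in> pointwise_stabilizer m" "vcong N (2 * k) (C *\<^sub>v x) z"
    using stabilizer_moves_nonorthogonal[OF x(1) z(1,2) m] by blast
  obtain D where D: "D \<in> pointwise_stabilizer m" "vcong N (2 * k) (D *\<^sub>v z) y"
    using stabilizer_moves_nonorthogonal[OF z(1) y(1) z(3) m] by blast
  have "vcong N (2 * k) ((D * C) *\<^sub>v x) y"
    by (rule vcong_mult_compose[OF H_carrier H_carrier _ _ C(2) D(2)])
      (use C D x z in \<open>auto simp: pointwise_stabilizer_def fixed_complement_def\<close>)
  then show ?thesis using stabilizer_mult[OF D(1) C(1)] by blast
qed

text \<open>
  If \<open>sform k y y'\<close> is a unit, the transvection along \<open>y' - y\<close> that takes \<open>y\<close> to \<open>y'\<close> fixes \<open>x\<close>. Otherwise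
  \<open>y + x\<close> serves as an intermediate step.
\<close>
lemma stabilizer_transitive_dual:
  assumes x: "x \<in> fixed_complement k m" and y: "y \<in> fixed_complement k m" and y': "y' \<in> fixed_complement k m"
    and xy: "[sform k x y = 1] (mod N)" and xy': "[sform k x y' = 1] (mod N)" and m: "m \<le> k"
  shows "\<exists>C\<in>pointwise_stabilizer m. vcong N (2 * k) (C *\<^sub>v x) x \<and> vcong N (2 * k) (C *\<^sub>v y) y'"
proof -
  have c: "x \<in> carrier_vec (2 * k)" "y \<in> carrier_vec (2 * k)" "y' \<in> carrier_vec (2 * k)"
    using x y y' by (auto simp: fixed_complement_def)
  have step: "\<exists>C\<in>pointwise_stabilizer m. vcong N (2 * k) (C *\<^sub>v x) x \<and> vcong N (2 * k) (C *\<^sub>v a) b"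
    if ab: "a \<in> fixed_complement k m" "b \<in> fixed_complement k m" "[sform k x a = 1] (mod N)" "[sform k x b = 1] (mod N)"
      "\<not> int p dvd sform k a b" for a b
  proof -
    have abc: "a \<in> carrier_vec (2 * k)" "b \<in> carrier_vec (2 * k)" using ab by (auto simp: fixed_complement_def)
    have "[sform k x b - sform k x a = 1 - 1] (mod N)" by (intro cong_diff ab)
    then have "[sform k x (b - a) = 0] (mod N)" using abc by (simp add: sform_minus)
    then show ?thesis
      using stabilizer_moves_nonorthogonal[OF ab(1,2,5) m] c(1) by blast
  qed
  show ?thesis
  proof (cases "int p dvd sform k y y'")
    case False
    then show ?thesis using step[OF y y' xy xy'] by blast
  next
    case True
    let ?z = "y + x"
    have z: "?z \<in> fixed_complement k m" using fixed_complement_add[OF y x m] .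
    have xz: "[sform k x ?z = 1] (mod N)" using xy c by (simp add: sform_add)
    have "sform k y ?z = - sform k x y" using c sform_swap[of k y x] by (simp add: sform_add)
    then have yz: "\<not> int p dvd sform k y ?z" using not_dvd_of_cong_1[OF xy] by simp
    have "sform k ?z y' = sform k y y' + sform k x y'" using c by (simp add: sform_add)
    then have zy': "\<not> int p dvd sform k ?z y'"
      using not_dvd_of_cong_1[OF xy'] True by (simp add: dvd_add_right_iff)
    obtain C where C: "C \<in> pointwise_stabilizer m" "vcong N (2 * k) (C *\<^sub>v x) x" "vcong N (2 * k) (C *\<^sub>v y) ?z"
      using step[OF y z xy xz yz] by blast
    obtain D where D: "D \<in> pointwise_stabilizer m" "vcong N (2 * k) (D *\<^sub>v x) x" "vcong N (2 * k) (D *\<^sub>v ?z) y'"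
      using step[OF z y' xz xy' zy'] by blast
    have H: "C \<in> H" "D \<in> H" using C D by (auto simp: pointwise_stabilizer_def)
    have "vcong N (2 * k) ((D * C) *\<^sub>v x) x" "vcong N (2 * k) ((D * C) *\<^sub>v y) y'"
      using vcong_mult_compose[OF H_carrier[OF H(2)] H_carrier[OF H(1)] c(1) c(1) C(2) D(2)]
        vcong_mult_compose[OF H_carrier[OF H(2)] H_carrier[OF H(1)] c(2) _ C(3) D(3)] c by auto
    then show ?thesis using stabilizer_mult[OF D(1) C(1)] by blast
  qed
qed

lemma unit_vec_in_fixed_complement:
  "m \<le> i \<Longrightarrow> i < k \<Longrightarrow> unit_vec (2 * k) i \<in> fixed_complement k m"
  "m \<le> i \<Longrightarrow> i < k \<Longrightarrow> unit_vec (2 * k) (i + k) \<in> fixed_complement k m"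
  by (auto simp: fixed_complement_def)

text \<open>The coordinates of a vector are, up to sign, the values of the form at the vector and the unit vectors.\<close>
lemma orthogonal_to_fixed_pairs:
  assumes A: "form_preserving N k A" and x: "x \<in> fixed_complement k m" and m: "m \<le> k"
    and fixed: "\<And>i. i < m \<Longrightarrow> vcong N (2 * k) (A *\<^sub>v unit_vec (2 * k) i) (unit_vec (2 * k) i) \<and>
     vcong N (2 * k) (A *\<^sub>v unit_vec (2 * k) (i + k)) (unit_vec (2 * k) (i + k))"
  shows "A *\<^sub>v x \<in> fixed_complement k m"
proof -
  have c: "x \<in> carrier_vec (2 * k)" "A \<in> carrier_mat (2 * k) (2 * k)"
    using x A by (auto simp: fixed_complement_def form_preserving_def)
  have eq: "[sform k (A *\<^sub>v x) e = sform k x e] (mod N)"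
    if "e \<in> carrier_vec (2 * k)" "vcong N (2 * k) (A *\<^sub>v e) e" for e
  proof -
    have "[sform k (A *\<^sub>v x) e = sform k (A *\<^sub>v x) (A *\<^sub>v e)] (mod N)"
      by (intro sform_cong vcong_refl vcong_sym[OF that(2)])
    also have "[sform k (A *\<^sub>v x) (A *\<^sub>v e) = sform k x e] (mod N)"
      using A c that by (auto simp: form_preserving_def)
    finally show ?thesis .
  qed
  have "[(A *\<^sub>v x) $ i = 0] (mod N) \<and> [(A *\<^sub>v x) $ (i + k) = 0] (mod N)" if i: "i < m" for i
  proof -
    have ik: "i < k" using i m by simp
    have x0: "[x $ i = 0] (mod N)" "[x $ (i + k) = 0] (mod N)" using x i by (auto simp: fixed_complement_def)
    have "[(A *\<^sub>v x) $ i = x $ i] (mod N)" "[- (A *\<^sub>v x) $ (i + k) = - x $ (i + k)] (mod N)"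
      using eq[of "unit_vec (2 * k) (i + k)"] eq[of "unit_vec (2 * k) i"] fixed[OF i]
      unfolding sform_unit_vec[OF ik] by auto
    then show ?thesis using x0 cong_trans unfolding cong_minus_minus_iff by blast
  qed
  then show ?thesis using mult_mat_vec_carrier[OF c(2,1)] by (simp add: fixed_complement_def)
qed

lemma stabilizer_transitive_hyperbolic_pairs:
  assumes x: "x \<in> fixed_complement k m" and y: "y \<in> fixed_complement k m"
    and xy: "[sform k x y = 1] (mod N)" and m: "m < k"
  shows "\<exists>C\<in>pointwise_stabilizer m. vcong N (2 * k) (C *\<^sub>v x) (unit_vec (2 * k) m) \<and>
    vcong N (2 * k) (C *\<^sub>v y) (unit_vec (2 * k) (m + k))"
proof -
  let ?e = "unit_vec (2 * k) m :: int vec" and ?f = "unit_vec (2 * k) (m + k) :: int vec"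
  have c: "x \<in> carrier_vec (2 * k)" "y \<in> carrier_vec (2 * k)" using x y by (auto simp: fixed_complement_def)
  have mk: "m \<le> k" using m by simp
  have e: "?e \<in> fixed_complement k m" "?f \<in> fixed_complement k m"
    using unit_vec_in_fixed_complement[of m m] m by auto
  have ef: "sform k ?e ?f = 1" using sform_unit_vec(1)[OF m, of ?e] m by simp
  have ux: "unimodular k x"
    using unimodularI[OF c(1), of y] not_dvd_of_cong_1[OF xy] sform_swap[of k y x] by simp
  have ue: "unimodular k ?e"
    unfolding unimodular_def using m prime_gt_1_nat[OF prime] by (auto intro!: exI[of _ m])
  obtain C where C: "C \<in> pointwise_stabilizer m" "vcong N (2 * k) (C *\<^sub>v x) ?e"
    using stabilizer_transitive_unimodular[OF x ux e(1) ue mk] by blast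
  have CH: "C \<in> H" using C by (simp add: pointwise_stabilizer_def)
  have Cy: "C *\<^sub>v y \<in> fixed_complement k m"
    by (rule orthogonal_to_fixed_pairs[OF H_form[OF CH] y mk]) (use C(1) in \<open>simp add: pointwise_stabilizer_def\<close>)
  have "[sform k ?e (C *\<^sub>v y) = sform k (C *\<^sub>v x) (C *\<^sub>v y)] (mod N)"
    by (intro sform_cong vcong_refl vcong_sym[OF C(2)])
  also have "[sform k (C *\<^sub>v x) (C *\<^sub>v y) = sform k x y] (mod N)"
    using H_form[OF CH] c by (simp add: form_preserving_def)
  also note xy
  finally have eCy: "[sform k ?e (C *\<^sub>v y) = 1] (mod N)" .
  obtain D where D: "D \<in> pointwise_stabilizer m" "vcong N (2 * k) (D *\<^sub>v ?e) ?e"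
    "vcong N (2 * k) (D *\<^sub>v (C *\<^sub>v y)) ?f"
    using stabilizer_transitive_dual[OF e(1) Cy e(2) eCy _ mk] ef by auto
  have DH: "D \<in> H" using D by (simp add: pointwise_stabilizer_def)
  have "vcong N (2 * k) ((D * C) *\<^sub>v x) ?e"
    by (rule vcong_mult_compose[OF H_carrier[OF DH] H_carrier[OF CH] c(1) _ C(2) D(2)]) simp
  moreover have "vcong N (2 * k) ((D * C) *\<^sub>v y) ?f"
    unfolding assoc_mult_mat_vec[OF H_carrier[OF DH] H_carrier[OF CH] c(2)] by (rule D(3))
  ultimately show ?thesis using stabilizer_mult[OF D(1) C(1)] by blast
qed

text \<open>
  The columns of a symplectic matrix form hyperbolic pairs; they are moved to the standard ones
  pair by pair.
\<close>
lemma ex_left_inverse_in_monoid: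
  assumes A: "form_preserving N k A"
  shows "\<exists>C\<in>H. reduce N (C * A) = reduce N (1\<^sub>m (2 * k))"
proof -
  let ?u = "\<lambda>i. unit_vec (2 * k) i :: int vec"
  have Ac: "A \<in> carrier_mat (2 * k) (2 * k)" using A by (simp add: form_preserving_def)
  have CA: "form_preserving N k (C * A)" if "C \<in> H" for C
    using Sp_lift_mult[of C k A] H_form[OF that] A by (simp add: Sp_lift_iff_form_preserving)
  have "\<exists>C\<in>H. \<forall>i<m. vcong N (2 * k) ((C * A) *\<^sub>v ?u i) (?u i) \<and> vcong N (2 * k) ((C * A) *\<^sub>v ?u (i + k)) (?u (i + k))"
    if "m \<le> k" for m
    using that
  proof (induction m)
    case 0
    then show ?case using H_one by auto
  next
    case (Suc m)
    then obtain C where C: "C \<in> H" and fixed: "\<And>i. i < m \<Longrightarrow> vcong N (2 * k) ((C * A) *\<^sub>v ?u i) (?u i) \<and>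
      vcong N (2 * k) ((C * A) *\<^sub>v ?u (i + k)) (?u (i + k))"
      by auto
    let ?B = "C * A"
    have B: "form_preserving N k ?B" by (rule CA[OF C])
    have m: "m < k" "m \<le> k" using Suc.prems by auto
    have Bc: "?B \<in> carrier_mat (2 * k) (2 * k)" using B by (simp add: form_preserving_def)
    have x: "?B *\<^sub>v ?u m \<in> fixed_complement k m" and y: "?B *\<^sub>v ?u (m + k) \<in> fixed_complement k m"
      using orthogonal_to_fixed_pairs[OF B _ m(2) fixed] unit_vec_in_fixed_complement[of m m] m by auto
    have "sform k (?u m) (?u (m + k)) = 1" using sform_unit_vec(1)[OF m(1), of "?u m"] m by simp
    then have "[sform k (?B *\<^sub>v ?u m) (?B *\<^sub>v ?u (m + k)) = 1] (mod N)"
      using B unfolding form_preserving_def by (metis unit_vec_carrier)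
    then obtain D where D: "D \<in> pointwise_stabilizer m" "vcong N (2 * k) (D *\<^sub>v (?B *\<^sub>v ?u m)) (?u m)"
      "vcong N (2 * k) (D *\<^sub>v (?B *\<^sub>v ?u (m + k))) (?u (m + k))"
      using stabilizer_transitive_hyperbolic_pairs[OF x y _ m(1)] by blast
    have DH: "D \<in> H" using D by (simp add: pointwise_stabilizer_def)
    have DCA: "(D * C) * A = D * ?B"
      using assoc_mult_mat[OF H_carrier[OF DH] H_carrier[OF C] Ac] .
    have DB: "(D * ?B) *\<^sub>v ?u i = D *\<^sub>v (?B *\<^sub>v ?u i)" for i
      by (rule assoc_mult_mat_vec[OF H_carrier[OF DH] Bc unit_vec_carrier])
    have "vcong N (2 * k) ((D * ?B) *\<^sub>v ?u i) (?u i) \<and> vcong N (2 * k) ((D * ?B) *\<^sub>v ?u (i + k)) (?u (i + k))"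
      if i: "i < Suc m" for i
    proof (cases "i = m")
      case True
      then show ?thesis using D by (simp only: DB)
    next
      case False
      then have "i < m" using i by simp
      then show ?thesis
        using fixed[of i] D(1)
          vcong_mult_compose[OF H_carrier[OF DH] Bc unit_vec_carrier unit_vec_carrier]
        unfolding pointwise_stabilizer_def by blast
    qed
    then show ?case unfolding DCA[symmetric] using H_mult[OF DH C] by blast
  qed
  then obtain C where C: "C \<in> H" and cols: "\<And>i. i < k \<Longrightarrow> vcong N (2 * k) ((C * A) *\<^sub>v ?u i) (?u i) \<and>
      vcong N (2 * k) ((C * A) *\<^sub>v ?u (i + k)) (?u (i + k))"
    by blast
  have CAc: "C * A \<in> carrier_mat (2 * k) (2 * k)" using C Ac by simp
  have "[(C * A) $$ (i, j) = 1\<^sub>m (2 * k) $$ (i, j)] (mod N)" if ij: "i < 2 * k" "j < 2 * k" for i j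
  proof -
    have "vcong N (2 * k) ((C * A) *\<^sub>v ?u j) (?u j)"
      using cols[of j] cols[of "j - k"] ij(2) by (cases "j < k") auto
    moreover have "((C * A) *\<^sub>v ?u j) $ i = (C * A) $$ (i, j)"
      by (rule mult_unit_vec_index[OF CAc ij])
    ultimately show ?thesis using ij by (auto simp: vcong_def)
  qed
  then have "reduce N (C * A) = reduce N (1\<^sub>m (2 * k))"
    using reduce_eq_iff[OF CAc one_carrier_mat] by blast
  then show ?thesis using C by blast
qed

end

lemma (in residues) normal_eq_carrier_of_left_inverses:
  assumes G: "group (mod_group m k S)" and S: "S \<subseteq> carrier_mat k k" and K: "normal K (mod_group m k S)"
    and inv: "\<And>A. A \<in> S \<Longrightarrow> \<exists>C\<in>S. reduce m C \<in> K \<and> reduce m (C * A) = reduce m (1\<^sub>m k)"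
  shows "K = carrier (mod_group m k S)"
proof -
  let ?G = "mod_group m k S"
  interpret group ?G by fact
  note sub = normal_imp_subgroup[OF K] and simps = mod_group_simps[OF S]
  have "carrier ?G \<subseteq> K"
  proof
    fix x assume x: "x \<in> carrier ?G"
    then obtain A where A: "A \<in> S" "x = reduce m A" by (auto simp: simps(3))
    obtain C where C: "C \<in> S" "reduce m C \<in> K" "reduce m (C * A) = reduce m (1\<^sub>m k)" using inv[OF A(1)] by blast
    have c: "reduce m C \<in> carrier ?G" using C(1) by (simp add: simps(3))
    have "reduce m C \<otimes>\<^bsub>?G\<^esub> x = \<one>\<^bsub>?G\<^esub>" using C A by (simp add: simps(1,2))
    then have "x = inv\<^bsub>?G\<^esub> reduce m C" using x c inv_equality inv_inv by metis
    then show "x \<in> K" using subgroup.m_inv_closed[OF sub C(2)] by simp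
  qed
  then show ?thesis using subgroup.subset[OF sub] by blast
qed

context prime_power_modulus
begin

lemma transvection_monoid_Sp_lift: "transvection_monoid p n k (Sp_lift N k)"
proof
  show "1\<^sub>m (2 * k) \<in> Sp_lift N k"
    using left_mult_one_mat[OF symp_form_carrier] right_mult_one_mat[OF symp_form_carrier] by (simp add: Sp_lift_def)
qed (auto simp: Sp_lift_iff_form_preserving[symmetric] Sp_lift_mult unimodular_def transvection_in_Sp_lift)

text \<open>
  By transitivity some symplectic \<open>g\<close> takes the first unit vector to \<open>v\<close>, and conjugation by \<open>g\<close> takes a
  transvection along a vector to one along its image.
\<close>
lemma transvection_conjugate:
  assumes k: "0 < k" and v: "unimodular k v"
  shows "\<exists>g\<in>Sp_lift N k. \<forall>s. reduce N (transvection k v s * g) = reduce N (g * transvection k (unit_vec (2 * k) 0) s)"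
proof -
  interpret T: transvection_monoid p n k "Sp_lift N k" by (rule transvection_monoid_Sp_lift)
  let ?u = "\<lambda>i. unit_vec (2 * k) i :: int vec"
  have vc: "v \<in> carrier_vec (2 * k)" using v by (simp add: unimodular_def)
  have u: "unimodular k (?u 0)"
    unfolding unimodular_def using k prime_gt_1_nat[OF prime] by (auto intro!: exI[of _ 0])
  have "?u 0 \<in> fixed_complement k 0" "v \<in> fixed_complement k 0"
    using vc by (simp_all add: fixed_complement_def)
  from T.stabilizer_transitive_unimodular[OF this(1) u this(2) v le0]
  obtain g where g: "g \<in> T.pointwise_stabilizer 0" "vcong N (2 * k) (g *\<^sub>v ?u 0) v" ..
  then have g: "g \<in> Sp_lift N k" "vcong N (2 * k) (g *\<^sub>v ?u 0) v"
    by (simp_all add: T.pointwise_stabilizer_def)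
  have gf: "form_preserving N k g" using g(1) by (simp only: Sp_lift_iff_form_preserving)
  then have gc: "g \<in> carrier_mat (2 * k) (2 * k)" by (simp only: form_preserving_def)
  have "reduce N (transvection k v s * g) = reduce N (g * transvection k (?u 0) s)" for s
  proof -
    let ?T = "transvection k v s" and ?S = "transvection k (?u 0) s"
    have "[(?T * g) $$ (i, j) = (g * ?S) $$ (i, j)] (mod N)" if ij: "i < 2 * k" "j < 2 * k" for i j
    proof -
      have gj: "g *\<^sub>v ?u j \<in> carrier_vec (2 * k)" for j by (rule mult_mat_vec_carrier[OF gc unit_vec_carrier])
      have "(?T * g) $$ (i, j) = ((?T * g) *\<^sub>v ?u j) $ i"
        by (rule mult_unit_vec_index[OF mult_carrier_mat[OF transvection_carrier gc] ij, symmetric])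
      also have "\<dots> = (?T *\<^sub>v (g *\<^sub>v ?u j)) $ i"
        by (simp only: assoc_mult_mat_vec[OF transvection_carrier gc unit_vec_carrier])
      also have "\<dots> = (g *\<^sub>v ?u j) $ i + (s * sform k (g *\<^sub>v ?u j) v) * v $ i"
        unfolding transvection_mult_vec[OF gj vc] using gj[of j] vc ij by (simp del: index_mult_mat_vec)
      finally have L: "(?T * g) $$ (i, j) = (g *\<^sub>v ?u j) $ i + (s * sform k (g *\<^sub>v ?u j) v) * v $ i" .
      have "(g * ?S) $$ (i, j) = ((g * ?S) *\<^sub>v ?u j) $ i"
        by (rule mult_unit_vec_index[OF mult_carrier_mat[OF gc transvection_carrier] ij, symmetric])
      also have "\<dots> = (g *\<^sub>v (?S *\<^sub>v ?u j)) $ i"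
        by (simp only: assoc_mult_mat_vec[OF gc transvection_carrier unit_vec_carrier])
      also have "\<dots> = (\<Sum>l\<in>{0..<2 * k}. g $$ (i, l) * (?u j $ l + (s * sform k (?u j) (?u 0)) * ?u 0 $ l))"
        unfolding transvection_mult_vec[OF unit_vec_carrier unit_vec_carrier]
        using gc ij by (simp add: scalar_prod_def)
      also have "\<dots> = (\<Sum>l\<in>{0..<2 * k}. g $$ (i, l) * ?u j $ l) +
          (s * sform k (?u j) (?u 0)) * (\<Sum>l\<in>{0..<2 * k}. g $$ (i, l) * ?u 0 $ l)"
        by (simp only: sum_distrib_left sum.distrib[symmetric] algebra_simps)
      also have "\<dots> = (g *\<^sub>v ?u j) $ i + (s * sform k (?u j) (?u 0)) * (g *\<^sub>v ?u 0) $ i"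
        using gc ij by (simp add: scalar_prod_def)
      finally have R: "(g * ?S) $$ (i, j) = (g *\<^sub>v ?u j) $ i + (s * sform k (?u j) (?u 0)) * (g *\<^sub>v ?u 0) $ i" .
      have "[sform k (g *\<^sub>v ?u j) v = sform k (g *\<^sub>v ?u j) (g *\<^sub>v ?u 0)] (mod N)"
        by (intro sform_cong vcong_refl vcong_sym[OF g(2)])
      also have "[sform k (g *\<^sub>v ?u j) (g *\<^sub>v ?u 0) = sform k (?u j) (?u 0)] (mod N)"
        using gf unfolding form_preserving_def by (meson unit_vec_carrier)
      finally have "[sform k (g *\<^sub>v ?u j) v = sform k (?u j) (?u 0)] (mod N)" .
      moreover have "[v $ i = (g *\<^sub>v ?u 0) $ i] (mod N)"
        using vcong_sym[OF g(2)] ij unfolding vcong_def by blast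
      ultimately show ?thesis unfolding L R by (intro cong_add cong_refl cong_mult)
    qed
    then show ?thesis using gc by (subst reduce_eq_iff[of _ "2 * k" "2 * k"]) auto
  qed
  then show ?thesis using g(1) by blast
qed

text \<open>
  The transvections along unimodular vectors are conjugate to those in \<open>K\<close>, and they generate the group.
\<close>
lemma Sp_normal_closure_transvection:
  assumes k: "0 < k" and K: "normal K (Sp_mod k)"
    and T: "\<And>s. reduce N (transvection k (unit_vec (2 * k) 0) s) \<in> K"
  shows "K = carrier (Sp_mod k)"
proof -
  let ?G = "Sp_mod k"
  interpret K: normal K ?G by fact
  have gp: "group ?G" by (rule group_Sp_lift)
  note sub = normal_imp_subgroup[OF K]
  have S: "Sp_lift N k \<subseteq> carrier_mat (2 * k) (2 * k)" by (auto simp: Sp_lift_def)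
  note G = mod_group_simps[OF S]
  define H where "H = {C \<in> Sp_lift N k. reduce N C \<in> K}"
  have "transvection_monoid p n k H"
  proof
    show "1\<^sub>m (2 * k) \<in> H"
      using subgroup.one_closed[OF sub] G(2) transvection_monoid.H_one[OF transvection_monoid_Sp_lift] by (simp add: H_def)
    show "C * D \<in> H" if "C \<in> H" "D \<in> H" for C D
      using that subgroup.m_closed[OF sub, of "reduce N C" "reduce N D"] G(1)[of C D] Sp_lift_mult by (simp add: H_def)
    show "transvection k v s \<in> H" if v: "unimodular k v" for v s
    proof -
      obtain g where g: "g \<in> Sp_lift N k" and
        conj: "reduce N (transvection k v s * g) = reduce N (g * transvection k (unit_vec (2 * k) 0) s)"
        using transvection_conjugate[OF k v] by blast
      have t: "transvection k v s \<in> Sp_lift N k" "transvection k (unit_vec (2 * k) 0) s \<in> Sp_lift N k"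
        using v by (auto simp: unimodular_def intro!: transvection_in_Sp_lift)
      have cl: "reduce N g \<in> carrier ?G" "reduce N (transvection k v s) \<in> carrier ?G"
        "reduce N (transvection k (unit_vec (2 * k) 0) s) \<in> carrier ?G"
        using g t by (auto simp: G(3))
      have "reduce N (transvection k v s) \<otimes>\<^bsub>?G\<^esub> reduce N g =
          reduce N g \<otimes>\<^bsub>?G\<^esub> reduce N (transvection k (unit_vec (2 * k) 0) s)"
        using conj g t by (simp add: G(1))
      then have "reduce N (transvection k v s) =
          reduce N g \<otimes>\<^bsub>?G\<^esub> reduce N (transvection k (unit_vec (2 * k) 0) s) \<otimes>\<^bsub>?G\<^esub> inv\<^bsub>?G\<^esub> reduce N g"
        using group.inv_solve_right[OF gp cl(2) monoid.m_closed[OF group.is_monoid[OF gp] cl(1,3)] cl(1)] by simp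
      also have "\<dots> \<in> K" using K.inv_op_closed2[OF cl(1) T] .
      finally show ?thesis using t by (simp add: H_def)
    qed
  qed (auto simp: H_def Sp_lift_iff_form_preserving)
  then interpret T: transvection_monoid p n k H .
  show ?thesis
  proof (rule normal_eq_carrier_of_left_inverses[OF gp S K])
    fix A assume "A \<in> Sp_lift N k"
    then have "form_preserving N k A" by (simp only: Sp_lift_iff_form_preserving)
    from T.ex_left_inverse_in_monoid[OF this]
    show "\<exists>C\<in>Sp_lift N k. reduce N C \<in> K \<and> reduce N (C * A) = reduce N (1\<^sub>m (2 * k))"
      unfolding H_def by blast
  qed
qed

end

section \<open>The special linear group as the normal closure of an elementary matrix\<close>

lemma addrow_mat_mult_index:
  fixes B :: "int mat"
  assumes "B \<in> carrier_mat k nc" "l < k" "r < k" "i < k" "j < nc"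
  shows "(addrow_mat k a r l * B) $$ (i, j) = (if i = r then a * B $$ (l, j) + B $$ (i, j) else B $$ (i, j))"
  using addrow_mat[OF assms(1,2), of a r] assms by (metis carrier_matD index_mat_addrow(1))

lemma addrow_mat_add:
  fixes a b :: int
  assumes "i < k" "j < k" "i \<noteq> j"
  shows "addrow_mat k a i j * addrow_mat k b i j = addrow_mat k (a + b) i j"
proof (rule eq_matI)
  fix r c assume "r < dim_row (addrow_mat k (a + b) i j)" "c < dim_col (addrow_mat k (a + b) i j)"
  then have rc: "r < k" "c < k" by (auto simp: addrow_mat_def)
  show "(addrow_mat k a i j * addrow_mat k b i j) $$ (r, c) = addrow_mat k (a + b) i j $$ (r, c)"
    unfolding addrow_mat_mult_index[OF addrow_mat_carrier assms(2,1) rc]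
    using assms rc by (auto simp: addrow_mat_def)
qed (auto simp: addrow_mat_def)

text \<open>
  The matrices \<open>addrow_mat k s i j\<close> are the elementary matrices $I+sE_{ij}$. This and the next lemma are the
  commutator relations $[I+E_{li},I+sE_{ij}]=I+sE_{lj}$ and $[I-sE_{ij},I-E_{jl}]=I+sE_{il}$.
\<close>
lemma addrow_mat_commutator_left:
  fixes s :: int
  assumes "i < k" "j < k" "l < k" "i \<noteq> j" "j \<noteq> l" "i \<noteq> l"
  shows "addrow_mat k 1 l i * addrow_mat k s i j = addrow_mat k s l j * (addrow_mat k s i j * addrow_mat k 1 l i)"
    (is "?L = ?R")
proof (rule eq_matI)
  fix r c assume "r < dim_row ?R" "c < dim_col ?R"
  then have rc: "r < k" "c < k" by (auto simp: addrow_mat_def)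
  have "addrow_mat k s i j * addrow_mat k 1 l i \<in> carrier_mat k k" by simp
  then show "?L $$ (r, c) = ?R $$ (r, c)"
    using assms rc
    by (simp add: addrow_mat_mult_index[of _ k k] del: index_mult_mat)
qed (auto simp: addrow_mat_def)

lemma addrow_mat_commutator_right:
  fixes s :: int
  assumes "i < k" "j < k" "l < k" "i \<noteq> j" "j \<noteq> l" "i \<noteq> l"
  shows "addrow_mat k s i j * addrow_mat k 1 j l = addrow_mat k 1 j l * (addrow_mat k s i j * addrow_mat k s i l)"
    (is "?L = ?R")
proof (rule eq_matI)
  fix r c assume "r < dim_row ?R" "c < dim_col ?R"
  then have rc: "r < k" "c < k" by (auto simp: addrow_mat_def)
  have "addrow_mat k s i j * addrow_mat k s i l \<in> carrier_mat k k" by simp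
  then show "?L $$ (r, c) = ?R $$ (r, c)"
    using assms rc
    by (simp add: addrow_mat_mult_index[of _ k k] del: index_mult_mat)
qed (auto simp: addrow_mat_def)

text \<open>
  This is used for the matrices whose residues lie in a given normal subgroup.
\<close>
locale elementary_monoid = prime_power_modulus +
  fixes k :: nat and H :: "int mat set"
  assumes H_SL: "H \<subseteq> SL_lift N k"
    and H_mult: "\<And>C D. C \<in> H \<Longrightarrow> D \<in> H \<Longrightarrow> C * D \<in> H"
    and H_one: "1\<^sub>m k \<in> H"
    and H_elementary: "\<And>a i j. i < k \<Longrightarrow> j < k \<Longrightarrow> i \<noteq> j \<Longrightarrow> addrow_mat k a i j \<in> H"
begin

definition cleared_columns :: "nat \<Rightarrow> int mat set" where
  "cleared_columns m = {B \<in> carrier_mat k k. \<forall>j<m. \<forall>i<k. [B $$ (i, j) = (if i = j then 1 else 0)] (mod N)}"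

lemma H_carrier: "C \<in> H \<Longrightarrow> C \<in> carrier_mat k k"
  using H_SL by (auto simp: SL_lift_def)

text \<open>Row \<open>l\<close> is zero modulo \<open>N\<close> in the columns before \<open>m\<close>.\<close>
lemma cleared_columns_addrow:
  assumes B: "B \<in> cleared_columns m" and l: "m \<le> l" "l < k" "r < k"
  shows "addrow_mat k a r l * B \<in> cleared_columns m"
proof -
  have Bc: "B \<in> carrier_mat k k" using B by (simp add: cleared_columns_def)
  have "[(addrow_mat k a r l * B) $$ (i, j) = (if i = j then 1 else 0)] (mod N)" if ij: "j < m" "i < k" for i j
  proof -
    have jk: "j < k" using ij l by simp
    have e: "[B $$ (i, j) = (if i = j then 1 else 0)] (mod N)" "[B $$ (l, j) = (if l = j then 1 else 0)] (mod N)"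
      using B ij l unfolding cleared_columns_def by blast+
    have lj: "l \<noteq> j" using ij l by simp
    have "[a * B $$ (l, j) + B $$ (i, j) = a * 0 + (if i = j then 1 else 0)] (mod N)"
      using e lj by (intro cong_add cong_scalar_left) simp_all
    then show ?thesis
      unfolding addrow_mat_mult_index[OF Bc l(2,3) ij(2) jk] using e(1) by (cases "i = r"; cases "i = j") auto
  qed
  moreover have "addrow_mat k a r l * B \<in> carrier_mat k k" using Bc by simp
  ultimately show ?thesis by (simp add: cleared_columns_def)
qed

text \<open>
  Row \<open>m\<close> of an inverse of \<open>B\<close> has entries divisible by \<open>p\<close> in the columns before \<open>m\<close>. If \<open>p\<close> divided the
  entries of column \<open>m\<close> of \<open>B\<close> in the rows from \<open>m\<close> on, it would divide the product of this row and this
  column, which is congruent to \<open>1\<close>.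
\<close>
lemma ex_unit_below:
  assumes B: "B \<in> cleared_columns m" and det: "[det B = 1] (mod N)" and m: "m < k"
  shows "\<exists>i. m \<le> i \<and> i < k \<and> \<not> int p dvd B $$ (i, m)"
proof (rule ccontr)
  assume contra: "\<not> ?thesis"
  have Bc: "B \<in> carrier_mat k k" using B by (simp add: cleared_columns_def)
  have "coprime (det B) N" using det by (metis cong_imp_coprime cong_sym coprime_1_left)
  then obtain X where X: "X \<in> carrier_mat k k" "reduce N (X * B) = reduce N (1\<^sub>m k)"
    using ex_inverse_mod[OF Bc] by blast
  have XB: "[(\<Sum>i\<in>{0..<k}. X $$ (m, i) * B $$ (i, j)) = (if m = j then 1 else 0)] (mod N)" if "j < k" for j
  proof -
    have "[(X * B) $$ (m, j) = 1\<^sub>m k $$ (m, j)] (mod N)"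
      using X(2) m that reduce_eq_iff[OF mult_carrier_mat[OF X(1) Bc] one_carrier_mat, of N] by blast
    then show ?thesis using X(1) Bc m that by (simp add: scalar_prod_def)
  qed
  have X0: "int p dvd X $$ (m, j)" if j: "j < m" for j
  proof -
    have jk: "j < k" using j m by simp
    have "[(\<Sum>i\<in>{0..<k}. X $$ (m, i) * B $$ (i, j)) = (\<Sum>i\<in>{0..<k}. X $$ (m, i) * (if i = j then 1 else 0))] (mod N)"
      using B j by (intro cong_sum cong_scalar_left) (auto simp: cleared_columns_def)
    also have "(\<Sum>i\<in>{0..<k}. X $$ (m, i) * (if i = j then 1 else 0)) = X $$ (m, j)"
      using jk by (simp add: if_distrib[of "\<lambda>x. _ * x"] cong: if_cong)
    finally have "[X $$ (m, j) = (if m = j then 1 else 0)] (mod N)"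
      using XB[OF jk] by (rule cong_trans[OF cong_sym])
    then have "int p dvd X $$ (m, j) \<longleftrightarrow> int p dvd (if m = j then 1 else 0)" by (rule cong_mod_p)
    then show ?thesis using j by simp
  qed
  have "int p dvd (\<Sum>i\<in>{0..<k}. X $$ (m, i) * B $$ (i, m))"
  proof (rule dvd_sum)
    fix i assume "i \<in> {0..<k}"
    then show "int p dvd X $$ (m, i) * B $$ (i, m)"
      using X0[of i] contra by (cases "i < m") auto
  qed
  moreover have "[(\<Sum>i\<in>{0..<k}. X $$ (m, i) * B $$ (i, m)) = 1] (mod N)" using XB[OF m] by simp
  ultimately show False using not_dvd_of_cong_1 by blast
qed

text \<open>
  There is no row below the last pivot; it is determined by the determinant, because the matrix is upper
  triangular modulo \<open>N\<close>.
\<close>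
lemma det_last_pivot:
  assumes B: "B \<in> cleared_columns (k - 1)" and det: "[det B = 1] (mod N)" and k: "0 < k"
  shows "[B $$ (k - 1, k - 1) = 1] (mod N)"
proof -
  have Bc: "B \<in> carrier_mat k k" using B by (simp add: cleared_columns_def)
  \<comment> \<open>Congruent to \<open>B\<close>, but with the columns before the last one equal to unit vectors.\<close>
  define T where "T = mat k k (\<lambda>(i, j). if j < k - 1 then (if i = j then 1 else 0) else B $$ (i, j))"
  have Tc: "T \<in> carrier_mat k k" by (simp add: T_def)
  have "reduce N B = reduce N T"
    unfolding reduce_eq_iff[OF Bc Tc] using B by (auto simp: cleared_columns_def T_def)
  then have "[det B = det T] (mod N)" by (rule det_cong[OF Bc Tc])
  moreover have "det T = prod_list (diag_mat T)"
    by (rule det_upper_triangular[OF _ Tc]) (auto simp: upper_triangular_def T_def)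
  moreover have "prod_list (diag_mat T) = (\<Prod>i = 0..<k. T $$ (i, i))"
    using Tc by (simp add: prod_list_diag_prod)
  moreover have "\<dots> = (\<Prod>i = 0..<k. if i = k - 1 then B $$ (k - 1, k - 1) else 1)"
    by (intro prod.cong) (auto simp: T_def)
  moreover have "\<dots> = B $$ (k - 1, k - 1)" using k by simp
  ultimately have "[det B = B $$ (k - 1, k - 1)] (mod N)" by simp
  then show ?thesis using det by (rule cong_trans[OF cong_sym])
qed

lemma det_H_mult:
  assumes "C \<in> H" "B \<in> carrier_mat k k" "[det B = 1] (mod N)"
  shows "[det (C * B) = 1] (mod N)"
proof -
  have "[det C * det B = 1 * 1] (mod N)" using assms H_SL by (intro cong_mult) (auto simp: SL_lift_def)
  then show ?thesis using det_mult[OF H_carrier[OF assms(1)] assms(2)] by simp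
qed

text \<open>
  Before the last column, a multiple of a row with a unit in column \<open>m\<close>, below row \<open>m\<close>, makes the pivot \<open>1\<close>. If the only
  unit is the pivot itself, row \<open>m\<close> is first added to the next row.
\<close>
lemma ex_pivot_one:
  assumes B: "B \<in> cleared_columns m" and det: "[det B = 1] (mod N)" and m: "m < k"
  shows "\<exists>C\<in>H. C * B \<in> cleared_columns m \<and> [(C * B) $$ (m, m) = 1] (mod N)"
proof (cases "m = k - 1")
  case True
  have "1\<^sub>m k * B = B" using B by (intro left_mult_one_mat[of B k k]) (simp add: cleared_columns_def)
  then show ?thesis using det_last_pivot[of B] B det m True H_one by (intro bexI[of _ "1\<^sub>m k"]) auto
next
  case False
  have from_below: "\<exists>C\<in>H. C * B \<in> cleared_columns m \<and> [(C * B) $$ (m, m) = 1] (mod N)"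
    if B: "B \<in> cleared_columns m" and i: "m < i" "i < k" "\<not> int p dvd B $$ (i, m)" for B i
  proof -
    have Bc: "B \<in> carrier_mat k k" using B by (simp add: cleared_columns_def)
    obtain b where b: "[B $$ (i, m) * b = 1] (mod N)" using ex_inverse_of_unit[OF i(3)] by blast
    let ?a = "(1 - B $$ (m, m)) * b"
    have "(addrow_mat k ?a m i * B) $$ (m, m) = (1 - B $$ (m, m)) * (B $$ (i, m) * b) + B $$ (m, m)"
      unfolding addrow_mat_mult_index[OF Bc i(2) m m m] by (simp add: mult_ac)
    moreover have "[(1 - B $$ (m, m)) * (B $$ (i, m) * b) + B $$ (m, m) = (1 - B $$ (m, m)) * 1 + B $$ (m, m)] (mod N)"
      by (intro cong_add cong_scalar_left b cong_refl)
    ultimately have "[(addrow_mat k ?a m i * B) $$ (m, m) = 1] (mod N)" by simp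
    moreover have "addrow_mat k ?a m i * B \<in> cleared_columns m"
      using i m by (intro cleared_columns_addrow[OF B]) auto
    moreover have "addrow_mat k ?a m i \<in> H" using i m by (intro H_elementary) auto
    ultimately show ?thesis by blast
  qed
  have Bc: "B \<in> carrier_mat k k" using B by (simp add: cleared_columns_def)
  obtain i where i: "m \<le> i" "i < k" "\<not> int p dvd B $$ (i, m)" using ex_unit_below[OF B det m] by blast
  show ?thesis
  proof (cases "\<exists>i. m < i \<and> i < k \<and> \<not> int p dvd B $$ (i, m)")
    case True
    then show ?thesis using from_below[OF B] by blast
  next
    case nou: False
    have im: "i = m" using nou i by (metis le_neq_implies_less)
    have m1: "Suc m < k" using False m by simp
    let ?E = "addrow_mat k 1 (Suc m) m"
    have E: "?E \<in> H" using m m1 by (intro H_elementary) auto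
    have EB: "?E * B \<in> cleared_columns m" using m m1 by (intro cleared_columns_addrow[OF B]) auto
    have "int p dvd B $$ (Suc m, m)" using nou m1 by auto
    then have "\<not> int p dvd (?E * B) $$ (Suc m, m)"
      unfolding addrow_mat_mult_index[OF Bc m m1 m1 m] using i(3) im by (simp add: dvd_add_left_iff)
    then obtain C where C: "C \<in> H" "C * (?E * B) \<in> cleared_columns m" "[(C * (?E * B)) $$ (m, m) = 1] (mod N)"
      using from_below[OF EB _ m1] by blast
    have "C * (?E * B) = (C * ?E) * B"
      using assoc_mult_mat[OF H_carrier[OF C(1)] H_carrier[OF E] Bc] by simp
    then show ?thesis using C H_mult[OF C(1) E] by (intro bexI[of _ "C * ?E"]) auto
  qed
qed

lemma ex_clear_column:
  assumes B: "B \<in> cleared_columns m" and piv: "[B $$ (m, m) = 1] (mod N)" and m: "m < k"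
  shows "\<exists>C\<in>H. C * B \<in> cleared_columns (Suc m)"
proof -
  have Bc: "B \<in> carrier_mat k k" using B by (simp add: cleared_columns_def)
  have "\<exists>C\<in>H. C * B \<in> cleared_columns m \<and> [(C * B) $$ (m, m) = 1] (mod N) \<and>
    (\<forall>i<r. i \<noteq> m \<longrightarrow> [(C * B) $$ (i, m) = 0] (mod N))" if "r \<le> k" for r
    using that
  proof (induction r)
    case 0
    then show ?case using B piv H_one Bc by (intro bexI[of _ "1\<^sub>m k"]) auto
  next
    case (Suc r)
    then have r: "r < k" by simp
    obtain C where C: "C \<in> H" "C * B \<in> cleared_columns m" "[(C * B) $$ (m, m) = 1] (mod N)"
      "\<And>i. i < r \<Longrightarrow> i \<noteq> m \<Longrightarrow> [(C * B) $$ (i, m) = 0] (mod N)"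
      using Suc by auto
    show ?case
    proof (cases "r = m")
      case True
      then show ?thesis using C less_Suc_eq by (intro bexI[of _ C]) auto
    next
      case False
      let ?E = "addrow_mat k (- (C * B) $$ (r, m)) r m"
      have E: "?E \<in> H" using r m False by (intro H_elementary) auto
      have CB: "C * B \<in> carrier_mat k k" using H_carrier[OF C(1)] Bc by simp
      note idx = addrow_mat_mult_index[OF CB m r]
      have assoc: "(?E * C) * B = ?E * (C * B)"
        by (rule assoc_mult_mat[OF H_carrier[OF E] H_carrier[OF C(1)] Bc])
      have "?E * (C * B) \<in> cleared_columns m"
        using m r by (intro cleared_columns_addrow[OF C(2)]) auto
      moreover have "[(?E * (C * B)) $$ (m, m) = 1] (mod N)"
        unfolding idx[OF m m] using C(3) False by simp
      moreover have "[(?E * (C * B)) $$ (i, m) = 0] (mod N)" if i: "i < Suc r" "i \<noteq> m" for i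
      proof (cases "i = r")
        case True
        have "[- (C * B) $$ (r, m) * (C * B) $$ (m, m) + (C * B) $$ (r, m) = - (C * B) $$ (r, m) * 1 + (C * B) $$ (r, m)] (mod N)"
          by (intro cong_add cong_scalar_left C(3) cong_refl)
        then show ?thesis unfolding idx[OF r m] True by simp
      next
        case False
        then have "i < r" "i < k" using i r by auto
        then show ?thesis unfolding idx[OF \<open>i < k\<close> m] using C(4)[OF \<open>i < r\<close> i(2)] False by simp
      qed
      ultimately show ?thesis using H_mult[OF E C(1)] unfolding assoc[symmetric] by blast
    qed
  qed
  then obtain C where C: "C \<in> H" "C * B \<in> cleared_columns m" "[(C * B) $$ (m, m) = 1] (mod N)"
      "\<And>i. i < k \<Longrightarrow> i \<noteq> m \<Longrightarrow> [(C * B) $$ (i, m) = 0] (mod N)"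
    by blast
  have "C * B \<in> cleared_columns (Suc m)"
    using C by (auto simp: cleared_columns_def less_Suc_eq)
  then show ?thesis using C(1) by blast
qed

lemma ex_left_inverse_in_monoid:
  assumes A: "A \<in> SL_lift N k"
  shows "\<exists>C\<in>H. reduce N (C * A) = reduce N (1\<^sub>m k)"
proof -
  have Ac: "A \<in> carrier_mat k k" and det: "[det A = 1] (mod N)" using A by (auto simp: SL_lift_def)
  have "\<exists>C\<in>H. C * A \<in> cleared_columns m" if "m \<le> k" for m
    using that
  proof (induction m)
    case 0
    then show ?case using H_one Ac by (intro bexI[of _ "1\<^sub>m k"]) (auto simp: cleared_columns_def)
  next
    case (Suc m)
    then obtain C where C: "C \<in> H" "C * A \<in> cleared_columns m" by auto
    have m: "m < k" using Suc.prems by simp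
    obtain D where D: "D \<in> H" "D * (C * A) \<in> cleared_columns m" "[(D * (C * A)) $$ (m, m) = 1] (mod N)"
      using ex_pivot_one[OF C(2) det_H_mult[OF C(1) Ac det] m] by blast
    obtain F where F: "F \<in> H" "F * (D * (C * A)) \<in> cleared_columns (Suc m)"
      using ex_clear_column[OF D(2,3) m] by blast
    have "F * (D * (C * A)) = (F * (D * C)) * A"
      using H_carrier C(1) D(1) F(1) Ac by (simp add: assoc_mult_mat[of _ k k _ k _ k])
    then show ?case using F H_mult[OF F(1) H_mult[OF D(1) C(1)]] by auto
  qed
  then obtain C where C: "C \<in> H" "C * A \<in> cleared_columns k" by blast
  have CA: "C * A \<in> carrier_mat k k" using C by (simp add: cleared_columns_def)
  have "reduce N (C * A) = reduce N (1\<^sub>m k)"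
    unfolding reduce_eq_iff[OF CA one_carrier_mat] using C(2) by (auto simp: cleared_columns_def)
  then show ?thesis using C(1) by blast
qed

end

lemma (in normal) mem_of_commutator:
  assumes "g \<in> carrier G" "x \<in> carrier G" "h \<in> H" and "g \<otimes> h = x \<otimes> (h \<otimes> g)"
  shows "x \<in> H"
proof -
  have h: "h \<in> carrier G" using assms(3) by (rule mem_carrier)
  have "g \<otimes> h \<otimes> inv g = x \<otimes> h" using assms h by (simp add: m_assoc)
  then have "x = (g \<otimes> h \<otimes> inv g) \<otimes> inv h" using assms h by (simp add: m_assoc)
  then show ?thesis
    using inv_op_closed2[OF assms(1,3)] assms(3) subgroup_axioms
    by (simp add: subgroup.m_closed subgroup.m_inv_closed)
qed

lemma (in normal) mem_of_commutator':
  assumes "g \<in> carrier G" "x \<in> carrier G" "h \<in> H" and "h \<otimes> g = g \<otimes> (h \<otimes> x)"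
  shows "x \<in> H"
proof -
  have h: "h \<in> carrier G" using assms(3) by (rule mem_carrier)
  have "inv g \<otimes> h \<otimes> g = inv g \<otimes> (h \<otimes> g)" using assms h by (simp add: m_assoc)
  also have "\<dots> = h \<otimes> x" unfolding assms(4) using assms(1,2) h by (simp add: m_assoc[symmetric])
  finally have "x = inv h \<otimes> (inv g \<otimes> h \<otimes> g)" using assms h by (simp add: m_assoc[symmetric])
  then show ?thesis
    using inv_op_closed1[OF assms(1,3)] assms(3) subgroup_axioms
    by (simp add: subgroup.m_closed subgroup.m_inv_closed)
qed

context prime_power_modulus
begin

lemma addrow_mat_in_SL_lift:
  "i \<noteq> j \<Longrightarrow> addrow_mat k s i j \<in> SL_lift N k"
  by (simp add: SL_lift_def det_addrow_mat)

text \<open>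
  Commutators with elementary matrices move the position \<open>(0, k - 1)\<close> to every other one. Each step changes one of the
  two indices, by means of a third one.
\<close>
lemma SL_normal_closure_elementary:
  assumes k: "3 \<le> k" and K: "normal K (SL_mod k)"
    and U: "reduce N (addrow_mat k 1 0 (k - 1)) \<in> K"
  shows "K = carrier (SL_mod k)"
proof -
  let ?G = "SL_mod k"
  let ?E = "\<lambda>i j s. reduce N (addrow_mat k s i j)"
  interpret K: normal K ?G by fact
  have gp: "group ?G" by (rule group_SL_lift)
  note sub = normal_imp_subgroup[OF K]
  have S: "SL_lift N k \<subseteq> carrier_mat k k" by (auto simp: SL_lift_def)
  note G = mod_group_simps[OF S]
  have Ec: "?E i j s \<in> carrier ?G" if "i \<noteq> j" for i j s
    using addrow_mat_in_SL_lift[OF that] by (simp add: G(3))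
  have corner: "?E 0 (k - 1) s \<in> K" for s
  proof -
    have nat: "?E 0 (k - 1) (int t) \<in> K" for t
    proof (induction t)
      case 0
      have "addrow_mat k 0 0 (k - 1) = (1\<^sub>m k :: int mat)" by (intro eq_matI) (auto simp: addrow_mat_def)
      then show ?case using subgroup.one_closed[OF sub] by (simp add: G(2))
    next
      case (Suc t)
      have "?E 0 (k - 1) (int (Suc t)) = ?E 0 (k - 1) 1 \<otimes>\<^bsub>?G\<^esub> ?E 0 (k - 1) (int t)"
        using k addrow_mat_add[of 0 k "k - 1" 1 "int t"] addrow_mat_in_SL_lift[of 0 "k - 1" k]
        by (simp add: G(1))
      then show ?case using subgroup.m_closed[OF sub U Suc] by simp
    qed
    have "0 \<le> s mod N" using modulus_gt_1 by (intro pos_mod_sign) linarith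
    then have "int (nat (s mod N)) = s mod N" by (rule nat_0_le)
    moreover have "?E 0 (k - 1) s = ?E 0 (k - 1) (s mod N)"
      by (intro eq_matI) (use k in \<open>auto simp: addrow_mat_def\<close>)
    ultimately show ?thesis using nat[of "nat (s mod N)"] by simp
  qed
  have left: "?E l j s \<in> K" if "?E i j s \<in> K" "i < k" "j < k" "l < k" "i \<noteq> j" "j \<noteq> l" "i \<noteq> l" for i j l s
  proof (rule K.mem_of_commutator[OF _ _ that(1)])
    have SLs: "addrow_mat k 1 l i \<in> SL_lift N k" "addrow_mat k s i j \<in> SL_lift N k" "addrow_mat k s l j \<in> SL_lift N k"
      using that by (simp_all add: addrow_mat_in_SL_lift)
    then show "?E l i 1 \<otimes>\<^bsub>?G\<^esub> ?E i j s = ?E l j s \<otimes>\<^bsub>?G\<^esub> (?E i j s \<otimes>\<^bsub>?G\<^esub> ?E l i 1)"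
      using addrow_mat_commutator_left[OF that(2-7)] SL_lift_mult by (simp add: G(1))
  qed (use that Ec in auto)
  have right: "?E i l s \<in> K" if "?E i j s \<in> K" "i < k" "j < k" "l < k" "i \<noteq> j" "j \<noteq> l" "i \<noteq> l" for i j l s
  proof (rule K.mem_of_commutator'[OF _ _ that(1)])
    have SLs: "addrow_mat k 1 j l \<in> SL_lift N k" "addrow_mat k s i j \<in> SL_lift N k" "addrow_mat k s i l \<in> SL_lift N k"
      using that by (simp_all add: addrow_mat_in_SL_lift)
    then show "?E i j s \<otimes>\<^bsub>?G\<^esub> ?E j l 1 = ?E j l 1 \<otimes>\<^bsub>?G\<^esub> (?E i j s \<otimes>\<^bsub>?G\<^esub> ?E i l s)"
      using addrow_mat_commutator_right[OF that(2-7)] SL_lift_mult by (simp add: G(1))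
  qed (use that Ec in auto)
  have last_column: "?E i (k - 1) s \<in> K" if "i < k - 1" for i s
  proof (cases "i = 0")
    case True
    then show ?thesis using corner[of s] by simp
  next
    case False
    show ?thesis by (rule left[OF corner]) (use that k False in auto)
  qed
  have upper_rows: "?E i j s \<in> K" if "i < k - 1" "j < k" "i \<noteq> j" for i j s
  proof (cases "j = k - 1")
    case True
    then show ?thesis using last_column[OF that(1), of s] by simp
  next
    case False
    show ?thesis by (rule right[OF last_column[OF that(1)]]) (use that k False in auto)
  qed
  have all: "?E i j s \<in> K" if ij: "i < k" "j < k" "i \<noteq> j" for i j s
  proof (cases "i = k - 1")
    case True
    \<comment> \<open>A row other than the last one and row \<open>j\<close>, from which the entry is moved down.\<close>
  define l where "l = (if j = 0 then 1 else 0 :: nat)"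
    have "l < k - 1" "l \<noteq> j" using k by (auto simp: l_def)
    then show ?thesis using left[OF upper_rows[of l j]] ij True by auto
  qed (use upper_rows ij in auto)
  define H where "H = {C \<in> SL_lift N k. reduce N C \<in> K}"
  have "elementary_monoid p n k H"
  proof
    show "1\<^sub>m k \<in> H" using subgroup.one_closed[OF sub] G(2) by (simp add: H_def SL_lift_def)
    show "C * D \<in> H" if "C \<in> H" "D \<in> H" for C D
      using that subgroup.m_closed[OF sub, of "reduce N C" "reduce N D"] G(1)[of C D] SL_lift_mult by (simp add: H_def)
  qed (auto simp: H_def all addrow_mat_in_SL_lift)
  then interpret T: elementary_monoid p n k H .
  show ?thesis
  proof (rule normal_eq_carrier_of_left_inverses[OF gp S K])
    fix A assume "A \<in> SL_lift N k"
    from T.ex_left_inverse_in_monoid[OF this]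
    show "\<exists>C\<in>SL_lift N k. reduce N C \<in> K \<and> reduce N (C * A) = reduce N (1\<^sub>m k)"
      unfolding H_def by blast
  qed
qed

end

section \<open>Block unipotent subgroups\<close>

definition block_unipotent :: "nat \<Rightarrow> nat \<Rightarrow> int mat \<Rightarrow> int mat" where
  "block_unipotent a b S = four_block_mat (1\<^sub>m a) S (0\<^sub>m b a) (1\<^sub>m b)"

definition block_diagonal :: "nat \<Rightarrow> nat \<Rightarrow> int mat \<Rightarrow> int mat \<Rightarrow> int mat" where
  "block_diagonal a b P Q = four_block_mat P (0\<^sub>m a b) (0\<^sub>m b a) Q"

lemma block_unipotent_carrier [simp]:
  "block_unipotent a b S \<in> carrier_mat (a + b) (a + b)"
  by (simp add: block_unipotent_def)

lemma block_diagonal_carrier [simp]: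
  "P \<in> carrier_mat a a \<Longrightarrow> Q \<in> carrier_mat b b \<Longrightarrow> block_diagonal a b P Q \<in> carrier_mat (a + b) (a + b)"
  by (simp add: block_diagonal_def)

lemma block_unipotent_mult:
  assumes "S \<in> carrier_mat a b" "T \<in> carrier_mat a b"
  shows "block_unipotent a b S * block_unipotent a b T = block_unipotent a b (T + S)"
  unfolding block_unipotent_def
  by (subst mult_four_block_mat[of _ a a _ b _ b _ _ a _ b]) (use assms in simp_all)

lemma block_unipotent_mult_block_diagonal:
  assumes "S \<in> carrier_mat a b" "P \<in> carrier_mat a a" "Q \<in> carrier_mat b b"
  shows "block_unipotent a b S * block_diagonal a b P Q = four_block_mat P (S * Q) (0\<^sub>m b a) Q"
  unfolding block_unipotent_def block_diagonal_def
  by (subst mult_four_block_mat[of _ a a _ b _ b _ _ a _ b]) (use assms in simp_all)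

lemma block_diagonal_mult_block_unipotent:
  assumes "S \<in> carrier_mat a b" "P \<in> carrier_mat a a" "Q \<in> carrier_mat b b"
  shows "block_diagonal a b P Q * block_unipotent a b S = four_block_mat P (P * S) (0\<^sub>m b a) Q"
  unfolding block_unipotent_def block_diagonal_def
  by (subst mult_four_block_mat[of _ a a _ b _ b _ _ a _ b]) (use assms in simp_all)

lemma reduce_four_block_cong:
  assumes "A \<in> carrier_mat a a" "S \<in> carrier_mat a b" "T \<in> carrier_mat a b" "C \<in> carrier_mat b a" "D \<in> carrier_mat b b"
    and "reduce N S = reduce N T"
  shows "reduce N (four_block_mat A S C D) = reduce N (four_block_mat A T C D)"
proof -
  have e: "[S $$ (i, j) = T $$ (i, j)] (mod N)" if "i < a" "j < b" for i j
    using assms(6) that unfolding reduce_eq_iff[OF assms(2,3)] by blast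
  show ?thesis
    by (subst reduce_eq_iff[of _ "a + b" "a + b"]) (use assms(1-5) e in auto)
qed

lemma reduce_block_unipotent_cong:
  assumes "S \<in> carrier_mat a b" "T \<in> carrier_mat a b" "reduce N S = reduce N T"
  shows "reduce N (block_unipotent a b S) = reduce N (block_unipotent a b T)"
  unfolding block_unipotent_def
  by (rule reduce_four_block_cong[OF one_carrier_mat assms(1,2) zero_carrier_mat one_carrier_mat assms(3)])

context prime_power_modulus
begin

lemma mod_group_mult:
  assumes "A \<in> carrier_mat k k" "B \<in> carrier_mat k k"
  shows "reduce N A \<otimes>\<^bsub>mod_group N k L\<^esub> reduce N B = reduce N (A * B)"
  using mult_mat_over[OF assms] by (simp add: mod_group_def)

lemma mod_group_one: "\<one>\<^bsub>mod_group N k L\<^esub> = reduce N (1\<^sub>m k)"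
  using one_mat_over by (simp add: mod_group_def)

lemma block_unipotent_pow:
  assumes S: "S \<in> carrier_mat a b"
  shows "reduce N (block_unipotent a b S) [^]\<^bsub>mod_group N (a + b) L\<^esub> (t :: nat) =
    reduce N (block_unipotent a b (int t \<cdot>\<^sub>m S))"
proof (induction t)
  case 0
  have "block_unipotent a b (int 0 \<cdot>\<^sub>m S) = 1\<^sub>m (a + b)"
    using S by (intro eq_matI) (auto simp: block_unipotent_def)
  then show ?case by (simp add: mod_group_one nat_pow_def)
next
  case (Suc t)
  have "S + int t \<cdot>\<^sub>m S = int (Suc t) \<cdot>\<^sub>m S"
    using S by (intro eq_matI) (auto simp: algebra_simps)
  then show ?case
    using Suc S by (simp add: nat_pow_def mod_group_mult block_unipotent_mult)
qed

text \<open>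
  A block diagonal matrix with blocks \<open>P\<close> and \<open>Q\<close> conjugates the block unipotent matrix of \<open>T\<close> to that of \<open>T'\<close> if
  \<open>T * Q\<close> and \<open>P * T'\<close> are congruent. This turns the relations of \<open>degree_ge_character_orbit\<close> into congruences
  between products of blocks. The blocks \<open>P x\<close> and \<open>Q x\<close> scale, the blocks \<open>P' t\<close> and \<open>Q' t\<close> add multiples of
  \<open>S 0\<close> to the other \<open>S l\<close>.
\<close>
lemma degree_ge_block_unipotent:
  fixes S :: "nat \<Rightarrow> int mat" and P Q :: "nat \<Rightarrow> int mat" and P' Q' :: "(nat \<Rightarrow> nat) \<Rightarrow> int mat"
  assumes k: "k = a + b" and L: "group (mod_group N k L)" and \<rho>: "representation (mod_group N k L) d \<rho>" and m: "0 < m"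
    and S: "\<And>l. l < m \<Longrightarrow> S l \<in> carrier_mat a b"
    and SL: "\<And>l. l < m \<Longrightarrow> block_unipotent a b (S l) \<in> L"
    and nontriv: "\<rho> (reduce N (block_unipotent a b (int (p ^ i) \<cdot>\<^sub>m S 0))) \<noteq> 1\<^sub>m d"
    and PQ: "\<And>x. coprime x p \<Longrightarrow> P x \<in> carrier_mat a a" "\<And>x. coprime x p \<Longrightarrow> Q x \<in> carrier_mat b b"
    and PQL: "\<And>x. coprime x p \<Longrightarrow> block_diagonal a b (P x) (Q x) \<in> L"
    and D0: "\<And>x. coprime x p \<Longrightarrow> reduce N (S 0 * Q x) = reduce N (P x * (int (x ^ r) \<cdot>\<^sub>m S 0))"
    and D: "\<And>x l. coprime x p \<Longrightarrow> 0 < l \<Longrightarrow> l < m \<Longrightarrow> reduce N (S l * Q x) = reduce N (P x * (int (c x l) \<cdot>\<^sub>m S l))"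
    and PQ': "\<And>t. P' t \<in> carrier_mat a a" "\<And>t. Q' t \<in> carrier_mat b b"
    and PQL': "\<And>t. block_diagonal a b (P' t) (Q' t) \<in> L"
    and H0: "\<And>t. S 0 * Q' t = P' t * S 0"
    and H: "\<And>t l. 0 < l \<Longrightarrow> l < m \<Longrightarrow> S l * Q' t = P' t * (S l + int (r * t l) \<cdot>\<^sub>m S 0)"
    and r: "coprime r p"
  shows "\<exists>j. i < j \<and> j \<le> n \<and>
    (\<forall>A. finite A \<longrightarrow> (\<forall>a\<in>A. coprime a p) \<longrightarrow> (\<forall>a\<in>A. \<forall>b\<in>A. [a ^ r = b ^ r] (mod p ^ j) \<longrightarrow> a = b) \<longrightarrow>
      card A * (p ^ j) ^ (m - 1) \<le> d)"
proof -
  let ?G = "mod_group N k L"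
  let ?U = "\<lambda>l. reduce N (block_unipotent a b (S l))"
  have pow: "?U l [^]\<^bsub>?G\<^esub> (t :: nat) = reduce N (block_unipotent a b (int t \<cdot>\<^sub>m S l))" if "l < m" for l t
    unfolding k by (rule block_unipotent_pow[OF S[OF that]])
  have mult: "reduce N A \<otimes>\<^bsub>?G\<^esub> reduce N B = reduce N (A * B)"
    if "A \<in> carrier_mat (a + b) (a + b)" "B \<in> carrier_mat (a + b) (a + b)" for A B
    using that unfolding k by (rule mod_group_mult)
  have rel: "reduce N (block_unipotent a b T) \<otimes>\<^bsub>?G\<^esub> reduce N (block_diagonal a b X Y) =
      reduce N (block_diagonal a b X Y) \<otimes>\<^bsub>?G\<^esub> reduce N (block_unipotent a b T')"
    if "T \<in> carrier_mat a b" "T' \<in> carrier_mat a b" "X \<in> carrier_mat a a" "Y \<in> carrier_mat b b"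
      "reduce N (T * Y) = reduce N (X * T')" for T T' X Y
    using that
    by (simp add: mult block_unipotent_mult_block_diagonal block_diagonal_mult_block_unipotent)
      (rule reduce_four_block_cong[OF that(3) mult_carrier_mat[OF that(1,4)] mult_carrier_mat[OF that(3,2)]
          zero_carrier_mat that(4,5)])
  have S0: "S 0 \<in> carrier_mat a b" using S m by simp
  show ?thesis
  proof (rule degree_ge_character_orbit[where G = ?G and U = ?U and \<rho> = \<rho> and d = d and m = m and r = r and c = c
        and D = "\<lambda>x. reduce N (block_diagonal a b (P x) (Q x))"
        and H = "\<lambda>t. reduce N (block_diagonal a b (P' t) (Q' t))", OF L \<rho> prime m])
    show "?U l \<in> carrier ?G" if "l < m" for l
      using SL[OF that] by (simp add: mod_group_def)
    show "?U l \<otimes>\<^bsub>?G\<^esub> ?U l' = ?U l' \<otimes>\<^bsub>?G\<^esub> ?U l" if "l < m" "l' < m" for l l'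
      using S[OF that(1)] S[OF that(2)] comm_add_mat[of "S l" a b "S l'"] by (simp add: mult block_unipotent_mult)
    show "?U l [^]\<^bsub>?G\<^esub> p ^ n = \<one>\<^bsub>?G\<^esub>" if "l < m" for l
    proof -
      have "reduce N (int (p ^ n) \<cdot>\<^sub>m S l) = reduce N (0\<^sub>m a b)"
        by (subst reduce_eq_iff[of _ a b]) (use S[OF that] in \<open>auto simp: cong_0_iff\<close>)
      then have "reduce N (block_unipotent a b (int (p ^ n) \<cdot>\<^sub>m S l)) = reduce N (block_unipotent a b (0\<^sub>m a b))"
        by (intro reduce_block_unipotent_cong) (use S[OF that] in auto)
      moreover have "block_unipotent a b (0\<^sub>m a b) = 1\<^sub>m (a + b)"
        by (intro eq_matI) (auto simp: block_unipotent_def)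
      ultimately show ?thesis using pow[OF that, of "p ^ n"] by (simp add: mod_group_one k)
    qed
    show "\<rho> (?U 0 [^]\<^bsub>?G\<^esub> p ^ i) \<noteq> 1\<^sub>m d" unfolding pow[OF m] by (rule nontriv)
    show "reduce N (block_diagonal a b (P x) (Q x)) \<in> carrier ?G" if "coprime x p" for x
      using PQL[OF that] by (simp add: mod_group_def)
    show "?U 0 \<otimes>\<^bsub>?G\<^esub> reduce N (block_diagonal a b (P x) (Q x)) =
        reduce N (block_diagonal a b (P x) (Q x)) \<otimes>\<^bsub>?G\<^esub> ?U 0 [^]\<^bsub>?G\<^esub> (x ^ r)" if "coprime x p" for x
      unfolding pow[OF m] by (rule rel) (use S0 PQ[OF that] D0[OF that] in simp_all)
    show "?U l \<otimes>\<^bsub>?G\<^esub> reduce N (block_diagonal a b (P x) (Q x)) =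
        reduce N (block_diagonal a b (P x) (Q x)) \<otimes>\<^bsub>?G\<^esub> ?U l [^]\<^bsub>?G\<^esub> c x l" if "coprime x p" "0 < l" "l < m" for x l
      unfolding pow[OF that(3)] by (rule rel) (use S[OF that(3)] PQ[OF that(1)] D[OF that] in simp_all)
    show "reduce N (block_diagonal a b (P' t) (Q' t)) \<in> carrier ?G" for t
      using PQL' by (simp add: mod_group_def)
    show "?U 0 \<otimes>\<^bsub>?G\<^esub> reduce N (block_diagonal a b (P' t) (Q' t)) =
        reduce N (block_diagonal a b (P' t) (Q' t)) \<otimes>\<^bsub>?G\<^esub> ?U 0" for t
      by (rule rel) (use S0 PQ' H0 in simp_all)
    show "?U l \<otimes>\<^bsub>?G\<^esub> reduce N (block_diagonal a b (P' t) (Q' t)) =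
        reduce N (block_diagonal a b (P' t) (Q' t)) \<otimes>\<^bsub>?G\<^esub> (?U l \<otimes>\<^bsub>?G\<^esub> ?U 0 [^]\<^bsub>?G\<^esub> (r * t l))"
      if "0 < l" "l < m" for t l
    proof -
      have "?U l \<otimes>\<^bsub>?G\<^esub> ?U 0 [^]\<^bsub>?G\<^esub> (r * t l) = reduce N (block_unipotent a b (S l + int (r * t l) \<cdot>\<^sub>m S 0))"
        unfolding pow[OF m] using S[OF that(2)] S0 comm_add_mat[of "S l" a b "int (r * t l) \<cdot>\<^sub>m S 0"]
        by (simp add: mult block_unipotent_mult)
      then show ?thesis
        by (simp only:) (rule rel; use S[OF that(2)] S0 PQ' H[OF that, of t] in simp)
    qed
  qed (rule r)
qed

lemma ex_inverse_nat:
  assumes "coprime x p"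
  shows "\<exists>y :: nat. [int x * int y = 1] (mod N)"
proof -
  have "coprime x (p ^ n)" using assms by simp
  then obtain y where "[x * y = Suc 0] (mod p ^ n)" using cong_solve_coprime_nat by blast
  then have "[int (x * y) = int (Suc 0)] (mod int (p ^ n))" by (simp only: cong_int_iff)
  then show ?thesis by (intro exI[of _ y]) simp
qed

definition inverse_mod :: "nat \<Rightarrow> nat" where
  "inverse_mod x = (SOME y. [int x * int y = 1] (mod N))"

lemma inverse_mod: "coprime x p \<Longrightarrow> [int x * int (inverse_mod x) = 1] (mod N)"
  unfolding inverse_mod_def by (rule someI_ex[OF ex_inverse_nat])

end

definition diagonal_matrix :: "nat \<Rightarrow> (nat \<Rightarrow> int) \<Rightarrow> int mat" where
  "diagonal_matrix k f = mat k k (\<lambda>(i, j). if i = j then f i else 0)"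

definition row_shear :: "nat \<Rightarrow> (nat \<Rightarrow> int) \<Rightarrow> int mat" where
  "row_shear k t = mat k k (\<lambda>(i, j). if i = j then 1 else if i = 0 then t j else 0)"

lemma diagonal_matrix_carrier [simp]: "diagonal_matrix k f \<in> carrier_mat k k"
  by (simp add: diagonal_matrix_def)

lemma row_shear_carrier [simp]: "row_shear k t \<in> carrier_mat k k"
  by (simp add: row_shear_def)

lemma diagonal_matrix_mult_index:
  assumes "B \<in> carrier_mat k l" "i < k" "j < l"
  shows "(diagonal_matrix k f * B) $$ (i, j) = f i * B $$ (i, j)"
proof -
  have "(diagonal_matrix k f * B) $$ (i, j) = (\<Sum>s\<in>{0..<k}. (if i = s then f i else 0) * B $$ (s, j))"
    using assms by (simp add: diagonal_matrix_def scalar_prod_def)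
  also have "\<dots> = (\<Sum>s\<in>{0..<k}. if s = i then f i * B $$ (i, j) else 0)"
    by (intro sum.cong) auto
  finally show ?thesis using assms by simp
qed

lemma mult_diagonal_matrix_index:
  assumes "B \<in> carrier_mat l k" "i < l" "j < k"
  shows "(B * diagonal_matrix k f) $$ (i, j) = B $$ (i, j) * f j"
proof -
  have "(B * diagonal_matrix k f) $$ (i, j) = (\<Sum>s\<in>{0..<k}. B $$ (i, s) * (if s = j then f s else 0))"
    using assms by (simp add: diagonal_matrix_def scalar_prod_def)
  also have "\<dots> = (\<Sum>s\<in>{0..<k}. if s = j then B $$ (i, j) * f j else 0)"
    by (intro sum.cong) auto
  finally show ?thesis using assms by simp
qed

lemma row_shear_mult_index:
  assumes B: "B \<in> carrier_mat k l" and i: "i < k" and j: "j < l"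
  shows "(row_shear k t * B) $$ (i, j) = B $$ (i, j) + (if i = 0 then \<Sum>s\<in>{1..<k}. t s * B $$ (s, j) else 0)"
proof -
  have e: "(row_shear k t * B) $$ (i, j) =
      (\<Sum>s\<in>{0..<k}. (if i = s then 1 else if i = 0 then t s else 0) * B $$ (s, j))"
    using assms by (simp add: row_shear_def scalar_prod_def)
  show ?thesis
  proof (cases "i = 0")
    case True
    have k0: "{0..<k} = insert 0 {1..<k}" using i by auto
    have "(\<Sum>s\<in>{1..<k}. (if i = s then 1 else if i = 0 then t s else 0) * B $$ (s, j)) =
        (\<Sum>s\<in>{1..<k}. t s * B $$ (s, j))"
      using True by (intro sum.cong) auto
    then show ?thesis unfolding e k0 using True by simp
  next
    case False
    have "(\<Sum>s\<in>{0..<k}. (if i = s then 1 else if i = 0 then t s else 0) * B $$ (s, j)) =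
        (\<Sum>s\<in>{0..<k}. if s = i then B $$ (i, j) else 0)"
      using False by (intro sum.cong) auto
    then show ?thesis unfolding e using i False by simp
  qed
qed

lemma mult_row_shear_transpose_index:
  assumes B: "B \<in> carrier_mat l k" and i: "i < l" and j: "j < k"
  shows "(B * transpose_mat (row_shear k t)) $$ (i, j) =
    B $$ (i, j) + (if j = 0 then \<Sum>s\<in>{1..<k}. t s * B $$ (i, s) else 0)"
proof -
  have "B * transpose_mat (row_shear k t) = transpose_mat (row_shear k t * transpose_mat B)"
    using B by (simp add: transpose_mult[of _ k k])
  then have "(B * transpose_mat (row_shear k t)) $$ (i, j) = (row_shear k t * transpose_mat B) $$ (j, i)"
    using B i j by (simp add: row_shear_def)
  also have "\<dots> = transpose_mat B $$ (j, i) + (if j = 0 then \<Sum>s\<in>{1..<k}. t s * transpose_mat B $$ (s, i) else 0)"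
    by (rule row_shear_mult_index) (use B i j in auto)
  also have "(\<Sum>s\<in>{1..<k}. t s * transpose_mat B $$ (s, i)) = (\<Sum>s\<in>{1..<k}. t s * B $$ (i, s))"
    using B i by (intro sum.cong) auto
  finally show ?thesis using B i j by simp
qed

lemma det_diagonal_matrix: "det (diagonal_matrix k f) = (\<Prod>i = 0..<k. f i)"
proof -
  have "det (diagonal_matrix k f) = prod_list (diag_mat (diagonal_matrix k f))"
    by (rule det_upper_triangular[of _ k]) (auto simp: diagonal_matrix_def upper_triangular_def)
  also have "\<dots> = (\<Prod>i = 0..<k. diagonal_matrix k f $$ (i, i))"
    by (simp add: prod_list_diag_prod diagonal_matrix_def)
  also have "\<dots> = (\<Prod>i = 0..<k. f i)" by (intro prod.cong) (auto simp: diagonal_matrix_def)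
  finally show ?thesis .
qed

lemma det_row_shear: "det (row_shear k t) = 1"
proof -
  have "det (row_shear k t) = prod_list (diag_mat (row_shear k t))"
    by (rule det_upper_triangular[of _ k]) (auto simp: row_shear_def upper_triangular_def)
  also have "\<dots> = (\<Prod>i = 0..<k. row_shear k t $$ (i, i))"
    by (simp add: prod_list_diag_prod row_shear_def)
  also have "\<dots> = 1" by (intro prod.neutral) (auto simp: row_shear_def)
  finally show ?thesis .
qed

lemma row_shear_neg_mult: "row_shear k (\<lambda>j. - t j) * row_shear k t = 1\<^sub>m k"
proof (intro eq_matI)
  fix i j assume "i < dim_row (1\<^sub>m k :: int mat)" "j < dim_col (1\<^sub>m k :: int mat)"
  then have ij: "i < k" "j < k" by auto
  have "(\<Sum>s\<in>{1..<k}. - t s * row_shear k t $$ (s, j)) = (\<Sum>s\<in>{1..<k}. if s = j then - t j else 0)"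
    using ij by (intro sum.cong) (auto simp: row_shear_def)
  then show "(row_shear k (\<lambda>j. - t j) * row_shear k t) $$ (i, j) = 1\<^sub>m k $$ (i, j)"
    unfolding row_shear_mult_index[OF row_shear_carrier ij]
    using ij by (auto simp: row_shear_def)
qed (auto simp: row_shear_def)

lemma symp_form_block: "symp_form k = four_block_mat (0\<^sub>m k k) (1\<^sub>m k) (- 1\<^sub>m k) (0\<^sub>m k k)"
  by (intro eq_matI) (auto simp: symp_form_def)

lemma block_unipotent_in_SL_lift:
  assumes "S \<in> carrier_mat (k - 1) 1" "0 < k"
  shows "block_unipotent (k - 1) 1 S \<in> SL_lift N k"
proof -
  have "det (block_unipotent (k - 1) 1 S) = 1"
    unfolding block_unipotent_def
    by (subst det_four_block_mat_lower_left_zero[of _ "k - 1" _ 1]) (use assms in auto)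
  moreover have "k - 1 + 1 = k" using assms by simp
  ultimately show ?thesis
    using block_unipotent_carrier[of "k - 1" 1 S] by (simp add: SL_lift_def)
qed

lemma block_unipotent_in_Sp_lift:
  assumes S: "S \<in> carrier_mat k k" "transpose_mat S = S"
  shows "block_unipotent k k S \<in> Sp_lift N k"
proof -
  let ?U = "block_unipotent k k S"
  have "?U * symp_form k = four_block_mat (- S) (1\<^sub>m k) (- 1\<^sub>m k) (0\<^sub>m k k)"
    unfolding block_unipotent_def symp_form_block
    by (subst mult_four_block_mat[of _ k k _ k _ k _ _ k _ k]) (use S in simp_all)
  moreover have "transpose_mat ?U = four_block_mat (1\<^sub>m k) (0\<^sub>m k k) S (1\<^sub>m k)"
    unfolding block_unipotent_def using S by (subst transpose_four_block_mat[of _ k k _ k _ k]) simp_all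
  moreover have "four_block_mat (- S) (1\<^sub>m k) (- 1\<^sub>m k) (0\<^sub>m k k) * four_block_mat (1\<^sub>m k) (0\<^sub>m k k) S (1\<^sub>m k) = symp_form k"
    unfolding symp_form_block
    by (subst mult_four_block_mat[of _ k k _ k _ k _ _ k _ k]) (use S in simp_all)
  ultimately have "?U * symp_form k * transpose_mat ?U = symp_form k" by simp
  then show ?thesis by (simp add: Sp_lift_def mult_2)
qed

lemma block_diagonal_in_Sp_lift:
  assumes P: "P \<in> carrier_mat k k" and Q: "Q \<in> carrier_mat k k"
    and PQ: "reduce N (P * transpose_mat Q) = reduce N (1\<^sub>m k)"
  shows "block_diagonal k k P Q \<in> Sp_lift N k"
proof -
  let ?D = "block_diagonal k k P Q"
  have neg0: "- 0\<^sub>m k k = (0\<^sub>m k k :: int mat)" by (intro eq_matI) auto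
  have "?D * symp_form k = four_block_mat (0\<^sub>m k k) P (- Q) (0\<^sub>m k k)"
    unfolding block_diagonal_def symp_form_block
    by (subst mult_four_block_mat[of _ k k _ k _ k _ _ k _ k]) (use P Q neg0 in simp_all)
  moreover have "transpose_mat ?D = four_block_mat (transpose_mat P) (0\<^sub>m k k) (0\<^sub>m k k) (transpose_mat Q)"
    unfolding block_diagonal_def using P Q by (subst transpose_four_block_mat[of _ k k _ k _ k]) simp_all
  moreover have "four_block_mat (0\<^sub>m k k) P (- Q) (0\<^sub>m k k) *
      four_block_mat (transpose_mat P) (0\<^sub>m k k) (0\<^sub>m k k) (transpose_mat Q) =
      four_block_mat (0\<^sub>m k k) (P * transpose_mat Q) (- (Q * transpose_mat P)) (0\<^sub>m k k)"
    by (subst mult_four_block_mat[of _ k k _ k _ k _ _ k _ k]) (use P Q in simp_all)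
  ultimately have eq: "?D * symp_form k * transpose_mat ?D =
      four_block_mat (0\<^sub>m k k) (P * transpose_mat Q) (- (Q * transpose_mat P)) (0\<^sub>m k k)" by simp
  define X where "X = P * transpose_mat Q"
  have X: "X \<in> carrier_mat k k" "Q * transpose_mat P = transpose_mat X"
    using P Q by (simp_all add: X_def transpose_mult[of _ k k])
  have e: "[X $$ (i, j) = 1\<^sub>m k $$ (i, j)] (mod N)" if "i < k" "j < k" for i j
    using PQ that reduce_eq_iff[OF X(1) one_carrier_mat, of N] unfolding X_def[symmetric] by blast
  have "[- X $$ (j, i) = - 1\<^sub>m k $$ (i, j)] (mod N)" if "i < k" "j < k" for i j
    using e[OF that(2,1)] that unfolding cong_minus_minus_iff by (simp add: eq_commute)
  then have "reduce N (four_block_mat (0\<^sub>m k k) X (- transpose_mat X) (0\<^sub>m k k)) = reduce N (symp_form k)"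
    unfolding symp_form_block
    by (subst reduce_eq_iff[of _ "k + k" "k + k"]) (use X e in auto)
  then have "reduce N (?D * symp_form k * transpose_mat ?D) = reduce N (symp_form k)"
    unfolding eq X(2) X_def[symmetric] .
  then show ?thesis using P Q by (simp add: Sp_lift_def mult_2)
qed

section \<open>The root subgroups of the special linear and symplectic groups\<close>

lemma totient_le_of_orbit:
  fixes p j d e :: nat
  assumes p: "prime p" and j: "0 < j"
    and orbit: "\<And>A. finite A \<Longrightarrow> \<forall>a\<in>A. coprime a p \<Longrightarrow>
      \<forall>a\<in>A. \<forall>b\<in>A. [a ^ 1 = b ^ 1] (mod p ^ j) \<longrightarrow> a = b \<Longrightarrow> card A * e \<le> d"
  shows "p ^ (j - 1) * (p - 1) * e \<le> d"
proof -
  have p1: "1 < p ^ j" by (rule one_less_power[OF prime_gt_1_nat[OF p] j])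
  have "card (totatives (p ^ j)) * e \<le> d"
  proof (rule orbit)
    show "\<forall>a\<in>totatives (p ^ j). coprime a p"
      using j by (auto simp: in_totatives_iff)
    show "\<forall>a\<in>totatives (p ^ j). \<forall>b\<in>totatives (p ^ j). [a ^ 1 = b ^ 1] (mod p ^ j) \<longrightarrow> a = b"
      using totatives_less[OF _ p1] by (simp add: cong_less_modulus_unique_nat)
  qed simp
  then show ?thesis using totient_prime_power[OF p j] by (simp add: totient_def)
qed

text \<open>For odd \<open>p\<close>, one of each pair \<open>\<plusminus>a\<close> of units modulo \<open>p ^ j\<close> is kept; the squares of these are distinct.\<close>
lemma totient_le_of_square_orbit:
  fixes p j d e :: nat
  assumes p: "prime p" and p2: "p \<noteq> 2" and j: "0 < j"
    and orbit: "\<And>A. finite A \<Longrightarrow> \<forall>a\<in>A. coprime a p \<Longrightarrow>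
      \<forall>a\<in>A. \<forall>b\<in>A. [a ^ 2 = b ^ 2] (mod p ^ j) \<longrightarrow> a = b \<Longrightarrow> card A * e \<le> d"
  shows "p ^ (j - 1) * (p - 1) * e \<le> 2 * d"
proof -
  let ?q = "p ^ j"
  have odd_p: "odd p" using p p2 by (metis primes_dvd_imp_eq two_is_prime_nat)
  have q1: "1 < ?q" by (rule one_less_power[OF prime_gt_1_nat[OF p] j])
  define A where "A = {a \<in> totatives ?q. 2 * a < ?q}"
  have fin: "finite A" by (simp add: A_def)
  have cop: "coprime a p" if "a \<in> A" for a using that j by (auto simp: A_def in_totatives_iff)
  have tot: "totatives ?q \<subseteq> A \<union> (\<lambda>a. ?q - a) ` A"
  proof
    fix a assume a: "a \<in> totatives ?q"
    have aq: "a < ?q" by (rule totatives_less[OF a q1])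
    have "2 * a \<noteq> ?q" using odd_p by (metis dvd_triv_left even_power)
    then consider "2 * a < ?q" | "2 * (?q - a) < ?q" using aq by linarith
    then show "a \<in> A \<union> (\<lambda>a. ?q - a) ` A"
    proof cases
      case 2
      have "coprime (?q - a) ?q"
      proof (rule coprimeI)
        fix c assume c: "c dvd ?q - a" "c dvd ?q"
        have "c dvd a" by (rule dvd_diffD1[OF c]) (use aq in simp)
        moreover have "coprime a ?q" using a by (simp add: in_totatives_iff)
        ultimately show "is_unit c" using c(2) coprime_common_divisor by blast
      qed
      then have "?q - a \<in> A" using 2 aq by (simp add: A_def in_totatives_iff)
      then show ?thesis using aq by (intro UnI2 image_eqI[of _ _ "?q - a"]) auto
    qed (use a in \<open>simp add: A_def\<close>)
  qed
  have "card (totatives ?q) \<le> card (A \<union> (\<lambda>a. ?q - a) ` A)" using tot fin by (intro card_mono) auto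
  also have "\<dots> \<le> card A + card ((\<lambda>a. ?q - a) ` A)" by (rule card_Un_le)
  also have "\<dots> \<le> 2 * card A" using card_image_le[OF fin, of "\<lambda>a. ?q - a"] by simp
  finally have half: "totient ?q \<le> 2 * card A" by (simp add: totient_def)
  have no: False if ab: "a \<in> A" "b \<in> A" "a < b" "[a ^ 2 = b ^ 2] (mod ?q)" for a b
  proof -
    have bounds: "0 < b - a" "b - a < ?q" "0 < a + b" "a + b < ?q" using ab by (auto simp: A_def)
    have "?q dvd b ^ 2 - a ^ 2"
      using ab(3,4) cong_altdef_nat[of "a ^ 2" "b ^ 2" ?q] by (simp add: power_mono cong_sym_eq)
    also have "b ^ 2 - a ^ 2 = (b - a) * (a + b)"
    proof -
      obtain c where "b = a + c" using ab(3) less_imp_add_positive by blast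
      then show ?thesis by (simp add: power2_eq_square algebra_simps)
    qed
    finally have dvd: "?q dvd (b - a) * (a + b)" .
    have "\<not> (p dvd b - a \<and> p dvd a + b)"
    proof
      assume "p dvd b - a \<and> p dvd a + b"
      then have "p dvd (a + b) + (b - a)" by (metis dvd_add)
      also have "(a + b) + (b - a) = 2 * b" using ab(3) by simp
      finally have "p dvd b" using p odd_p by (metis prime_dvd_mult_iff primes_dvd_imp_eq two_is_prime_nat p2)
      then show False using cop[OF ab(2)] p by (metis coprime_absorb_right dvd_refl not_prime_unit coprime_commute)
    qed
    then consider "coprime ?q (b - a)" | "coprime ?q (a + b)"
      using p j by (metis coprime_power_left_iff prime_imp_coprime)
    then show False
    proof cases
      case 1
      then have "?q dvd a + b" using dvd by (simp add: coprime_dvd_mult_right_iff)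
      then show False using bounds(3,4) by (auto dest: dvd_imp_le)
    next
      case 2
      then have "?q dvd b - a" using dvd by (simp add: coprime_dvd_mult_left_iff)
      then show False using bounds(1,2) by (auto dest: dvd_imp_le)
    qed
  qed
  have "card A * e \<le> d"
  proof (rule orbit[OF fin])
    show "\<forall>a\<in>A. \<forall>b\<in>A. [a ^ 2 = b ^ 2] (mod ?q) \<longrightarrow> a = b"
      using no cong_sym by (metis linorder_neqE_nat)
  qed (use cop in blast)
  then have "2 * card A * e \<le> 2 * d" by simp
  moreover have "totient ?q * e \<le> 2 * card A * e" using half by (rule mult_le_mono1)
  ultimately have "totient ?q * e \<le> 2 * d" by (rule order.trans[rotated])
  then show ?thesis using totient_prime_power[OF p j] by simp
qed

definition SL_root :: "nat \<Rightarrow> nat \<Rightarrow> int mat" where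
  "SL_root k l = mat (k - 1) 1 (\<lambda>(i, j). if i = l then 1 else 0)"

text \<open>For \<open>l = 0\<close> the two conditions coincide, and the matrix has the single entry \<open>1\<close>.\<close>
definition Sp_root :: "nat \<Rightarrow> nat \<Rightarrow> int mat" where
  "Sp_root k l = mat k k (\<lambda>(i, j). if i = 0 \<and> j = l \<or> i = l \<and> j = 0 then 1 else 0)"

lemma SL_root_carrier [simp]: "SL_root k l \<in> carrier_mat (k - 1) 1"
  by (simp add: SL_root_def)

lemma SL_root_carrier_Suc [simp]: "SL_root k l \<in> carrier_mat (k - Suc 0) (Suc 0)"
  using SL_root_carrier[of k l] by simp

lemma Sp_root_carrier [simp]: "Sp_root k l \<in> carrier_mat k k"
  by (simp add: Sp_root_def)

context prime_power_modulus
begin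

text \<open>
  The diagonal matrix has the entries \<open>1/x, x, 1, \<dots>, 1\<close>. As \<open>k \<ge> 3\<close>, the second entry is not the last one and
  can be used to correct the determinant; this is why \<open>U 0\<close> is raised to the power \<open>x\<close> and not \<open>x ^ 2\<close>.
\<close>
lemma SL_degree_ge:
  assumes k: "3 \<le> k" and \<rho>: "representation (SL_mod k) d \<rho>"
    and nontriv: "\<rho> (reduce N (block_unipotent (k - 1) 1 (int (p ^ i) \<cdot>\<^sub>m SL_root k 0))) \<noteq> 1\<^sub>m d"
  shows "\<exists>j. i < j \<and> j \<le> n \<and> p ^ (j - 1) * (p - 1) * (p ^ j) ^ (k - 2) \<le> d"
proof -
  let ?a = "k - 1"
  let ?f = "\<lambda>x i. if i = 0 then int (inverse_mod x) else if i = 1 then int x else 1"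
  let ?P = "\<lambda>x. diagonal_matrix ?a (?f x)"
  let ?c = "\<lambda>x l. if l = 1 then inverse_mod x else (1 :: nat)"
  let ?P' = "\<lambda>t :: nat \<Rightarrow> nat. row_shear ?a (\<lambda>j. - int (t j))"
  have SL: "block_diagonal ?a 1 P (1\<^sub>m 1) \<in> SL_lift N k" if "P \<in> carrier_mat ?a ?a" "[det P = 1] (mod N)" for P
  proof -
    have "det (block_diagonal ?a 1 P (1\<^sub>m 1)) = det P"
      unfolding block_diagonal_def
      by (subst det_four_block_mat_lower_left_zero[of _ ?a _ 1]) (use that in auto)
    then show ?thesis using that k block_diagonal_carrier[OF that(1) one_carrier_mat[of 1]] by (simp add: SL_lift_def)
  qed
  have detP: "det (?P x) = int x * int (inverse_mod x)" for x
  proof -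
    have "{0..<?a} = insert 0 (insert 1 {2..<?a})" using k by auto
    then show ?thesis by (simp add: det_diagonal_matrix)
  qed
  have "\<exists>j. i < j \<and> j \<le> n \<and>
    (\<forall>A. finite A \<longrightarrow> (\<forall>a\<in>A. coprime a p) \<longrightarrow> (\<forall>a\<in>A. \<forall>b\<in>A. [a ^ 1 = b ^ 1] (mod p ^ j) \<longrightarrow> a = b) \<longrightarrow>
      card A * (p ^ j) ^ (?a - 1) \<le> d)"
  proof (rule degree_ge_block_unipotent[where k = k and a = ?a and b = 1 and L = "SL_lift N k" and m = ?a
        and \<rho> = \<rho> and S = "SL_root k" and P = ?P and Q = "\<lambda>_. 1\<^sub>m 1" and c = ?c and P' = ?P' and Q' = "\<lambda>_. 1\<^sub>m 1"
        and d = d and r = 1, OF _ group_SL_lift \<rho>])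
    show "block_unipotent ?a 1 (SL_root k l) \<in> SL_lift N k" for l
      by (rule block_unipotent_in_SL_lift[OF SL_root_carrier]) (use k in simp)
    show "block_diagonal ?a 1 (?P x) (1\<^sub>m 1) \<in> SL_lift N k" if "coprime x p" for x
      using inverse_mod[OF that] by (intro SL) (simp_all only: detP diagonal_matrix_carrier)
    show "block_diagonal ?a 1 (?P' t) (1\<^sub>m 1) \<in> SL_lift N k" for t
      by (intro SL) (simp_all add: det_row_shear)
    show "reduce N (SL_root k 0 * 1\<^sub>m 1) = reduce N (?P x * (int (x ^ 1) \<cdot>\<^sub>m SL_root k 0))" if x: "coprime x p" for x
    proof -
      have c2: "?P x * (int (x ^ 1) \<cdot>\<^sub>m SL_root k 0) \<in> carrier_mat ?a 1"
        by (rule mult_carrier_mat[OF diagonal_matrix_carrier smult_carrier_mat[OF SL_root_carrier]])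
      have "[SL_root k 0 $$ (i, j) = (?P x * (int (x ^ 1) \<cdot>\<^sub>m SL_root k 0)) $$ (i, j)] (mod N)" if ij: "i < ?a" "j < 1" for i j
        using cong_sym[OF inverse_mod[OF x]] ij
        by (subst diagonal_matrix_mult_index[of _ ?a 1]) (auto simp: SL_root_def mult.commute)
      then show ?thesis
        unfolding right_mult_one_mat[OF SL_root_carrier] reduce_eq_iff[OF SL_root_carrier c2] by blast
    qed
    show "reduce N (SL_root k l * 1\<^sub>m 1) = reduce N (?P x * (int (?c x l) \<cdot>\<^sub>m SL_root k l))"
      if x: "coprime x p" "0 < l" for x l
    proof -
      have c2: "?P x * (int (?c x l) \<cdot>\<^sub>m SL_root k l) \<in> carrier_mat ?a 1"
        by (rule mult_carrier_mat[OF diagonal_matrix_carrier smult_carrier_mat[OF SL_root_carrier]])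
      have "[SL_root k l $$ (i, j) = (?P x * (int (?c x l) \<cdot>\<^sub>m SL_root k l)) $$ (i, j)] (mod N)" if ij: "i < ?a" "j < 1" for i j
        using cong_sym[OF inverse_mod[OF x(1)]] ij x(2)
        by (subst diagonal_matrix_mult_index[of _ ?a 1]) (auto simp: SL_root_def)
      then show ?thesis
        unfolding right_mult_one_mat[OF SL_root_carrier] reduce_eq_iff[OF SL_root_carrier c2] by blast
    qed
    show "SL_root k 0 * 1\<^sub>m 1 = ?P' t * SL_root k 0" for t
    proof (rule eq_matI)
      fix i j assume "i < dim_row (?P' t * SL_root k 0)" "j < dim_col (?P' t * SL_root k 0)"
      then have ij: "i < ?a" "j < 1" by (auto simp: row_shear_def SL_root_def)
      have sum: "(\<Sum>s\<in>{1..<?a}. - int (t s) * SL_root k 0 $$ (s, j)) = 0"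
        using ij by (intro sum.neutral) (auto simp: SL_root_def)
      show "(SL_root k 0 * 1\<^sub>m 1) $$ (i, j) = (?P' t * SL_root k 0) $$ (i, j)"
        unfolding row_shear_mult_index[OF SL_root_carrier ij] sum right_mult_one_mat[OF SL_root_carrier] by simp
    qed (auto simp: SL_root_def row_shear_def)
    show "SL_root k l * 1\<^sub>m 1 = ?P' t * (SL_root k l + int (1 * t l) \<cdot>\<^sub>m SL_root k 0)"
      if l: "0 < l" "l < ?a" for t l
    proof (rule eq_matI)
      let ?B = "SL_root k l + int (1 * t l) \<cdot>\<^sub>m SL_root k 0"
      have B: "?B \<in> carrier_mat ?a 1" by simp
      fix i j assume "i < dim_row (?P' t * ?B)" "j < dim_col (?P' t * ?B)"
      then have ij: "i < ?a" "j < 1" by (auto simp: row_shear_def SL_root_def)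
      have "(\<Sum>s\<in>{1..<?a}. - int (t s) * ?B $$ (s, j)) = (\<Sum>s\<in>{1..<?a}. if s = l then - int (t l) else 0)"
        using ij l by (intro sum.cong) (auto simp: SL_root_def)
      also have "\<dots> = - int (t l)" using l by simp
      finally have sum: "(\<Sum>s\<in>{1..<?a}. - int (t s) * ?B $$ (s, j)) = - int (t l)" .
      show "(SL_root k l * 1\<^sub>m 1) $$ (i, j) = (?P' t * ?B) $$ (i, j)"
        unfolding row_shear_mult_index[OF B ij] sum right_mult_one_mat[OF SL_root_carrier]
        using ij l by (auto simp: SL_root_def)
    qed (auto simp: SL_root_def row_shear_def)
  qed (use k nontriv in auto)
  then obtain j where j: "i < j" "j \<le> n" and orbit: "\<And>A. finite A \<Longrightarrow> \<forall>a\<in>A. coprime a p \<Longrightarrow>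
      \<forall>a\<in>A. \<forall>b\<in>A. [a ^ 1 = b ^ 1] (mod p ^ j) \<longrightarrow> a = b \<Longrightarrow> card A * (p ^ j) ^ (?a - 1) \<le> d"
    by blast
  have "p ^ (j - 1) * (p - 1) * (p ^ j) ^ (?a - 1) \<le> d"
    by (rule totient_le_of_orbit[OF prime _ orbit]) (use j in auto)
  moreover have "?a - 1 = k - 2" by simp
  ultimately show ?thesis using j by auto
qed

text \<open>
  The blocks satisfy $Q=P^{-T}$ and take a symmetric matrix $S$ to $P^{-1}SP^{-T}$. Scaling the first basis vector
  by \<open>x\<close> multiplies $E_{00}$ by \<open>x ^ 2\<close>, and adding $t_l$ times it to another one takes $E_{0l}+E_{l0}$ to
  $E_{0l}+E_{l0}+2t_lE_{00}$.
\<close>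
lemma Sp_degree_ge:
  assumes k: "0 < k" and p2: "p \<noteq> 2" and \<rho>: "representation (Sp_mod k) d \<rho>"
    and nontriv: "\<rho> (reduce N (block_unipotent k k (int (p ^ i) \<cdot>\<^sub>m Sp_root k 0))) \<noteq> 1\<^sub>m d"
  shows "\<exists>j. i < j \<and> j \<le> n \<and> p ^ (j - 1) * (p - 1) * (p ^ j) ^ (k - 1) \<le> 2 * d"
proof -
  let ?f = "\<lambda>x i. if i = 0 then int (inverse_mod x) else 1"
  let ?g = "\<lambda>(x :: nat) (i :: nat). if i = 0 then int x else 1"
  let ?P = "\<lambda>x. diagonal_matrix k (?f x)" and ?Q = "\<lambda>x. diagonal_matrix k (?g x)"
  let ?P' = "\<lambda>t :: nat \<Rightarrow> nat. row_shear k (\<lambda>j. - int (t j))"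
  let ?Q' = "\<lambda>t :: nat \<Rightarrow> nat. transpose_mat (row_shear k (\<lambda>j. int (t j)))"
  have p_odd: "coprime 2 p" using prime p2 by (metis primes_coprime two_is_prime_nat)
  have entry: "[(Sp_root k l * ?Q x) $$ (i, j) = (?P x * (int e \<cdot>\<^sub>m Sp_root k l)) $$ (i, j)] (mod N)"
    if "i < k" "j < k" and "Sp_root k l $$ (i, j) \<noteq> 0 \<longrightarrow> [?g x j = ?f x i * int e] (mod N)" for l x e i j
  proof -
    have "(?P x * (int e \<cdot>\<^sub>m Sp_root k l)) $$ (i, j) = ?f x i * (int e * Sp_root k l $$ (i, j))"
      using that(1,2) by (subst diagonal_matrix_mult_index[of _ k k]) (auto simp: Sp_root_def)
    moreover have "(Sp_root k l * ?Q x) $$ (i, j) = Sp_root k l $$ (i, j) * ?g x j"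
      by (rule mult_diagonal_matrix_index[OF Sp_root_carrier that(1,2)])
    moreover have "Sp_root k l $$ (i, j) = 0 \<or> Sp_root k l $$ (i, j) = 1" using that(1,2) by (simp add: Sp_root_def)
    ultimately show ?thesis using that(3) by auto
  qed
  have "\<exists>j. i < j \<and> j \<le> n \<and>
    (\<forall>A. finite A \<longrightarrow> (\<forall>a\<in>A. coprime a p) \<longrightarrow> (\<forall>a\<in>A. \<forall>b\<in>A. [a ^ 2 = b ^ 2] (mod p ^ j) \<longrightarrow> a = b) \<longrightarrow>
      card A * (p ^ j) ^ (k - 1) \<le> d)"
  proof (rule degree_ge_block_unipotent[where k = "2 * k" and a = k and b = k and L = "Sp_lift N k" and m = k
        and \<rho> = \<rho> and S = "Sp_root k" and P = ?P and Q = ?Q and c = "\<lambda>x l. x" and P' = ?P' and Q' = ?Q'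
        and d = d and r = 2, OF _ group_Sp_lift \<rho>])
    show "block_unipotent k k (Sp_root k l) \<in> Sp_lift N k" for l
      by (rule block_unipotent_in_Sp_lift) (auto simp: Sp_root_def)
    show "block_diagonal k k (?P x) (?Q x) \<in> Sp_lift N k" if x: "coprime x p" for x
    proof (rule block_diagonal_in_Sp_lift)
      have "[(?P x * transpose_mat (?Q x)) $$ (i, j) = 1\<^sub>m k $$ (i, j)] (mod N)" if ij: "i < k" "j < k" for i j
        using inverse_mod[OF x] ij
        by (subst diagonal_matrix_mult_index[of _ k k]) (auto simp: diagonal_matrix_def mult.commute)
      then show "reduce N (?P x * transpose_mat (?Q x)) = reduce N (1\<^sub>m k)"
        by (subst reduce_eq_iff[of _ k k]) auto
    qed auto
    show "block_diagonal k k (?P' t) (?Q' t) \<in> Sp_lift N k" for t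
      by (rule block_diagonal_in_Sp_lift) (auto simp: row_shear_neg_mult)
    show "reduce N (Sp_root k 0 * ?Q x) = reduce N (?P x * (int (x ^ 2) \<cdot>\<^sub>m Sp_root k 0))" if x: "coprime x p" for x
    proof -
      have "[int x = int (inverse_mod x) * int (x ^ 2)] (mod N)"
        using cong_scalar_left[OF cong_sym[OF inverse_mod[OF x]], of "int x"] by (simp add: power2_eq_square mult_ac)
      then have "[(Sp_root k 0 * ?Q x) $$ (i, j) = (?P x * (int (x ^ 2) \<cdot>\<^sub>m Sp_root k 0)) $$ (i, j)] (mod N)"
        if "i < k" "j < k" for i j
        using that by (intro entry) (auto simp: Sp_root_def)
      then show ?thesis by (subst reduce_eq_iff[of _ k k]) auto
    qed
    show "reduce N (Sp_root k l * ?Q x) = reduce N (?P x * (int x \<cdot>\<^sub>m Sp_root k l))"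
      if x: "coprime x p" "0 < l" for x l
    proof -
      have "[1 = int (inverse_mod x) * int x] (mod N)"
        using cong_sym[OF inverse_mod[OF x(1)]] by (simp add: mult.commute)
      then have "[(Sp_root k l * ?Q x) $$ (i, j) = (?P x * (int x \<cdot>\<^sub>m Sp_root k l)) $$ (i, j)] (mod N)"
        if "i < k" "j < k" for i j
        using that x(2) by (intro entry) (auto simp: Sp_root_def)
      then show ?thesis by (subst reduce_eq_iff[of _ k k]) auto
    qed
    show "Sp_root k 0 * ?Q' t = ?P' t * Sp_root k 0" for t
    proof (rule eq_matI)
      fix i j assume "i < dim_row (?P' t * Sp_root k 0)" "j < dim_col (?P' t * Sp_root k 0)"
      then have ij: "i < k" "j < k" by (auto simp: row_shear_def Sp_root_def)
      have sums: "(\<Sum>s\<in>{1..<k}. - int (t s) * Sp_root k 0 $$ (s, j)) = 0" "(\<Sum>s\<in>{1..<k}. int (t s) * Sp_root k 0 $$ (i, s)) = 0"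
        using ij by (auto simp: Sp_root_def intro!: sum.neutral)
      show "(Sp_root k 0 * ?Q' t) $$ (i, j) = (?P' t * Sp_root k 0) $$ (i, j)"
        unfolding row_shear_mult_index[OF Sp_root_carrier ij] mult_row_shear_transpose_index[OF Sp_root_carrier ij] sums by simp
    qed (auto simp: Sp_root_def row_shear_def)
    show "Sp_root k l * ?Q' t = ?P' t * (Sp_root k l + int (2 * t l) \<cdot>\<^sub>m Sp_root k 0)"
      if l: "0 < l" "l < k" for t l
    proof (rule eq_matI)
      let ?B = "Sp_root k l + int (2 * t l) \<cdot>\<^sub>m Sp_root k 0"
      have B: "?B \<in> carrier_mat k k" by simp
      fix i j assume "i < dim_row (?P' t * ?B)" "j < dim_col (?P' t * ?B)"
      then have ij: "i < k" "j < k" by (auto simp: row_shear_def Sp_root_def)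
      have "(\<Sum>s\<in>{1..<k}. - int (t s) * ?B $$ (s, j)) = (\<Sum>s\<in>{1..<k}. if s = l then (if j = 0 then - int (t l) else 0) else 0)"
        using ij l by (intro sum.cong) (auto simp: Sp_root_def)
      also have "\<dots> = (if j = 0 then - int (t l) else 0)" using l by simp
      finally have sum1: "(\<Sum>s\<in>{1..<k}. - int (t s) * ?B $$ (s, j)) = (if j = 0 then - int (t l) else 0)" .
      have "(\<Sum>s\<in>{1..<k}. int (t s) * Sp_root k l $$ (i, s)) = (\<Sum>s\<in>{1..<k}. if s = l then (if i = 0 then int (t l) else 0) else 0)"
        using ij l by (intro sum.cong) (auto simp: Sp_root_def)
      also have "\<dots> = (if i = 0 then int (t l) else 0)" using l by simp
      finally have sum2: "(\<Sum>s\<in>{1..<k}. int (t s) * Sp_root k l $$ (i, s)) = (if i = 0 then int (t l) else 0)" .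
      show "(Sp_root k l * ?Q' t) $$ (i, j) = (?P' t * ?B) $$ (i, j)"
        unfolding row_shear_mult_index[OF B ij] mult_row_shear_transpose_index[OF Sp_root_carrier ij] sum1 sum2
        using ij l by (auto simp: Sp_root_def)
    qed (auto simp: Sp_root_def row_shear_def)
  qed (use k nontriv p_odd in auto)
  then obtain j where j: "i < j" "j \<le> n" and orbit: "\<And>A. finite A \<Longrightarrow> \<forall>a\<in>A. coprime a p \<Longrightarrow>
      \<forall>a\<in>A. \<forall>b\<in>A. [a ^ 2 = b ^ 2] (mod p ^ j) \<longrightarrow> a = b \<Longrightarrow> card A * (p ^ j) ^ (k - 1) \<le> d"
    by blast
  have "p ^ (j - 1) * (p - 1) * (p ^ j) ^ (k - 1) \<le> 2 * d"
    by (rule totient_le_of_square_orbit[OF prime p2 _ orbit]) (use j in auto)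
  then show ?thesis using j by auto
qed

end

section \<open>Existence of faithful representations\<close>

text \<open>
  Left multiplication permutes a basis indexed by the group, and only the unit fixes a basis vector.
\<close>
lemma ex_faithful_rep:
  fixes G (structure)
  assumes G: "group G" and fin: "finite (carrier G)"
  shows "\<exists>d \<rho>. faithful_rep G d \<rho>"
proof -
  interpret group G by fact
  define d where "d = card (carrier G)"
  obtain f where f: "bij_betw f {0..<d} (carrier G)"
    using ex_bij_betw_nat_finite[OF fin] unfolding d_def by blast
  have fc: "f i \<in> carrier G" if "i < d" for i using f that by (auto simp: bij_betw_def)
  have f_inj: "f i = f j \<longleftrightarrow> i = j" if "i < d" "j < d" for i j
    using f that by (auto simp: bij_betw_def inj_on_eq_iff)
  define \<rho> where "\<rho> g = mat d d (\<lambda>(i, j). if f i = g \<otimes> f j then 1 else 0 :: complex)" for g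
  have \<rho>c: "\<rho> g \<in> carrier_mat d d" for g by (simp add: \<rho>_def)
  have mult: "\<rho> (g \<otimes> h) = \<rho> g * \<rho> h" if gh: "g \<in> carrier G" "h \<in> carrier G" for g h
  proof (rule eq_matI)
    fix i j assume "i < dim_row (\<rho> g * \<rho> h)" "j < dim_col (\<rho> g * \<rho> h)"
    then have ij: "i < d" "j < d" using \<rho>c[of g] \<rho>c[of h] by auto
    obtain l where l: "l < d" "f l = h \<otimes> f j"
      using f gh(2) fc[OF ij(2)] by (metis atLeastLessThan_iff bij_betw_imp_surj_on imageE m_closed)
    have "(\<rho> g * \<rho> h) $$ (i, j) =
        (\<Sum>s\<in>{0..<d}. (if f i = g \<otimes> f s then 1 else 0) * (if f s = h \<otimes> f j then 1 else 0))"
      using ij by (simp add: \<rho>_def scalar_prod_def)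
    also have "\<dots> = (\<Sum>s\<in>{0..<d}. if s = l then (if f i = g \<otimes> f l then 1 else 0) else 0)"
      using f_inj[OF _ l(1)] l(2) by (intro sum.cong) auto
    also have "\<dots> = (if f i = g \<otimes> (h \<otimes> f j) then 1 else 0)" using l by simp
    finally show "\<rho> (g \<otimes> h) $$ (i, j) = (\<rho> g * \<rho> h) $$ (i, j)"
      using ij gh fc by (simp add: \<rho>_def m_assoc)
  qed (simp_all add: \<rho>_def)
  have one: "\<rho> \<one> = 1\<^sub>m d"
    by (rule eq_matI) (auto simp: \<rho>_def fc f_inj)
  have "\<rho> g \<in> carrier (GL_complex d)" if g: "g \<in> carrier G" for g
    unfolding carrier_GL_complex
    using mult[OF inv_closed[OF g] g] mult[OF g inv_closed[OF g]] g \<rho>c one by auto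
  then have rep: "representation G d \<rho>"
    using mult by (simp add: representation_def hom_def GL_complex_simps)
  have "g = \<one>" if g: "g \<in> carrier G" "\<rho> g = 1\<^sub>m d" for g
  proof -
    have d: "0 < d" unfolding d_def using fin one_closed by (auto simp: card_gt_0_iff)
    have "\<rho> g $$ (0, 0) = 1" using g(2) d by simp
    then have "f 0 = g \<otimes> f 0" using d by (simp add: \<rho>_def split: if_splits)
    then show ?thesis using fc[OF d] g(1) by simp
  qed
  then have "kernel G (GL_complex d) \<rho> = {\<one>}"
    using one by (auto simp: kernel_def GL_complex_simps)
  then show ?thesis using rep unfolding faithful_rep_def by blast
qed

lemma min_degree_ge:
  assumes "\<exists>d \<rho>. nontrivial_rep G d \<rho>" and "\<And>d \<rho>. nontrivial_rep G d \<rho> \<Longrightarrow> x \<le> real d"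
  shows "x \<le> real (min_degree G)"
  using LeastI_ex[of "\<lambda>d. \<exists>\<rho>. nontrivial_rep G d \<rho>"] assms unfolding min_degree_def by blast

lemma min_faithful_degree_ge:
  assumes "\<exists>d \<rho>. faithful_rep G d \<rho>" and "\<And>d \<rho>. faithful_rep G d \<rho> \<Longrightarrow> x \<le> real d"
  shows "x \<le> real (min_faithful_degree G)"
  using LeastI_ex[of "\<lambda>d. \<exists>\<rho>. faithful_rep G d \<rho>"] assms unfolding min_faithful_degree_def by blast

lemma faithful_rep_ne_one:
  assumes "faithful_rep G d \<rho>" and "g \<in> carrier G" "g \<noteq> \<one>\<^bsub>G\<^esub>"
  shows "\<rho> g \<noteq> 1\<^sub>m d"
  using assms by (auto simp: faithful_rep_def kernel_def GL_complex_simps)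

lemma faithful_imp_nontrivial_rep:
  assumes "faithful_rep G d \<rho>" and "g \<in> carrier G" "g \<noteq> \<one>\<^bsub>G\<^esub>"
  shows "nontrivial_rep G d \<rho>"
  using assms faithful_rep_ne_one[OF assms] by (auto simp: faithful_rep_def nontrivial_rep_def GL_complex_simps)

section \<open>The degree bounds\<close>

context prime_power_modulus
begin

lemma block_unipotent_multiple_ne_one:
  assumes S: "S \<in> carrier_mat a b" and entry: "S $$ (0, 0) = 1" "0 < a" "0 < b"
  shows "reduce N (block_unipotent a b (int (p ^ (n - 1)) \<cdot>\<^sub>m S)) \<noteq> reduce N (1\<^sub>m (a + b))"
proof
  let ?U = "block_unipotent a b (int (p ^ (n - 1)) \<cdot>\<^sub>m S)"
  assume "reduce N ?U = reduce N (1\<^sub>m (a + b))"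
  then have "\<forall>i<a + b. \<forall>j<a + b. [?U $$ (i, j) = 1\<^sub>m (a + b) $$ (i, j)] (mod N)"
    by (rule iffD1[OF reduce_eq_iff[OF block_unipotent_carrier one_carrier_mat]])
  moreover have "0 < a + b" "a < a + b" using entry by auto
  ultimately have "[block_unipotent a b (int (p ^ (n - 1)) \<cdot>\<^sub>m S) $$ (0, a) = 1\<^sub>m (a + b) $$ (0, a)] (mod N)"
    by blast
  then have "[int (p ^ (n - 1)) = 0] (mod N)"
    using entry S by (simp add: block_unipotent_def)
  then have "p ^ n dvd p ^ (n - 1)" by (metis cong_0_iff of_nat_dvd_iff of_nat_power)
  then have "n \<le> n - 1" using prime_gt_1_nat[OF prime] by (metis dvd_power_iff_le power_dvd_imp_le)
  then show False using n_pos by simp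
qed

lemma representation_kernel_normal:
  assumes "group G" "representation G d \<rho>"
  shows "normal (kernel G (GL_complex d) \<rho>) G"
  using representation_group_hom[OF assms] by (rule group_hom.normal_kernel)

text \<open>
  Multiples by natural numbers are powers, and other integers are congruent to natural numbers.
\<close>
lemma block_unipotent_multiples_in_subgroup:
  assumes sub: "subgroup K (mod_group N (a + b) L)" and S: "S \<in> carrier_mat a b"
    and K: "reduce N (block_unipotent a b S) \<in> K"
  shows "reduce N (block_unipotent a b (s \<cdot>\<^sub>m S)) \<in> K"
proof -
  have nat: "reduce N (block_unipotent a b (int t \<cdot>\<^sub>m S)) \<in> K" for t
    unfolding block_unipotent_pow[OF S, of L, symmetric]
  proof (induction t)
    case 0
    then show ?case using subgroup.one_closed[OF sub] by (simp add: nat_pow_def)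
  next
    case (Suc t)
    then show ?case using subgroup.m_closed[OF sub _ K] by (simp add: nat_pow_def)
  qed
  have "0 \<le> s mod N" using modulus_gt_1 by (intro pos_mod_sign) linarith
  then have s: "int (nat (s mod N)) = s mod N" by (rule nat_0_le)
  have "reduce N (s \<cdot>\<^sub>m S) = reduce N ((s mod N) \<cdot>\<^sub>m S)"
    by (rule reduce_smult_cong[OF S]) (simp add: cong_def)
  then have "reduce N (block_unipotent a b (s \<cdot>\<^sub>m S)) = reduce N (block_unipotent a b ((s mod N) \<cdot>\<^sub>m S))"
    by (intro reduce_block_unipotent_cong) (use S in auto)
  then show ?thesis using nat[of "nat (s mod N)"] unfolding s by simp
qed

text \<open>
  If the root element acted trivially, so would its normal closure, which is the whole group.
\<close>
lemma SL_nontrivial_degree_ge: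
  assumes k: "3 \<le> k" and \<rho>: "nontrivial_rep (SL_mod k) d \<rho>"
  shows "(p - 1) * p ^ (k - 2) \<le> d"
proof -
  let ?G = "SL_mod k" and ?S = "SL_root k 0"
  let ?K = "kernel ?G (GL_complex d) \<rho>"
  have rep: "representation ?G d \<rho>" using \<rho> by (simp add: nontrivial_rep_def)
  have sm: "int (p ^ 0) \<cdot>\<^sub>m ?S = ?S" by (intro eq_matI) auto
  have U: "addrow_mat k 1 0 (k - 1) = block_unipotent (k - 1) 1 ?S"
    using k by (intro eq_matI) (auto simp: addrow_mat_def block_unipotent_def SL_root_def)
  have "\<rho> (reduce N (block_unipotent (k - 1) 1 (int (p ^ 0) \<cdot>\<^sub>m ?S))) \<noteq> 1\<^sub>m d"
  proof
    assume triv: "\<rho> (reduce N (block_unipotent (k - 1) 1 (int (p ^ 0) \<cdot>\<^sub>m ?S))) = 1\<^sub>m d"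
    have "addrow_mat k 1 0 (k - 1) \<in> SL_lift N k" using k by (intro addrow_mat_in_SL_lift) simp
    then have "reduce N (addrow_mat k 1 0 (k - 1)) \<in> ?K"
      using triv unfolding sm U by (simp add: kernel_def GL_complex_simps mod_group_def)
    then have "?K = carrier ?G"
      by (rule SL_normal_closure_elementary[OF k representation_kernel_normal[OF group_SL_lift rep]])
    then show False using \<rho> by (auto simp: nontrivial_rep_def kernel_def)
  qed
  from SL_degree_ge[OF k rep this] obtain j where j: "0 < j" "p ^ (j - 1) * (p - 1) * (p ^ j) ^ (k - 2) \<le> d"
    by blast
  have p1: "1 \<le> p" using prime_gt_1_nat[OF prime] by simp
  have "1 * (p - 1) * p ^ (k - 2) \<le> p ^ (j - 1) * (p - 1) * (p ^ j) ^ (k - 2)"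
    using p1 j(1) by (intro mult_mono power_mono) (auto simp: self_le_power)
  from order.trans[OF this j(2)] show ?thesis by (simp only: mult_1)
qed

lemma SL_faithful_degree_ge:
  assumes k: "3 \<le> k" and \<rho>: "faithful_rep (SL_mod k) d \<rho>"
  shows "p ^ (n - 1) * (p - 1) * (p ^ n) ^ (k - 2) \<le> d"
proof -
  let ?G = "SL_mod k" and ?U = "block_unipotent (k - 1) 1 (int (p ^ (n - 1)) \<cdot>\<^sub>m SL_root k 0)"
  have rep: "representation ?G d \<rho>" using \<rho> by (simp add: faithful_rep_def)
  have k1: "k - 1 + 1 = k" using k by simp
  have "?U \<in> SL_lift N k"
    by (rule block_unipotent_in_SL_lift[OF smult_carrier_mat[OF SL_root_carrier]]) (use k in simp)
  moreover have "reduce N ?U \<noteq> reduce N (1\<^sub>m k)"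
    using block_unipotent_multiple_ne_one[OF SL_root_carrier, of k 0] k unfolding k1 by (simp add: SL_root_def)
  ultimately have "\<rho> (reduce N ?U) \<noteq> 1\<^sub>m d"
    by (intro faithful_rep_ne_one[OF \<rho>]) (simp_all add: mod_group_one, simp add: mod_group_def)
  from SL_degree_ge[OF k rep this] obtain j where j: "n - 1 < j" "j \<le> n" "p ^ (j - 1) * (p - 1) * (p ^ j) ^ (k - 2) \<le> d"
    by blast
  have "j = n" using j by simp
  then show ?thesis using j by simp
qed

lemma Sp_nontrivial_degree_ge:
  assumes k: "0 < k" and p2: "p \<noteq> 2" and \<rho>: "nontrivial_rep (Sp_mod k) d \<rho>"
  shows "(p - 1) * p ^ (k - 1) \<le> 2 * d"
proof -
  let ?G = "Sp_mod k" and ?S = "Sp_root k 0"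
  let ?K = "kernel ?G (GL_complex d) \<rho>"
  have rep: "representation ?G d \<rho>" using \<rho> by (simp add: nontrivial_rep_def)
  have sm: "int (p ^ 0) \<cdot>\<^sub>m ?S = ?S" by (intro eq_matI) auto
  have T: "transvection k (unit_vec (2 * k) 0) s = block_unipotent k k ((- s) \<cdot>\<^sub>m ?S)" for s
    using k by (intro eq_matI) (auto simp: transvection_def block_unipotent_def Sp_root_def)
  have "\<rho> (reduce N (block_unipotent k k (int (p ^ 0) \<cdot>\<^sub>m ?S))) \<noteq> 1\<^sub>m d"
  proof
    assume triv: "\<rho> (reduce N (block_unipotent k k (int (p ^ 0) \<cdot>\<^sub>m ?S))) = 1\<^sub>m d"
    have norm: "normal ?K ?G" by (rule representation_kernel_normal[OF group_Sp_lift rep])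
    have "block_unipotent k k ?S \<in> Sp_lift N k"
      by (rule block_unipotent_in_Sp_lift) (auto simp: Sp_root_def)
    then have K: "reduce N (block_unipotent k k ?S) \<in> ?K"
      using triv unfolding sm by (simp add: kernel_def GL_complex_simps mod_group_def)
    have sub: "subgroup ?K (mod_group N (k + k) (Sp_lift N k))"
      using normal_imp_subgroup[OF norm] by (simp add: mult_2)
    have "reduce N (transvection k (unit_vec (2 * k) 0) s) \<in> ?K" for s
      unfolding T by (rule block_unipotent_multiples_in_subgroup[OF sub Sp_root_carrier K])
    then have "?K = carrier ?G" by (rule Sp_normal_closure_transvection[OF k norm])
    then show False using \<rho> by (auto simp: nontrivial_rep_def kernel_def)
  qed
  from Sp_degree_ge[OF k p2 rep this] obtain j where j: "0 < j" "p ^ (j - 1) * (p - 1) * (p ^ j) ^ (k - 1) \<le> 2 * d"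
    by blast
  have p1: "1 \<le> p" using prime_gt_1_nat[OF prime] by simp
  have "1 * (p - 1) * p ^ (k - 1) \<le> p ^ (j - 1) * (p - 1) * (p ^ j) ^ (k - 1)"
    using p1 j(1) by (intro mult_mono power_mono) (auto simp: self_le_power)
  from order.trans[OF this j(2)] show ?thesis by (simp only: mult_1)
qed

lemma Sp_faithful_degree_ge:
  assumes k: "0 < k" and p2: "p \<noteq> 2" and \<rho>: "faithful_rep (Sp_mod k) d \<rho>"
  shows "p ^ (n - 1) * (p - 1) * (p ^ n) ^ (k - 1) \<le> 2 * d"
proof -
  let ?G = "Sp_mod k" and ?U = "block_unipotent k k (int (p ^ (n - 1)) \<cdot>\<^sub>m Sp_root k 0)"
  have rep: "representation ?G d \<rho>" using \<rho> by (simp add: faithful_rep_def)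
  have "?U \<in> Sp_lift N k"
    by (rule block_unipotent_in_Sp_lift) (auto simp: Sp_root_def)
  moreover have "reduce N ?U \<noteq> reduce N (1\<^sub>m (2 * k))"
    using block_unipotent_multiple_ne_one[OF Sp_root_carrier, of k 0] k by (simp add: Sp_root_def mult_2)
  ultimately have "\<rho> (reduce N ?U) \<noteq> 1\<^sub>m d"
    by (intro faithful_rep_ne_one[OF \<rho>]) (simp_all add: mod_group_one, simp add: mod_group_def)
  from Sp_degree_ge[OF k p2 rep this] obtain j where j: "n - 1 < j" "j \<le> n" "p ^ (j - 1) * (p - 1) * (p ^ j) ^ (k - 1) \<le> 2 * d"
    by blast
  have "j = n" using j by simp
  then show ?thesis using j by simp
qed

lemma ex_faithful_and_nontrivial_rep:
  assumes G: "group (mod_group N k L)" and L: "L \<subseteq> carrier_mat k k" and A: "A \<in> L" "reduce N A \<noteq> reduce N (1\<^sub>m k)"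
  shows "(\<exists>d \<rho>. faithful_rep (mod_group N k L) d \<rho>) \<and> (\<exists>d \<rho>. nontrivial_rep (mod_group N k L) d \<rho>)"
proof -
  obtain d \<rho> where f: "faithful_rep (mod_group N k L) d \<rho>" using ex_faithful_rep[OF G finite_mod_group[OF L]] by blast
  have "reduce N A \<in> carrier (mod_group N k L)" "reduce N A \<noteq> \<one>\<^bsub>mod_group N k L\<^esub>"
    using A by (simp_all add: mod_group_one) (simp add: mod_group_def)
  from faithful_imp_nontrivial_rep[OF f this] show ?thesis using f by blast
qed

lemma degree_bounds:
  assumes \<G>: "admissible \<G>" and p2: "p \<noteq> 2"
  shows "nontrivial_rep (points \<G> (residue_ring N)) d \<rho> \<Longrightarrow> h_bound \<G> p \<le> real d"
    and "faithful_rep (points \<G> (residue_ring N)) d \<rho> \<Longrightarrow> hf_bound \<G> p n \<le> real d"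
    and "(\<exists>d \<rho>. faithful_rep (points \<G> (residue_ring N)) d \<rho>) \<and> (\<exists>d \<rho>. nontrivial_rep (points \<G> (residue_ring N)) d \<rho>)"
proof -
  let ?G = "points \<G> (residue_ring N)"
  have p1: "1 \<le> p" using prime_gt_1_nat[OF prime] by simp
  have tot: "real p ^ n - real p ^ (n - 1) = real (p ^ (n - 1) * (p - 1))"
    using n_pos p1 by (cases n) (simp_all add: of_nat_diff algebra_simps)
  consider (SL) k where "\<G> = SL k" "3 \<le> k"
    | (Sp) k where "0 < k" "?G = Sp_mod k"
        "h_bound \<G> p = 1 / 2 * (real p - 1) * real p ^ (k - 1)"
        "hf_bound \<G> p n = 1 / 2 * (real p ^ n - real p ^ (n - 1)) * real p ^ ((k - 1) * n)"
  proof (cases \<G>)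
    case (SL k)
    show ?thesis
    proof (cases "k = 2")
      case True
      then show ?thesis using that(2)[of 1] SL SL_2_eq_Sp_2 Sp_over_eq[of 1] by simp
    next
      case False
      then show ?thesis using that(1)[of k] SL \<G> by simp
    qed
  next
    case (Sp k)
    then show ?thesis using that(2)[of k] \<G> Sp_over_eq[of k] by simp
  qed
  then have "(nontrivial_rep ?G d \<rho> \<longrightarrow> h_bound \<G> p \<le> real d) \<and>
    (faithful_rep ?G d \<rho> \<longrightarrow> hf_bound \<G> p n \<le> real d) \<and>
    (\<exists>d \<rho>. faithful_rep ?G d \<rho>) \<and> (\<exists>d \<rho>. nontrivial_rep ?G d \<rho>)"
  proof cases
    case SL
    have pts: "?G = SL_mod k" using SL by (simp add: SL_over_eq)
    have k2: "k - 1 = Suc (k - 2)" using SL by simp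
    have pk: "real p ^ (k - 1) = real p * real p ^ (k - 2)" unfolding k2 by simp
    have h: "h_bound \<G> p = real ((p - 1) * p ^ (k - 2))"
      unfolding SL(1) h_bound.simps pk using SL(2) p1 by (simp add: of_nat_diff algebra_simps)
    have hf: "hf_bound \<G> p n = real (p ^ (n - 1) * (p - 1) * (p ^ n) ^ (k - 2))"
      unfolding SL(1) hf_bound.simps tot using SL(2) by (simp add: power_mult[symmetric] mult.commute[of n])
    have "h_bound \<G> p \<le> real d" if "nontrivial_rep ?G d \<rho>"
      unfolding h using SL_nontrivial_degree_ge[OF SL(2)] that unfolding pts of_nat_le_iff by blast
    moreover have "hf_bound \<G> p n \<le> real d" if "faithful_rep ?G d \<rho>"
      unfolding hf using SL_faithful_degree_ge[OF SL(2)] that unfolding pts of_nat_le_iff by blast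
    moreover have "(\<exists>d \<rho>. faithful_rep ?G d \<rho>) \<and> (\<exists>d \<rho>. nontrivial_rep ?G d \<rho>)"
      unfolding pts
    proof (rule ex_faithful_and_nontrivial_rep[OF group_SL_lift])
      show "block_unipotent (k - 1) 1 (int (p ^ (n - 1)) \<cdot>\<^sub>m SL_root k 0) \<in> SL_lift N k"
        by (rule block_unipotent_in_SL_lift[OF smult_carrier_mat[OF SL_root_carrier]]) (use SL in simp)
      have "k - 1 + 1 = k" using SL by simp
      then show "reduce N (block_unipotent (k - 1) 1 (int (p ^ (n - 1)) \<cdot>\<^sub>m SL_root k 0)) \<noteq> reduce N (1\<^sub>m k)"
        using block_unipotent_multiple_ne_one[OF SL_root_carrier, of k 0] SL by (simp add: SL_root_def)
    qed (auto simp: SL_lift_def)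
    ultimately show ?thesis by blast
  next
    case Sp
    have "h_bound \<G> p \<le> real d" if "nontrivial_rep ?G d \<rho>"
    proof -
      have "real ((p - 1) * p ^ (k - 1)) \<le> real (2 * d)"
        using Sp_nontrivial_degree_ge[OF Sp(1) p2] that unfolding Sp(2) of_nat_le_iff by blast
      then show ?thesis using p1 by (simp add: Sp(3) of_nat_diff)
    qed
    moreover have "hf_bound \<G> p n \<le> real d" if "faithful_rep ?G d \<rho>"
    proof -
      have "real (p ^ (n - 1) * (p - 1) * (p ^ n) ^ (k - 1)) \<le> real (2 * d)"
        using Sp_faithful_degree_ge[OF Sp(1) p2] that unfolding Sp(2) of_nat_le_iff by blast
      then show ?thesis
        unfolding Sp(4) tot by (simp add: power_mult[symmetric] mult.commute[of n])
    qed
    moreover have "(\<exists>d \<rho>. faithful_rep ?G d \<rho>) \<and> (\<exists>d \<rho>. nontrivial_rep ?G d \<rho>)"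
      unfolding Sp(2)
    proof (rule ex_faithful_and_nontrivial_rep[OF group_Sp_lift])
      show "block_unipotent k k (int (p ^ (n - 1)) \<cdot>\<^sub>m Sp_root k 0) \<in> Sp_lift N k"
        by (rule block_unipotent_in_Sp_lift) (auto simp: Sp_root_def)
      show "reduce N (block_unipotent k k (int (p ^ (n - 1)) \<cdot>\<^sub>m Sp_root k 0)) \<noteq> reduce N (1\<^sub>m (2 * k))"
        using block_unipotent_multiple_ne_one[OF Sp_root_carrier, of k 0] Sp(1) by (simp add: Sp_root_def mult_2)
    qed (auto simp: Sp_lift_def)
    ultimately show ?thesis by blast
  qed
  then show "nontrivial_rep ?G d \<rho> \<Longrightarrow> h_bound \<G> p \<le> real d"
    and "faithful_rep ?G d \<rho> \<Longrightarrow> hf_bound \<G> p n \<le> real d"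
    and "(\<exists>d \<rho>. faithful_rep ?G d \<rho>) \<and> (\<exists>d \<rho>. nontrivial_rep ?G d \<rho>)"
    by blast+
qed

end

text \<open>
  The constant is the one of the symplectic groups, where \<open>(p - 1) / 2 \<ge> p / 3\<close> for \<open>p \<ge> 3\<close> with equality for \<open>p = 3\<close>.
\<close>
lemma h_bound_ge:
  assumes "admissible \<G>" "p \<ge> 3"
  shows "1 / 3 * real p ^ group_rank \<G> \<le> h_bound \<G> p"
proof (cases \<G>)
  case (SL k)
  show ?thesis
  proof (cases "k = 2")
    case True
    then show ?thesis using SL assms by simp
  next
    case False
    then have k: "k - 1 = Suc (k - 2)" using SL assms by simp
    have "1 / 3 * real p * real p ^ (k - 2) \<le> (real p - 1) * real p ^ (k - 2)"
      using assms by (intro mult_right_mono) auto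
    moreover have pk: "real p ^ (k - 1) = real p * real p ^ (k - 2)" unfolding k by simp
    ultimately show ?thesis
      unfolding SL group_rank.simps h_bound.simps pk using False by (simp add: algebra_simps)
  qed
next
  case (Sp k)
  then have k: "k = Suc (k - 1)" using assms by simp
  have "1 / 3 * real p * real p ^ (k - 1) \<le> 1 / 2 * (real p - 1) * real p ^ (k - 1)"
    using assms by (intro mult_right_mono) auto
  moreover have "real p ^ k = real p * real p ^ (k - 1)" by (subst k) simp
  ultimately show ?thesis using Sp by simp
qed

theorem theorem1:
  shows "(\<forall>(\<G> :: group_type) (p :: nat) (n :: nat).
      admissible \<G> \<and> prime p \<and> p \<ge> 3 \<and> n \<ge> 1 \<longrightarrow>
        (\<forall>d \<rho>. nontrivial_rep (points \<G> (residue_ring (int p ^ n))) d \<rho> \<longrightarrow> real d \<ge> h_bound \<G> p) \<and>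
        (\<forall>d \<rho>. faithful_rep (points \<G> (residue_ring (int p ^ n))) d \<rho> \<longrightarrow> real d \<ge> hf_bound \<G> p n) \<and>
        real (min_degree (points \<G> (residue_ring (int p ^ n)))) \<ge> h_bound \<G> p \<and>
        real (min_faithful_degree (points \<G> (residue_ring (int p ^ n)))) \<ge> hf_bound \<G> p n) \<and>
    (\<exists>c :: real. c > 0 \<and> (\<forall>(\<G> :: group_type) (p :: nat) (n :: nat).
      admissible \<G> \<and> prime p \<and> p \<ge> 3 \<and> n \<ge> 1 \<longrightarrow>
        real (min_degree (points \<G> (residue_ring (int p ^ n)))) \<ge> c * real p ^ group_rank \<G>))"
proof -
  have main: "(\<forall>d \<rho>. nontrivial_rep (points \<G> (residue_ring (int p ^ n))) d \<rho> \<longrightarrow> real d \<ge> h_bound \<G> p) \<and>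
        (\<forall>d \<rho>. faithful_rep (points \<G> (residue_ring (int p ^ n))) d \<rho> \<longrightarrow> real d \<ge> hf_bound \<G> p n) \<and>
        real (min_degree (points \<G> (residue_ring (int p ^ n)))) \<ge> h_bound \<G> p \<and>
        real (min_faithful_degree (points \<G> (residue_ring (int p ^ n)))) \<ge> hf_bound \<G> p n"
    if "admissible \<G>" "prime p" "p \<ge> 3" "n \<ge> 1" for \<G> p n
  proof -
    interpret prime_power_modulus p n using that by unfold_locales auto
    have p2: "p \<noteq> 2" using that by simp
    note b = degree_bounds[OF that(1) p2]
    have "h_bound \<G> p \<le> real (min_degree (points \<G> (residue_ring N)))"
      by (rule min_degree_ge) (use b in blast)+
    moreover have "hf_bound \<G> p n \<le> real (min_faithful_degree (points \<G> (residue_ring N)))"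
      by (rule min_faithful_degree_ge) (use b in blast)+
    ultimately show ?thesis using b by blast
  qed
  have "1 / 3 * real p ^ group_rank \<G> \<le> real (min_degree (points \<G> (residue_ring (int p ^ n))))"
    if "admissible \<G>" "prime p" "p \<ge> 3" "n \<ge> 1" for \<G> p n
    using main[OF that] h_bound_ge[OF that(1,3)] by linarith
  then have "\<exists>c :: real. c > 0 \<and> (\<forall>\<G> p n. admissible \<G> \<and> prime p \<and> p \<ge> 3 \<and> n \<ge> 1 \<longrightarrow>
        real (min_degree (points \<G> (residue_ring (int p ^ n)))) \<ge> c * real p ^ group_rank \<G>)"
    by (intro exI[of _ "1 / 3"]) auto
  then show ?thesis using main by blast
qed

end
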